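(* Let $\mathcal{A}$ be an abelian category with enough projectives satisfying Grothendieck's AB 5 axiom, and let $\mathcal{D}$ be its derived category. Let $\mathcal{I}$ be the ideal of ghosts in $\mathcal{D}$ and let $\mathcal{P}$ be the class of ghost projective complexes. Then the pair $(\mathcal{P},\mathcal{I})$ forms a projective class in $\mathcal{D}$.
   Context: AB 5: set-indexed colimits exist in $\mathcal{A}$ and filtered colimits are exact. Complexes are unbounded $\mathbb{Z}$-graded chain complexes of objects of $\mathcal{A}$; $\mathcal{D}$ is obtained from the category of chain complexes by inverting quasi-isomorphisms, and is triangulated. A ghost is a map in $\mathcal{D}$ which is zero in homology. An object of $\mathcal{D}$ is ghost projective if it is isomorphic in $\mathcal{D}$ to a complex of projectives with zero differential. A projective class in a triangulated category is a pair $(\mathcal{P},\mathcal{I})$ of a class of objects and a class of maps such that: $\mathcal{I}$ is exactly the class of maps $X\to Y$ for which all composites $P\to X\to Y$ with $P$ in $\mathcal{P}$ are zero; $\mathcal{P}$ is exactly the class of objects $P$ for which all composites $P\to X\to Y$ with $X\to Y$ in $\mathcal{I}$ are zero; and each object $X$ lies in an exact triangle $P\to X\to Y\to\Sigma P$ with $P$ in $\mathcal{P}$ and $X\to Y$ in $\mathcal{I}$. *)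

theory Defs
  imports "HOL-Algebra.Group" "HOL-Library.Infinite_Typeclass"
begin

section \<open>Categories and functors\<close>

text \<open>
  Arrows carry their domain and codomain, so composition does not mention objects. Its value
  on pairs that are not composable is never used.
\<close>

record ('o, 'm) category_data =
  Obj :: "'o set"
  Arr :: "'m set"
  Dom :: "'m \<Rightarrow> 'o"
  Cod :: "'m \<Rightarrow> 'o"
  Id :: "'o \<Rightarrow> 'm"
  Comp :: "'m \<Rightarrow> 'm \<Rightarrow> 'm" (infixr "\<cdot>\<index>" 70)

definition Hom :: "('o, 'm, 'z) category_data_scheme \<Rightarrow> 'o \<Rightarrow> 'o \<Rightarrow> 'm set" where
  "Hom C X Y = {f \<in> Arr C. Dom C f = X \<and> Cod C f = Y}"

locale category =
  fixes C (structure)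
  assumes Dom_Obj: "f \<in> Arr C \<Longrightarrow> Dom C f \<in> Obj C"
    and Cod_Obj: "f \<in> Arr C \<Longrightarrow> Cod C f \<in> Obj C"
    and Id_Hom: "X \<in> Obj C \<Longrightarrow> Id C X \<in> Hom C X X"
    and Comp_Hom: "f \<in> Hom C X Y \<Longrightarrow> g \<in> Hom C Y Z \<Longrightarrow> g \<cdot> f \<in> Hom C X Z"
    and Comp_Id: "f \<in> Hom C X Y \<Longrightarrow> f \<cdot> Id C X = f"
    and Id_Comp: "f \<in> Hom C X Y \<Longrightarrow> Id C Y \<cdot> f = f"
    and Comp_assoc: "f \<in> Hom C W X \<Longrightarrow> g \<in> Hom C X Y \<Longrightarrow> h \<in> Hom C Y Z
                      \<Longrightarrow> h \<cdot> (g \<cdot> f) = (h \<cdot> g) \<cdot> f"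

definition mono_arr :: "('o, 'm, 'z) category_data_scheme \<Rightarrow> 'm \<Rightarrow> bool" where
  "mono_arr C m \<longleftrightarrow> m \<in> Arr C \<and>
     (\<forall>W. \<forall>g \<in> Hom C W (Dom C m). \<forall>h \<in> Hom C W (Dom C m).
        m \<cdot>\<^bsub>C\<^esub> g = m \<cdot>\<^bsub>C\<^esub> h \<longrightarrow> g = h)"

definition epi_arr :: "('o, 'm, 'z) category_data_scheme \<Rightarrow> 'm \<Rightarrow> bool" where
  "epi_arr C e \<longleftrightarrow> e \<in> Arr C \<and>
     (\<forall>W. \<forall>g \<in> Hom C (Cod C e) W. \<forall>h \<in> Hom C (Cod C e) W.
        g \<cdot>\<^bsub>C\<^esub> e = h \<cdot>\<^bsub>C\<^esub> e \<longrightarrow> g = h)"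

definition inverse_pair :: "('o, 'm, 'z) category_data_scheme \<Rightarrow> 'm \<Rightarrow> 'm \<Rightarrow> bool" where
  "inverse_pair C f g \<longleftrightarrow> f \<in> Arr C \<and> g \<in> Hom C (Cod C f) (Dom C f) \<and>
     g \<cdot>\<^bsub>C\<^esub> f = Id C (Dom C f) \<and> f \<cdot>\<^bsub>C\<^esub> g = Id C (Cod C f)"

definition iso_arr :: "('o, 'm, 'z) category_data_scheme \<Rightarrow> 'm \<Rightarrow> bool" where
  "iso_arr C f \<longleftrightarrow> (\<exists>g. inverse_pair C f g)"

definition inverse_arr :: "('o, 'm, 'z) category_data_scheme \<Rightarrow> 'm \<Rightarrow> 'm" where
  "inverse_arr C f = (THE g. inverse_pair C f g)"

definition iso_obj :: "('o, 'm, 'z) category_data_scheme \<Rightarrow> 'o \<Rightarrow> 'o \<Rightarrow> bool" where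
  "iso_obj C X Y \<longleftrightarrow> (\<exists>f \<in> Hom C X Y. iso_arr C f)"

definition projective_obj :: "('o, 'm, 'z) category_data_scheme \<Rightarrow> 'o \<Rightarrow> bool" where
  "projective_obj C P \<longleftrightarrow> P \<in> Obj C \<and>
     (\<forall>e f. epi_arr C e \<and> f \<in> Hom C P (Cod C e) \<longrightarrow>
        (\<exists>g \<in> Hom C P (Dom C e). e \<cdot>\<^bsub>C\<^esub> g = f))"

definition enough_projectives :: "('o, 'm, 'z) category_data_scheme \<Rightarrow> bool" where
  "enough_projectives C \<longleftrightarrow>
     (\<forall>X \<in> Obj C. \<exists>P. projective_obj C P \<and> (\<exists>e \<in> Hom C P X. epi_arr C e))"

definition is_functor ::
  "('i, 'j, 'y) category_data_scheme \<Rightarrow> ('o, 'm, 'z) category_data_scheme \<Rightarrow>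
   ('i \<Rightarrow> 'o) \<Rightarrow> ('j \<Rightarrow> 'm) \<Rightarrow> bool" where
  "is_functor J C Fo Fa \<longleftrightarrow>
     (\<forall>j \<in> Obj J. Fo j \<in> Obj C) \<and>
     (\<forall>i \<in> Obj J. \<forall>j \<in> Obj J. \<forall>u \<in> Hom J i j. Fa u \<in> Hom C (Fo i) (Fo j)) \<and>
     (\<forall>j \<in> Obj J. Fa (Id J j) = Id C (Fo j)) \<and>
     (\<forall>u \<in> Arr J. \<forall>v \<in> Arr J. Cod J u = Dom J v \<longrightarrow> Fa (v \<cdot>\<^bsub>J\<^esub> u) = Fa v \<cdot>\<^bsub>C\<^esub> Fa u)"

definition is_nat_trans ::
  "('i, 'j, 'y) category_data_scheme \<Rightarrow> ('o, 'm, 'z) category_data_scheme \<Rightarrow>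
   ('i \<Rightarrow> 'o) \<Rightarrow> ('j \<Rightarrow> 'm) \<Rightarrow> ('i \<Rightarrow> 'o) \<Rightarrow> ('j \<Rightarrow> 'm) \<Rightarrow> ('i \<Rightarrow> 'm) \<Rightarrow> bool" where
  "is_nat_trans J C Fo Fa Go Ga \<alpha> \<longleftrightarrow>
     (\<forall>j \<in> Obj J. \<alpha> j \<in> Hom C (Fo j) (Go j)) \<and>
     (\<forall>u \<in> Arr J. \<alpha> (Cod J u) \<cdot>\<^bsub>C\<^esub> Fa u = Ga u \<cdot>\<^bsub>C\<^esub> \<alpha> (Dom J u))"

definition is_cocone ::
  "('i, 'j, 'y) category_data_scheme \<Rightarrow> ('o, 'm, 'z) category_data_scheme \<Rightarrow>
   ('i \<Rightarrow> 'o) \<Rightarrow> ('j \<Rightarrow> 'm) \<Rightarrow> 'o \<Rightarrow> ('i \<Rightarrow> 'm) \<Rightarrow> bool" where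
  "is_cocone J C Fo Fa L \<iota> \<longleftrightarrow> L \<in> Obj C \<and>
     (\<forall>j \<in> Obj J. \<iota> j \<in> Hom C (Fo j) L) \<and>
     (\<forall>u \<in> Arr J. \<iota> (Cod J u) \<cdot>\<^bsub>C\<^esub> Fa u = \<iota> (Dom J u))"

definition is_colimit ::
  "('i, 'j, 'y) category_data_scheme \<Rightarrow> ('o, 'm, 'z) category_data_scheme \<Rightarrow>
   ('i \<Rightarrow> 'o) \<Rightarrow> ('j \<Rightarrow> 'm) \<Rightarrow> 'o \<Rightarrow> ('i \<Rightarrow> 'm) \<Rightarrow> bool" where
  "is_colimit J C Fo Fa L \<iota> \<longleftrightarrow> is_cocone J C Fo Fa L \<iota> \<and>
     (\<forall>M \<mu>. is_cocone J C Fo Fa M \<mu> \<longrightarrow>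
        (\<exists>!h. h \<in> Hom C L M \<and> (\<forall>j \<in> Obj J. h \<cdot>\<^bsub>C\<^esub> \<iota> j = \<mu> j)))"

definition filtered_category :: "('i, 'j, 'y) category_data_scheme \<Rightarrow> bool" where
  "filtered_category J \<longleftrightarrow> category J \<and> Obj J \<noteq> {} \<and>
     (\<forall>i \<in> Obj J. \<forall>j \<in> Obj J. \<exists>k \<in> Obj J. Hom J i k \<noteq> {} \<and> Hom J j k \<noteq> {}) \<and>
     (\<forall>i \<in> Obj J. \<forall>j \<in> Obj J. \<forall>u \<in> Hom J i j. \<forall>v \<in> Hom J i j.
        \<exists>k \<in> Obj J. \<exists>w \<in> Hom J j k. w \<cdot>\<^bsub>J\<^esub> u = w \<cdot>\<^bsub>J\<^esub> v)"


section \<open>Abelian categories\<close>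

record ('o, 'm) preadditive_data = "('o, 'm) category_data" +
  Add :: "'m \<Rightarrow> 'm \<Rightarrow> 'm" (infixl "\<oplus>\<index>" 65)
  Zero :: "'o \<Rightarrow> 'o \<Rightarrow> 'm"

definition hom_group :: "('o, 'm, 'z) preadditive_data_scheme \<Rightarrow> 'o \<Rightarrow> 'o \<Rightarrow> 'm monoid" where
  "hom_group A X Y = \<lparr>carrier = Hom A X Y, monoid.mult = Add A, one = Zero A X Y\<rparr>"

definition Neg :: "('o, 'm, 'z) preadditive_data_scheme \<Rightarrow> 'm \<Rightarrow> 'm" where
  "Neg A f = inv\<^bsub>hom_group A (Dom A f) (Cod A f)\<^esub> f"

locale preadditive_category = category A for A (structure) +
  assumes hom_comm_group: "X \<in> Obj A \<Longrightarrow> Y \<in> Obj A \<Longrightarrow> comm_group (hom_group A X Y)"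
    and Comp_Add: "f \<in> Hom A X Y \<Longrightarrow> g \<in> Hom A Y Z \<Longrightarrow> g' \<in> Hom A Y Z
                    \<Longrightarrow> (g \<oplus> g') \<cdot> f = (g \<cdot> f) \<oplus> (g' \<cdot> f)"
    and Add_Comp: "f \<in> Hom A X Y \<Longrightarrow> f' \<in> Hom A X Y \<Longrightarrow> g \<in> Hom A Y Z
                    \<Longrightarrow> g \<cdot> (f \<oplus> f') = (g \<cdot> f) \<oplus> (g \<cdot> f')"

definition zero_obj :: "('o, 'm, 'z) category_data_scheme \<Rightarrow> 'o \<Rightarrow> bool" where
  "zero_obj C N \<longleftrightarrow> N \<in> Obj C \<and>
     (\<forall>X \<in> Obj C. (\<exists>!f. f \<in> Hom C N X) \<and> (\<exists>!f. f \<in> Hom C X N))"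

record ('o, 'm) biproduct_data =
  bobj :: 'o
  inj1 :: 'm
  inj2 :: 'm
  prj1 :: 'm
  prj2 :: 'm

definition is_biproduct ::
  "('o, 'm, 'z) preadditive_data_scheme \<Rightarrow> 'o \<Rightarrow> 'o \<Rightarrow> ('o, 'm) biproduct_data \<Rightarrow> bool" where
  "is_biproduct A X Y B \<longleftrightarrow> bobj B \<in> Obj A \<and>
     inj1 B \<in> Hom A X (bobj B) \<and> inj2 B \<in> Hom A Y (bobj B) \<and>
     prj1 B \<in> Hom A (bobj B) X \<and> prj2 B \<in> Hom A (bobj B) Y \<and>
     prj1 B \<cdot>\<^bsub>A\<^esub> inj1 B = Id A X \<and> prj2 B \<cdot>\<^bsub>A\<^esub> inj2 B = Id A Y \<and>
     prj2 B \<cdot>\<^bsub>A\<^esub> inj1 B = Zero A X Y \<and> prj1 B \<cdot>\<^bsub>A\<^esub> inj2 B = Zero A Y X \<and>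
     (inj1 B \<cdot>\<^bsub>A\<^esub> prj1 B) \<oplus>\<^bsub>A\<^esub> (inj2 B \<cdot>\<^bsub>A\<^esub> prj2 B) = Id A (bobj B)"

definition biproduct ::
  "('o, 'm, 'z) preadditive_data_scheme \<Rightarrow> 'o \<Rightarrow> 'o \<Rightarrow> ('o, 'm) biproduct_data" where
  "biproduct A X Y = (SOME B. is_biproduct A X Y B)"

definition is_kernel :: "('o, 'm, 'z) preadditive_data_scheme \<Rightarrow> 'm \<Rightarrow> 'm \<Rightarrow> bool" where
  "is_kernel A f k \<longleftrightarrow> f \<in> Arr A \<and> k \<in> Arr A \<and> Cod A k = Dom A f \<and>
     f \<cdot>\<^bsub>A\<^esub> k = Zero A (Dom A k) (Cod A f) \<and>
     (\<forall>W. \<forall>g \<in> Hom A W (Dom A f). f \<cdot>\<^bsub>A\<^esub> g = Zero A W (Cod A f) \<longrightarrow>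
        (\<exists>!h. h \<in> Hom A W (Dom A k) \<and> k \<cdot>\<^bsub>A\<^esub> h = g))"

definition is_cokernel :: "('o, 'm, 'z) preadditive_data_scheme \<Rightarrow> 'm \<Rightarrow> 'm \<Rightarrow> bool" where
  "is_cokernel A f q \<longleftrightarrow> f \<in> Arr A \<and> q \<in> Arr A \<and> Dom A q = Cod A f \<and>
     q \<cdot>\<^bsub>A\<^esub> f = Zero A (Dom A f) (Cod A q) \<and>
     (\<forall>W. \<forall>g \<in> Hom A (Cod A f) W. g \<cdot>\<^bsub>A\<^esub> f = Zero A (Dom A f) W \<longrightarrow>
        (\<exists>!h. h \<in> Hom A (Cod A q) W \<and> h \<cdot>\<^bsub>A\<^esub> q = g))"

definition kernel_arr :: "('o, 'm, 'z) preadditive_data_scheme \<Rightarrow> 'm \<Rightarrow> 'm" where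
  "kernel_arr A f = (SOME k. is_kernel A f k)"

definition cokernel_arr :: "('o, 'm, 'z) preadditive_data_scheme \<Rightarrow> 'm \<Rightarrow> 'm" where
  "cokernel_arr A f = (SOME q. is_cokernel A f q)"

locale abelian_category = preadditive_category A for A (structure) +
  assumes ex_zero_obj: "\<exists>N. zero_obj A N"
    and ex_biproduct: "X \<in> Obj A \<Longrightarrow> Y \<in> Obj A \<Longrightarrow> \<exists>B. is_biproduct A X Y B"
    and ex_kernel: "f \<in> Arr A \<Longrightarrow> \<exists>k. is_kernel A f k"
    and ex_cokernel: "f \<in> Arr A \<Longrightarrow> \<exists>q. is_cokernel A f q"
    and mono_normal: "mono_arr A m \<Longrightarrow> \<exists>f. is_kernel A f m"
    and epi_normal: "epi_arr A e \<Longrightarrow> \<exists>f. is_cokernel A f e"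

definition short_exact :: "('o, 'm, 'z) preadditive_data_scheme \<Rightarrow> 'm \<Rightarrow> 'm \<Rightarrow> bool" where
  "short_exact A f g \<longleftrightarrow> mono_arr A f \<and> epi_arr A g \<and> is_kernel A g f"

text \<open>
  The type \<open>'i\<close> bounds the size of the diagrams: a category counts as small when its objects
  and its arrows can be taken from \<open>'i\<close>. This bound is unrelated to the types of objects and
  arrows of \<open>A\<close>. (Bounding diagrams by the collection of all arrows of \<open>A\<close> would, by
  Freyd's theorem, make a cocomplete \<open>A\<close> trivial.)
\<close>

definition has_colimits :: "'i itself \<Rightarrow> ('o, 'm, 'z) category_data_scheme \<Rightarrow> bool" where
  "has_colimits _ C \<longleftrightarrow>
     (\<forall>(J :: ('i, 'i) category_data) Fo Fa. category J \<and> is_functor J C Fo Fa \<longrightarrow>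
        (\<exists>L \<iota>. is_colimit J C Fo Fa L \<iota>))"

definition filtered_colimits_exact ::
  "'i itself \<Rightarrow> ('o, 'm, 'z) preadditive_data_scheme \<Rightarrow> bool" where
  "filtered_colimits_exact _ A \<longleftrightarrow>
     (\<forall>(J :: ('i, 'i) category_data) Fo Fa Go Ga Ko Ka \<alpha> \<beta> L \<kappa> M \<mu> N \<nu> a b.
        filtered_category J \<and>
        is_functor J A Fo Fa \<and> is_functor J A Go Ga \<and> is_functor J A Ko Ka \<and>
        is_nat_trans J A Fo Fa Go Ga \<alpha> \<and> is_nat_trans J A Go Ga Ko Ka \<beta> \<and>
        (\<forall>j \<in> Obj J. short_exact A (\<alpha> j) (\<beta> j)) \<and>
        is_colimit J A Fo Fa L \<kappa> \<and> is_colimit J A Go Ga M \<mu> \<and> is_colimit J A Ko Ka N \<nu> \<and>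
        a \<in> Hom A L M \<and> (\<forall>j \<in> Obj J. a \<cdot>\<^bsub>A\<^esub> \<kappa> j = \<mu> j \<cdot>\<^bsub>A\<^esub> \<alpha> j) \<and>
        b \<in> Hom A M N \<and> (\<forall>j \<in> Obj J. b \<cdot>\<^bsub>A\<^esub> \<mu> j = \<nu> j \<cdot>\<^bsub>A\<^esub> \<beta> j) \<longrightarrow>
        short_exact A a b)"

definition AB5 :: "'i itself \<Rightarrow> ('o, 'm, 'z) preadditive_data_scheme \<Rightarrow> bool" where
  "AB5 I A \<longleftrightarrow> has_colimits I A \<and> filtered_colimits_exact I A"


section \<open>Chain complexes and homology\<close>

record ('o, 'm) chain_complex =
  ob :: "int \<Rightarrow> 'o"
  diff :: "int \<Rightarrow> 'm"

definition is_chain_complex ::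
  "('o, 'm, 'z) preadditive_data_scheme \<Rightarrow> ('o, 'm) chain_complex \<Rightarrow> bool" where
  "is_chain_complex A X \<longleftrightarrow>
     (\<forall>n. ob X n \<in> Obj A \<and> diff X n \<in> Hom A (ob X n) (ob X (n - 1)) \<and>
          diff X (n - 1) \<cdot>\<^bsub>A\<^esub> diff X n = Zero A (ob X n) (ob X (n - 2)))"

type_synonym ('o, 'm) chain_map =
  "('o, 'm) chain_complex \<times> (int \<Rightarrow> 'm) \<times> ('o, 'm) chain_complex"

definition is_chain_map ::
  "('o, 'm, 'z) preadditive_data_scheme \<Rightarrow> ('o, 'm) chain_map \<Rightarrow> bool" where
  "is_chain_map A = (\<lambda>(X, f, Y). is_chain_complex A X \<and> is_chain_complex A Y \<and>
     (\<forall>n. f n \<in> Hom A (ob X n) (ob Y n) \<and>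
          diff Y n \<cdot>\<^bsub>A\<^esub> f n = f (n - 1) \<cdot>\<^bsub>A\<^esub> diff X n))"

definition Ch ::
  "('o, 'm, 'z) preadditive_data_scheme \<Rightarrow>
   (('o, 'm) chain_complex, ('o, 'm) chain_map) category_data" where
  "Ch A = \<lparr>Obj = {X. is_chain_complex A X},
           Arr = {f. is_chain_map A f},
           Dom = (\<lambda>(X, f, Y). X),
           Cod = (\<lambda>(X, f, Y). Y),
           Id = (\<lambda>X. (X, \<lambda>n. Id A (ob X n), X)),
           Comp = (\<lambda>(Y, g, Z) (X, f, Y'). (X, \<lambda>n. g n \<cdot>\<^bsub>A\<^esub> f n, Z))\<rparr>"

definition zero_map ::
  "('o, 'm, 'z) preadditive_data_scheme \<Rightarrow> ('o, 'm) chain_complex \<Rightarrow>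
   ('o, 'm) chain_complex \<Rightarrow> ('o, 'm) chain_map" where
  "zero_map A X Y = (X, \<lambda>n. Zero A (ob X n) (ob Y n), Y)"

definition cycle_incl ::
  "('o, 'm, 'z) preadditive_data_scheme \<Rightarrow> int \<Rightarrow> ('o, 'm) chain_complex \<Rightarrow> 'm" where
  "cycle_incl A n X = kernel_arr A (diff X n)"

definition cycles ::
  "('o, 'm, 'z) preadditive_data_scheme \<Rightarrow> int \<Rightarrow> ('o, 'm) chain_complex \<Rightarrow> 'o" where
  "cycles A n X = Dom A (cycle_incl A n X)"

definition boundary_arr ::
  "('o, 'm, 'z) preadditive_data_scheme \<Rightarrow> int \<Rightarrow> ('o, 'm) chain_complex \<Rightarrow> 'm" where
  "boundary_arr A n X =
     (THE b. b \<in> Hom A (ob X (n + 1)) (cycles A n X) \<and>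
             cycle_incl A n X \<cdot>\<^bsub>A\<^esub> b = diff X (n + 1))"

definition homology_proj ::
  "('o, 'm, 'z) preadditive_data_scheme \<Rightarrow> int \<Rightarrow> ('o, 'm) chain_complex \<Rightarrow> 'm" where
  "homology_proj A n X = cokernel_arr A (boundary_arr A n X)"

definition homology ::
  "('o, 'm, 'z) preadditive_data_scheme \<Rightarrow> int \<Rightarrow> ('o, 'm) chain_complex \<Rightarrow> 'o" where
  "homology A n X = Cod A (homology_proj A n X)"

definition cycle_map ::
  "('o, 'm, 'z) preadditive_data_scheme \<Rightarrow> int \<Rightarrow> ('o, 'm) chain_map \<Rightarrow> 'm" where
  "cycle_map A n = (\<lambda>(X, f, Y).
     THE z. z \<in> Hom A (cycles A n X) (cycles A n Y) \<and>
            cycle_incl A n Y \<cdot>\<^bsub>A\<^esub> z = f n \<cdot>\<^bsub>A\<^esub> cycle_incl A n X)"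

definition homology_map ::
  "('o, 'm, 'z) preadditive_data_scheme \<Rightarrow> int \<Rightarrow> ('o, 'm) chain_map \<Rightarrow> 'm" where
  "homology_map A n = (\<lambda>(X, f, Y).
     THE h. h \<in> Hom A (homology A n X) (homology A n Y) \<and>
            h \<cdot>\<^bsub>A\<^esub> homology_proj A n X = homology_proj A n Y \<cdot>\<^bsub>A\<^esub> cycle_map A n (X, f, Y))"

definition quasi_isos ::
  "('o, 'm, 'z) preadditive_data_scheme \<Rightarrow> ('o, 'm) chain_map set" where
  "quasi_isos A = {f \<in> Arr (Ch A). \<forall>n. iso_arr A (homology_map A n f)}"

definition shift_complex ::
  "('o, 'm, 'z) preadditive_data_scheme \<Rightarrow> ('o, 'm) chain_complex \<Rightarrow>
   ('o, 'm) chain_complex" where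
  "shift_complex A X = \<lparr>ob = (\<lambda>n. ob X (n - 1)), diff = (\<lambda>n. Neg A (diff X (n - 1)))\<rparr>"

definition shift_map ::
  "('o, 'm, 'z) preadditive_data_scheme \<Rightarrow> ('o, 'm) chain_map \<Rightarrow> ('o, 'm) chain_map" where
  "shift_map A = (\<lambda>(X, f, Y). (shift_complex A X, \<lambda>n. f (n - 1), shift_complex A Y))"

text \<open>
  The cone of \<open>f : X \<rightarrow> Y\<close> has \<open>Y\<^sub>n \<oplus> X\<^sub>n\<^sub>-\<^sub>1\<close> in degree \<open>n\<close>,
  with differential \<open>(y, x) \<mapsto> (d y + f x, - d x)\<close>.
\<close>

definition cone_summands ::
  "('o, 'm, 'z) preadditive_data_scheme \<Rightarrow> ('o, 'm) chain_map \<Rightarrow> int \<Rightarrow>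
   ('o, 'm) biproduct_data" where
  "cone_summands A = (\<lambda>(X, f, Y) n. biproduct A (ob Y n) (ob X (n - 1)))"

definition cone ::
  "('o, 'm, 'z) preadditive_data_scheme \<Rightarrow> ('o, 'm) chain_map \<Rightarrow> ('o, 'm) chain_complex" where
  "cone A = (\<lambda>(X, f, Y). let B = cone_summands A (X, f, Y) in
     \<lparr>ob = (\<lambda>n. bobj (B n)),
      diff = (\<lambda>n.
        (inj1 (B (n - 1)) \<cdot>\<^bsub>A\<^esub> diff Y n \<cdot>\<^bsub>A\<^esub> prj1 (B n)) \<oplus>\<^bsub>A\<^esub>
        (inj1 (B (n - 1)) \<cdot>\<^bsub>A\<^esub> f (n - 1) \<cdot>\<^bsub>A\<^esub> prj2 (B n)) \<oplus>\<^bsub>A\<^esub>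
        (inj2 (B (n - 1)) \<cdot>\<^bsub>A\<^esub> Neg A (diff X (n - 1)) \<cdot>\<^bsub>A\<^esub> prj2 (B n)))\<rparr>)"

definition cone_incl ::
  "('o, 'm, 'z) preadditive_data_scheme \<Rightarrow> ('o, 'm) chain_map \<Rightarrow> ('o, 'm) chain_map" where
  "cone_incl A = (\<lambda>(X, f, Y).
     (Y, \<lambda>n. inj1 (cone_summands A (X, f, Y) n), cone A (X, f, Y)))"

definition cone_proj ::
  "('o, 'm, 'z) preadditive_data_scheme \<Rightarrow> ('o, 'm) chain_map \<Rightarrow> ('o, 'm) chain_map" where
  "cone_proj A = (\<lambda>(X, f, Y).
     (cone A (X, f, Y), \<lambda>n. prj2 (cone_summands A (X, f, Y) n), shift_complex A X))"


section \<open>Inverting a set of arrows\<close>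

text \<open>
  The category obtained from \<open>C\<close> by formally inverting the arrows in \<open>W\<close> (Gabriel--Zisman).
  Its objects are those of \<open>C\<close>. Its arrows are zigzags of arrows of \<open>C\<close> and formal inverses of
  arrows in \<open>W\<close>, modulo the congruence that makes the embedding of \<open>C\<close> a functor and the
  formal inverses inverse to the arrows in \<open>W\<close>. In a zigzag \<open>(X, ls, Y)\<close> from \<open>X\<close> to \<open>Y\<close>, the
  letters are listed in order of travel, the one starting at \<open>X\<close> first.
\<close>

datatype 'm letter = Fwd 'm | Inv 'm

type_synonym ('o, 'm) zigzag = "'o \<times> 'm letter list \<times> 'o"

fun letter_in :: "('o, 'm, 'z) category_data_scheme \<Rightarrow> 'm set \<Rightarrow> 'm letter \<Rightarrow> bool" where
  "letter_in C W (Fwd f) \<longleftrightarrow> f \<in> Arr C"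
| "letter_in C W (Inv s) \<longleftrightarrow> s \<in> W"

fun letter_src :: "('o, 'm, 'z) category_data_scheme \<Rightarrow> 'm letter \<Rightarrow> 'o" where
  "letter_src C (Fwd f) = Dom C f"
| "letter_src C (Inv s) = Cod C s"

fun letter_tgt :: "('o, 'm, 'z) category_data_scheme \<Rightarrow> 'm letter \<Rightarrow> 'o" where
  "letter_tgt C (Fwd f) = Cod C f"
| "letter_tgt C (Inv s) = Dom C s"

fun is_zigzag ::
  "('o, 'm, 'z) category_data_scheme \<Rightarrow> 'm set \<Rightarrow> 'o \<Rightarrow> 'm letter list \<Rightarrow> 'o \<Rightarrow> bool" where
  "is_zigzag C W X [] Y \<longleftrightarrow> X \<in> Obj C \<and> X = Y"
| "is_zigzag C W X (l # ls) Y \<longleftrightarrow>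
     letter_in C W l \<and> letter_src C l = X \<and> is_zigzag C W (letter_tgt C l) ls Y"

definition zigzags :: "('o, 'm, 'z) category_data_scheme \<Rightarrow> 'm set \<Rightarrow> ('o, 'm) zigzag set" where
  "zigzags C W = {(X, ls, Y). is_zigzag C W X ls Y}"

inductive elem_reduction ::
  "('o, 'm, 'z) category_data_scheme \<Rightarrow> 'm set \<Rightarrow> 'm letter list \<Rightarrow> 'm letter list \<Rightarrow> bool"
  for C W where
  Comp: "f \<in> Arr C \<Longrightarrow> g \<in> Arr C \<Longrightarrow> Cod C f = Dom C g \<Longrightarrow>
         elem_reduction C W [Fwd f, Fwd g] [Fwd (g \<cdot>\<^bsub>C\<^esub> f)]"
| Id: "X \<in> Obj C \<Longrightarrow> elem_reduction C W [Fwd (Id C X)] []"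
| Fwd_Inv: "s \<in> W \<Longrightarrow> elem_reduction C W [Fwd s, Inv s] []"
| Inv_Fwd: "s \<in> W \<Longrightarrow> elem_reduction C W [Inv s, Fwd s] []"

definition zigzag_step ::
  "('o, 'm, 'z) category_data_scheme \<Rightarrow> 'm set \<Rightarrow> ('o, 'm) zigzag \<Rightarrow> ('o, 'm) zigzag \<Rightarrow> bool" where
  "zigzag_step C W p q \<longleftrightarrow> p \<in> zigzags C W \<and> q \<in> zigzags C W \<and>
     (\<exists>X Y us ls ls' vs. p = (X, us @ ls @ vs, Y) \<and> q = (X, us @ ls' @ vs, Y) \<and>
        elem_reduction C W ls ls')"

definition zigzag_rel ::
  "('o, 'm, 'z) category_data_scheme \<Rightarrow> 'm set \<Rightarrow> (('o, 'm) zigzag \<times> ('o, 'm) zigzag) set" where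
  "zigzag_rel C W = {(p, q). p \<in> zigzags C W \<and> q \<in> zigzags C W \<and> equivclp (zigzag_step C W) p q}"

definition zigzag_class ::
  "('o, 'm, 'z) category_data_scheme \<Rightarrow> 'm set \<Rightarrow> ('o, 'm) zigzag \<Rightarrow> ('o, 'm) zigzag set" where
  "zigzag_class C W p = zigzag_rel C W `` {p}"

definition zigzag_join :: "('o, 'm) zigzag \<Rightarrow> ('o, 'm) zigzag \<Rightarrow> ('o, 'm) zigzag" where
  "zigzag_join = (\<lambda>(X, us, Y) (Y', vs, Z). (X, us @ vs, Z))"

definition localization ::
  "('o, 'm, 'z) category_data_scheme \<Rightarrow> 'm set \<Rightarrow> ('o, ('o, 'm) zigzag set) category_data" where
  "localization C W =
     \<lparr>Obj = Obj C,
      Arr = zigzags C W // zigzag_rel C W,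
      Dom = (\<lambda>\<phi>. the_elem ((\<lambda>(X, ls, Y). X) ` \<phi>)),
      Cod = (\<lambda>\<phi>. the_elem ((\<lambda>(X, ls, Y). Y) ` \<phi>)),
      Id = (\<lambda>X. zigzag_class C W (X, [], X)),
      Comp = (\<lambda>\<psi> \<phi>. \<Union>p \<in> \<phi>. \<Union>q \<in> \<psi>. zigzag_class C W (zigzag_join p q))\<rparr>"

definition loc_functor ::
  "('o, 'm, 'z) category_data_scheme \<Rightarrow> 'm set \<Rightarrow> 'm \<Rightarrow> ('o, 'm) zigzag set" where
  "loc_functor C W f = zigzag_class C W (Dom C f, [Fwd f], Cod C f)"


section \<open>Triangles and projective classes\<close>

record ('o, 'm) triangulated_data = "('o, 'm) category_data" +
  tzero :: "'o \<Rightarrow> 'o \<Rightarrow> 'm"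
  susp_obj :: "'o \<Rightarrow> 'o"
  susp_arr :: "'m \<Rightarrow> 'm"
  exact_triangles :: "('m \<times> 'm \<times> 'm) set"

definition projective_class ::
  "('o, 'm, 'z) triangulated_data_scheme \<Rightarrow> 'o set \<Rightarrow> 'm set \<Rightarrow> bool" where
  "projective_class T \<P> \<I> \<longleftrightarrow>
     \<I> = {f \<in> Arr T. \<forall>P \<in> \<P>. \<forall>g \<in> Hom T P (Dom T f). f \<cdot>\<^bsub>T\<^esub> g = tzero T P (Cod T f)} \<and>
     \<P> = {P \<in> Obj T. \<forall>f \<in> \<I>. \<forall>g \<in> Hom T P (Dom T f). f \<cdot>\<^bsub>T\<^esub> g = tzero T P (Cod T f)} \<and>
     (\<forall>X \<in> Obj T. \<exists>P \<in> \<P>. \<exists>Y \<in> Obj T. \<exists>u \<in> Hom T P X. \<exists>v \<in> Hom T X Y.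
        \<exists>w \<in> Hom T Y (susp_obj T P). (u, v, w) \<in> exact_triangles T \<and> v \<in> \<I>)"


section \<open>The derived category\<close>

type_synonym ('o, 'm) derived_arr =
  "(('o, 'm) chain_complex, ('o, 'm) chain_map) zigzag set"

definition derived_loc ::
  "('o, 'm, 'z) preadditive_data_scheme \<Rightarrow>
   (('o, 'm) chain_complex, ('o, 'm) derived_arr) category_data" where
  "derived_loc A = localization (Ch A) (quasi_isos A)"

definition derived_functor_Q ::
  "('o, 'm, 'z) preadditive_data_scheme \<Rightarrow> ('o, 'm) chain_map \<Rightarrow> ('o, 'm) derived_arr" where
  "derived_functor_Q A = loc_functor (Ch A) (quasi_isos A)"

definition shift_zigzag ::
  "('o, 'm, 'z) preadditive_data_scheme \<Rightarrow>
   (('o, 'm) chain_complex, ('o, 'm) chain_map) zigzag \<Rightarrow>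
   (('o, 'm) chain_complex, ('o, 'm) chain_map) zigzag" where
  "shift_zigzag A = (\<lambda>(X, ls, Y).
     (shift_complex A X, map (map_letter (shift_map A)) ls, shift_complex A Y))"

definition shift_derived ::
  "('o, 'm, 'z) preadditive_data_scheme \<Rightarrow> ('o, 'm) derived_arr \<Rightarrow> ('o, 'm) derived_arr" where
  "shift_derived A \<phi> = (\<Union>p \<in> \<phi>. zigzag_class (Ch A) (quasi_isos A) (shift_zigzag A p))"

text \<open>The exact triangles are those isomorphic in the derived category to cone triangles.\<close>

definition derived_triangles ::
  "('o, 'm, 'z) preadditive_data_scheme \<Rightarrow>
   (('o, 'm) derived_arr \<times> ('o, 'm) derived_arr \<times> ('o, 'm) derived_arr) set" where
  "derived_triangles A = (let D = derived_loc A; Q = derived_functor_Q A in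
     {(u, v, w). \<exists>X Y Z. u \<in> Hom D X Y \<and> v \<in> Hom D Y Z \<and> w \<in> Hom D Z (shift_complex A X) \<and>
        (\<exists>X' Y' f a b c. f \<in> Hom (Ch A) X' Y' \<and>
           a \<in> Hom D X X' \<and> iso_arr D a \<and>
           b \<in> Hom D Y Y' \<and> iso_arr D b \<and>
           c \<in> Hom D Z (cone A f) \<and> iso_arr D c \<and>
           b \<cdot>\<^bsub>D\<^esub> u = Q f \<cdot>\<^bsub>D\<^esub> a \<and>
           c \<cdot>\<^bsub>D\<^esub> v = Q (cone_incl A f) \<cdot>\<^bsub>D\<^esub> b \<and>
           shift_derived A a \<cdot>\<^bsub>D\<^esub> w = Q (cone_proj A f) \<cdot>\<^bsub>D\<^esub> c)})"

definition derived_category ::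
  "('o, 'm, 'z) preadditive_data_scheme \<Rightarrow>
   (('o, 'm) chain_complex, ('o, 'm) derived_arr) triangulated_data" where
  "derived_category A = category_data.extend (derived_loc A)
     (triangulated_data.fields
        (\<lambda>X Y. derived_functor_Q A (zero_map A X Y))
        (shift_complex A)
        (shift_derived A)
        (derived_triangles A))"

fun homology_letter ::
  "('o, 'm, 'z) preadditive_data_scheme \<Rightarrow> int \<Rightarrow> ('o, 'm) chain_map letter \<Rightarrow> 'm" where
  "homology_letter A n (Fwd f) = homology_map A n f"
| "homology_letter A n (Inv s) = inverse_arr A (homology_map A n s)"

definition homology_zigzag ::
  "('o, 'm, 'z) preadditive_data_scheme \<Rightarrow> int \<Rightarrow>
   (('o, 'm) chain_complex, ('o, 'm) chain_map) zigzag \<Rightarrow> 'm" where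
  "homology_zigzag A n = (\<lambda>(X, ls, Y).
     foldl (\<lambda>h l. homology_letter A n l \<cdot>\<^bsub>A\<^esub> h) (Id A (homology A n X)) ls)"

definition homology_derived ::
  "('o, 'm, 'z) preadditive_data_scheme \<Rightarrow> int \<Rightarrow> ('o, 'm) derived_arr \<Rightarrow> 'm" where
  "homology_derived A n \<phi> = the_elem (homology_zigzag A n ` \<phi>)"

definition ghosts :: "('o, 'm, 'z) preadditive_data_scheme \<Rightarrow> ('o, 'm) derived_arr set" where
  "ghosts A = {\<phi> \<in> Arr (derived_category A). \<forall>n. homology_derived A n \<phi> =
     Zero A (homology A n (Dom (derived_category A) \<phi>))
            (homology A n (Cod (derived_category A) \<phi>))}"

definition ghost_projectives ::
  "('o, 'm, 'z) preadditive_data_scheme \<Rightarrow> ('o, 'm) chain_complex set" where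
  "ghost_projectives A = {X \<in> Obj (derived_category A). \<exists>P. is_chain_complex A P \<and>
     (\<forall>n. projective_obj A (ob P n) \<and> diff P n = Zero A (ob P n) (ob P (n - 1))) \<and>
     iso_obj (derived_category A) X P}"

end

theory Submission
  imports Defs
begin

text \<open>
  Enough projectives allow homology to be computed with generalized elements: for a projective
  \<open>T\<close>, arrows from \<open>T\<close> to \<open>H\<^sub>n(X)\<close> are cycles \<open>T \<rightarrow> X\<^sub>n\<close> modulo boundaries. For a complex \<open>P\<close> of
  projectives with zero differential this shows that every zigzag from \<open>P\<close> is equivalent to a
  chain map, determined by its effect on homology; so ghosts out of \<open>P\<close> vanish. Projective
  covers of the \<open>H\<^sub>n(X)\<close> lift to a chain map \<open>u : P \<rightarrow> X\<close> that is epi in homology, and the cone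
  triangle of \<open>u\<close> is the required one.

  If all ghosts out of \<open>X\<close> vanish, then so does \<open>X \<rightarrow> cone u\<close>. Instead of lifting the identity of
  \<open>X\<close> along \<open>u\<close>, which would need a calculus of fractions, one tests this vanishing on the two-term
  complexes \<open>Q1 \<rightarrow> P\<^sub>n\<close> that present \<open>H\<^sub>n(X)\<close>: maps out of them are an explicit functor on the
  derived category, and the null-homotopy obtained splits \<open>P\<^sub>n \<rightarrow> H\<^sub>n(X)\<close>. Hence \<open>H\<^sub>n(X)\<close> is
  projective, and a choice of cycles gives a quasi-isomorphism from \<open>(H\<^sub>n(X))\<^sub>n\<close> with zero
  differential to \<open>X\<close>.
\<close>

section \<open>Categories and abelian categories\<close>

text \<open>Arrows of the localization are classes of zigzags, so equality is awkward in both
  directions. To prove that two chain maps become equal one must exhibit moves. A cylinder provides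
  them for sources with zero differential, where degreewise choices of cycles are automatically
  chain maps. To exploit an equality one needs a quantity invariant under the moves: an action of
  the letters on sets in which quasi-isomorphisms act bijectively. Homology is one such action, but
  it cannot detect that a ghost vanishes, because ghosts are zero there. Homotopy classes of maps
  out of a two-term complex form the finer action.

  Testing on \<open>P\<^sub>n\<close> alone would yield an endomorphism \<open>h2\<close> of
  \<open>P\<^sub>n\<close> with \<open>e \<cdot> h2 = e\<close>, where \<open>e\<close> is the epi
  onto \<open>H\<^sub>n(X)\<close>, but would say nothing about the kernel of \<open>e\<close>. The
  term \<open>Q1\<close> covers that kernel and forces \<open>h2\<close> to kill it. Then
  \<open>h2 = r \<cdot> e\<close>, and cancelling \<open>e\<close> in
  \<open>e \<cdot> r \<cdot> e = e\<close> gives the splitting \<open>r\<close>.\<close>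

lemma Hom_iff: "f \<in> Hom C X Y \<longleftrightarrow> f \<in> Arr C \<and> Dom C f = X \<and> Cod C f = Y"
  by (simp add: Hom_def)

context category
begin

lemma Dom_in_Obj [simp]: "f \<in> Arr C \<Longrightarrow> Dom C f \<in> Obj C"
  by (rule Dom_Obj)

lemma Cod_in_Obj [simp]: "f \<in> Arr C \<Longrightarrow> Cod C f \<in> Obj C"
  by (rule Cod_Obj)

lemma comp_arr [simp]:
  assumes "f \<in> Arr C" "g \<in> Arr C" "Cod C f = Dom C g"
  shows "g \<cdot> f \<in> Arr C" "Dom C (g \<cdot> f) = Dom C f" "Cod C (g \<cdot> f) = Cod C g"
  using Comp_Hom[of f "Dom C f" "Cod C f" g "Cod C g"] assms by (auto simp: Hom_iff)

lemma id_arr [simp]: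
  assumes "X \<in> Obj C"
  shows "Id C X \<in> Arr C" "Dom C (Id C X) = X" "Cod C (Id C X) = X"
  using Id_Hom[OF assms] by (auto simp: Hom_iff)

lemma comp_id [simp]: "f \<in> Arr C \<Longrightarrow> Dom C f = X \<Longrightarrow> f \<cdot> Id C X = f"
  using Comp_Id[of f "Dom C f" "Cod C f"] by (auto simp: Hom_iff)

lemma id_comp [simp]: "f \<in> Arr C \<Longrightarrow> Cod C f = X \<Longrightarrow> Id C X \<cdot> f = f"
  using Id_Comp[of f "Dom C f" "Cod C f"] by (auto simp: Hom_iff)

lemma comp_assoc [simp]:
  "f \<in> Arr C \<Longrightarrow> g \<in> Arr C \<Longrightarrow> h \<in> Arr C \<Longrightarrow> Cod C f = Dom C g \<Longrightarrow> Cod C g = Dom C h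
    \<Longrightarrow> (h \<cdot> g) \<cdot> f = h \<cdot> (g \<cdot> f)"
  using Comp_assoc[of f "Dom C f" "Cod C f" g "Cod C g" h "Cod C h"] by (auto simp: Hom_iff)

lemma mono_arrD:
  "mono_arr C m \<Longrightarrow> g \<in> Arr C \<Longrightarrow> h \<in> Arr C \<Longrightarrow> Dom C g = Dom C h \<Longrightarrow> Cod C g = Dom C m
    \<Longrightarrow> Cod C h = Dom C m \<Longrightarrow> m \<cdot> g = m \<cdot> h \<Longrightarrow> g = h"
  by (auto simp: mono_arr_def Hom_iff)

lemma epi_arrD:
  "epi_arr C e \<Longrightarrow> g \<in> Arr C \<Longrightarrow> h \<in> Arr C \<Longrightarrow> Cod C g = Cod C h \<Longrightarrow> Dom C g = Cod C e
    \<Longrightarrow> Dom C h = Cod C e \<Longrightarrow> g \<cdot> e = h \<cdot> e \<Longrightarrow> g = h"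
  by (auto simp: epi_arr_def Hom_iff)

lemma inverse_pairD:
  assumes "inverse_pair C f g"
  shows "f \<in> Arr C" "g \<in> Arr C" "Dom C g = Cod C f" "Cod C g = Dom C f"
    "g \<cdot> f = Id C (Dom C f)" "f \<cdot> g = Id C (Cod C f)"
  using assms by (auto simp: inverse_pair_def Hom_iff)

lemma inverse_pair_unique:
  assumes "inverse_pair C f g" "inverse_pair C f h"
  shows "g = h"
proof -
  note g = inverse_pairD[OF assms(1)] and h = inverse_pairD[OF assms(2)]
  have "g = (h \<cdot> f) \<cdot> g" using g h(5) by simp
  also have "\<dots> = h \<cdot> (f \<cdot> g)" using g(1-4) h(1-4) by (subst comp_assoc) auto
  also have "\<dots> = h" using g h by simp
  finally show ?thesis .
qed

lemma inverse_arr_eq: "inverse_pair C f g \<Longrightarrow> inverse_arr C f = g"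
  unfolding inverse_arr_def using inverse_pair_unique by blast

lemma inverse_arr_pair: "iso_arr C f \<Longrightarrow> inverse_pair C f (inverse_arr C f)"
  unfolding iso_arr_def using inverse_arr_eq by auto

lemma inverse_pair_id: "X \<in> Obj C \<Longrightarrow> inverse_pair C (Id C X) (Id C X)"
  by (simp add: inverse_pair_def Hom_iff)

lemma iso_arr_id: "X \<in> Obj C \<Longrightarrow> iso_arr C (Id C X)"
  using inverse_pair_id unfolding iso_arr_def by blast

lemma projective_objD:
  assumes "projective_obj C P" "epi_arr C e" "f \<in> Arr C" "Dom C f = P" "Cod C f = Cod C e"
  obtains g where "g \<in> Arr C" "Dom C g = P" "Cod C g = Dom C e" "e \<cdot> g = f"
proof -
  have "f \<in> Hom C P (Cod C e)" using assms by (simp add: Hom_iff)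
  then obtain g where "g \<in> Hom C P (Dom C e)" "e \<cdot> g = f"
    using assms(1,2) unfolding projective_obj_def by blast
  then show thesis using that by (auto simp: Hom_iff)
qed

text \<open>A lifting problem on \<open>X\<close> is carried to \<open>P\<close> along
  \<open>r\<close>, and composing the solution with \<open>s\<close> undoes this. It is applied to
  \<open>homology A n X\<close> as a retract of a projective.\<close>

lemma projective_retract:
  assumes P: "projective_obj C P" and s: "s \<in> Hom C X P" and r: "r \<in> Hom C P X"
    and rs: "r \<cdot> s = Id C X"
  shows "projective_obj C X"
  unfolding projective_obj_def
proof (intro conjI allI impI)
  show X: "X \<in> Obj C" using s by (auto simp: Hom_iff)
  fix e f
  assume "epi_arr C e \<and> f \<in> Hom C X (Cod C e)"
  then have e: "epi_arr C e" and f: "f \<in> Arr C" "Dom C f = X" "Cod C f = Cod C e"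
    by (auto simp: Hom_iff)
  have e': "e \<in> Arr C" using e by (simp add: epi_arr_def)
  obtain g where g: "g \<in> Arr C" "Dom C g = P" "Cod C g = Dom C e" "e \<cdot> g = f \<cdot> r"
    using projective_objD[OF P e, of "f \<cdot> r"] f r by (auto simp: Hom_iff)
  have "e \<cdot> (g \<cdot> s) = (e \<cdot> g) \<cdot> s"
    using g(1-3) e' s by (simp add: Hom_iff)
  also have "\<dots> = f \<cdot> (r \<cdot> s)"
    unfolding g(4) using f r s by (simp add: Hom_iff)
  finally have "e \<cdot> (g \<cdot> s) = f"
    using f by (simp add: rs)
  then show "\<exists>g\<in>Hom C X (Dom C e). e \<cdot> g = f"
    using g s by (intro bexI[of _ "g \<cdot> s"]) (auto simp: Hom_iff)
qed

end

section \<open>Arithmetic of arrows in a preadditive category\<close>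

context preadditive_category
begin

lemma hom_group_simps:
  "carrier (hom_group A X Y) = Hom A X Y" "monoid.mult (hom_group A X Y) = Add A"
  "one (hom_group A X Y) = Zero A X Y"
  by (simp_all add: hom_group_def)

lemma zero_arr [simp]:
  assumes "X \<in> Obj A" "Y \<in> Obj A"
  shows "Zero A X Y \<in> Arr A" "Dom A (Zero A X Y) = X" "Cod A (Zero A X Y) = Y"
proof -
  interpret G: comm_group "hom_group A X Y" using hom_comm_group assms .
  show "Zero A X Y \<in> Arr A" "Dom A (Zero A X Y) = X" "Cod A (Zero A X Y) = Y"
    using G.one_closed by (simp_all add: hom_group_simps Hom_iff)
qed

lemma add_arr [simp]:
  assumes "f \<in> Arr A" "g \<in> Arr A" "Dom A f = Dom A g" "Cod A f = Cod A g"
  shows "f \<oplus> g \<in> Arr A" "Dom A (f \<oplus> g) = Dom A g" "Cod A (f \<oplus> g) = Cod A g"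
proof -
  interpret G: comm_group "hom_group A (Dom A g) (Cod A g)"
    using hom_comm_group assms by simp
  show "f \<oplus> g \<in> Arr A" "Dom A (f \<oplus> g) = Dom A g" "Cod A (f \<oplus> g) = Cod A g"
    using G.m_closed[of f g] assms by (simp_all add: hom_group_simps Hom_iff)
qed

lemma add_assoc [simp]:
  assumes "f \<in> Arr A" "g \<in> Arr A" "h \<in> Arr A" "Dom A f = Dom A g" "Cod A f = Cod A g"
    "Dom A g = Dom A h" "Cod A g = Cod A h"
  shows "(f \<oplus> g) \<oplus> h = f \<oplus> (g \<oplus> h)"
proof -
  interpret G: comm_group "hom_group A (Dom A g) (Cod A g)"
    using hom_comm_group assms by simp
  show ?thesis
    using G.m_assoc[of f g h] assms by (simp add: hom_group_simps Hom_iff)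
qed

lemma add_commute:
  assumes "f \<in> Arr A" "g \<in> Arr A" "Dom A f = Dom A g" "Cod A f = Cod A g"
  shows "f \<oplus> g = g \<oplus> f"
proof -
  interpret G: comm_group "hom_group A (Dom A g) (Cod A g)"
    using hom_comm_group assms by simp
  show ?thesis
    using G.m_comm[of f g] assms by (simp add: hom_group_simps Hom_iff)
qed

lemma add_left_commute:
  assumes "f \<in> Arr A" "g \<in> Arr A" "h \<in> Arr A" "Dom A f = Dom A g" "Cod A f = Cod A g"
    "Dom A g = Dom A h" "Cod A g = Cod A h"
  shows "f \<oplus> (g \<oplus> h) = g \<oplus> (f \<oplus> h)"
  using add_assoc[of f g h] add_assoc[of g f h] add_commute[of f g] assms by simp

lemmas add_ac = add_commute add_left_commute

lemma zero_add [simp]: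
  assumes "f \<in> Arr A" "Dom A f = X" "Cod A f = Y"
  shows "Zero A X Y \<oplus> f = f"
proof -
  interpret G: comm_group "hom_group A X Y"
    using hom_comm_group assms by force
  show ?thesis
    using G.l_one[of f] assms by (simp add: hom_group_simps Hom_iff)
qed

lemma add_zero [simp]:
  "f \<in> Arr A \<Longrightarrow> Dom A f = X \<Longrightarrow> Cod A f = Y \<Longrightarrow> f \<oplus> Zero A X Y = f"
  by (subst add_commute) auto

lemma neg_arr [simp]:
  assumes "f \<in> Arr A"
  shows "Neg A f \<in> Arr A" "Dom A (Neg A f) = Dom A f" "Cod A (Neg A f) = Cod A f"
    "Neg A f \<oplus> f = Zero A (Dom A f) (Cod A f)"
proof -
  interpret G: comm_group "hom_group A (Dom A f) (Cod A f)"
    using hom_comm_group assms by simp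
  have f: "f \<in> carrier (hom_group A (Dom A f) (Cod A f))"
    using assms by (simp add: hom_group_simps Hom_iff)
  show "Neg A f \<in> Arr A" "Dom A (Neg A f) = Dom A f" "Cod A (Neg A f) = Cod A f"
    using G.inv_closed[OF f] by (simp_all add: hom_group_simps Hom_iff Neg_def)
  show "Neg A f \<oplus> f = Zero A (Dom A f) (Cod A f)"
    using G.l_inv[OF f] by (simp add: hom_group_simps Neg_def)
qed

lemma add_neg [simp]: "f \<in> Arr A \<Longrightarrow> f \<oplus> Neg A f = Zero A (Dom A f) (Cod A f)"
  by (subst add_commute) auto

lemma add_left_cancel:
  assumes "f \<in> Arr A" "g \<in> Arr A" "h \<in> Arr A" "Dom A f = Dom A g" "Cod A f = Cod A g"
    "Dom A h = Dom A g" "Cod A h = Cod A g" "h \<oplus> f = h \<oplus> g"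
  shows "f = g"
proof -
  interpret G: comm_group "hom_group A (Dom A g) (Cod A g)"
    using hom_comm_group assms by simp
  show ?thesis
    using G.Units_l_cancel[of h f g] assms by (simp add: hom_group_simps Hom_iff)
qed

lemma neg_eqI:
  assumes "f \<in> Arr A" "g \<in> Arr A" "Dom A f = Dom A g" "Cod A f = Cod A g"
    "f \<oplus> g = Zero A (Dom A f) (Cod A f)"
  shows "g = Neg A f"
  using add_left_cancel[of g "Neg A f" f] assms by simp

lemma neg_add_cancel [simp]:
  assumes "f \<in> Arr A" "g \<in> Arr A" "Dom A f = Dom A g" "Cod A f = Cod A g"
  shows "Neg A f \<oplus> (f \<oplus> g) = g" "f \<oplus> (Neg A f \<oplus> g) = g"
  using assms add_assoc[of "Neg A f" f g] add_assoc[of f "Neg A f" g] by simp_all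

lemma comp_add_right [simp]:
  assumes "f \<in> Arr A" "f' \<in> Arr A" "g \<in> Arr A" "Dom A f = Dom A f'" "Cod A f = Dom A g"
    "Cod A f' = Dom A g"
  shows "g \<cdot> (f \<oplus> f') = (g \<cdot> f) \<oplus> (g \<cdot> f')"
  using Add_Comp[of f "Dom A f" "Cod A f" f' g "Cod A g"] assms by (simp add: Hom_iff)

lemma comp_add_left [simp]:
  assumes "f \<in> Arr A" "g \<in> Arr A" "g' \<in> Arr A" "Cod A g = Cod A g'" "Cod A f = Dom A g"
    "Cod A f = Dom A g'"
  shows "(g \<oplus> g') \<cdot> f = (g \<cdot> f) \<oplus> (g' \<cdot> f)"
  using Comp_Add[of f "Dom A f" "Cod A f" g "Cod A g" g'] assms by (simp add: Hom_iff)

text \<open>Yields the absorption laws for zero arrows: by distributivity, a composite with zero is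
  idempotent under addition.\<close>

lemma add_idem_zero:
  assumes "f \<in> Arr A" "f \<oplus> f = f"
  shows "f = Zero A (Dom A f) (Cod A f)"
  using add_left_cancel[of f "Zero A (Dom A f) (Cod A f)" f] assms by simp

lemma comp_zero [simp]:
  assumes "g \<in> Arr A" "Dom A g = Y" "X \<in> Obj A"
  shows "g \<cdot> Zero A X Y = Zero A X (Cod A g)"
proof -
  have Y: "Y \<in> Obj A" using assms by auto
  have "g \<cdot> Zero A X Y \<oplus> g \<cdot> Zero A X Y = g \<cdot> (Zero A X Y \<oplus> Zero A X Y)"
    using assms Y by (subst comp_add_right) auto
  also have "\<dots> = g \<cdot> Zero A X Y" using assms Y by (subst zero_add) auto
  finally show ?thesis
    using add_idem_zero[of "g \<cdot> Zero A X Y"] assms Y by simp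
qed

lemma zero_comp [simp]:
  assumes "f \<in> Arr A" "Cod A f = Y" "Z \<in> Obj A"
  shows "Zero A Y Z \<cdot> f = Zero A (Dom A f) Z"
proof -
  have Y: "Y \<in> Obj A" using assms by auto
  have "Zero A Y Z \<cdot> f \<oplus> Zero A Y Z \<cdot> f = (Zero A Y Z \<oplus> Zero A Y Z) \<cdot> f"
    using assms Y by (subst comp_add_left) auto
  also have "\<dots> = Zero A Y Z \<cdot> f" using assms Y by (subst zero_add) auto
  finally show ?thesis
    using add_idem_zero[of "Zero A Y Z \<cdot> f"] assms Y by simp
qed

lemma comp_neg [simp]:
  assumes "f \<in> Arr A" "g \<in> Arr A" "Cod A f = Dom A g"
  shows "g \<cdot> Neg A f = Neg A (g \<cdot> f)"
  by - (rule neg_eqI, use assms comp_add_right[of f "Neg A f" g] in \<open>auto\<close>)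

lemma neg_comp [simp]:
  assumes "f \<in> Arr A" "g \<in> Arr A" "Cod A f = Dom A g"
  shows "Neg A g \<cdot> f = Neg A (g \<cdot> f)"
  by - (rule neg_eqI, use assms comp_add_left[of f g "Neg A g"] in \<open>auto\<close>)

lemma neg_neg [simp]: "f \<in> Arr A \<Longrightarrow> Neg A (Neg A f) = f"
  using neg_eqI[of "Neg A f" f] by simp

lemma neg_zero [simp]: "X \<in> Obj A \<Longrightarrow> Y \<in> Obj A \<Longrightarrow> Neg A (Zero A X Y) = Zero A X Y"
  using neg_eqI[of "Zero A X Y" "Zero A X Y"] by simp

lemma neg_eq_zero_iff:
  assumes "f \<in> Arr A" "Dom A f = X" "Cod A f = Y"
  shows "Neg A f = Zero A X Y \<longleftrightarrow> f = Zero A X Y"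
proof -
  have "X \<in> Obj A" "Y \<in> Obj A" using assms by auto
  then show ?thesis using neg_neg[OF assms(1)] by (metis neg_zero)
qed

lemma eq_if_diff_zero:
  assumes "f \<in> Arr A" "g \<in> Arr A" "Dom A f = Dom A g" "Cod A f = Cod A g"
    "f \<oplus> Neg A g = Zero A (Dom A g) (Cod A g)"
  shows "f = g"
proof -
  have "Neg A g \<oplus> f = Zero A (Dom A g) (Cod A g)"
    using assms by (subst add_commute) auto
  then have "f = Neg A (Neg A g)"
    by - (rule neg_eqI, use assms in \<open>auto\<close>)
  then show ?thesis using assms by simp
qed

text \<open>Homotopy relations are kept in the form \<open>x = y \<oplus> z\<close>, whereas cycles
  arise as differences; this passes between the two forms.\<close>

lemma add_eq_iff_diff_eq:
  assumes "x \<in> Arr A" "y \<in> Arr A" "z \<in> Arr A" "Dom A x = S" "Dom A y = S" "Dom A z = S"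
    "Cod A x = T" "Cod A y = T" "Cod A z = T"
  shows "x = y \<oplus> z \<longleftrightarrow> x \<oplus> Neg A y = z"
proof
  assume "x = y \<oplus> z"
  then have "x \<oplus> Neg A y = Neg A y \<oplus> (y \<oplus> z)"
    using assms by (subst add_commute) auto
  then show "x \<oplus> Neg A y = z" using assms by simp
next
  assume "x \<oplus> Neg A y = z"
  then have "y \<oplus> z = y \<oplus> (Neg A y \<oplus> x)"
    using assms add_commute[of x "Neg A y"] by simp
  then show "x = y \<oplus> z" using assms by simp
qed

lemma neg_add:
  assumes "x \<in> Arr A" "y \<in> Arr A" "Dom A x = Dom A y" "Cod A x = Cod A y"
  shows "Neg A (x \<oplus> y) = Neg A x \<oplus> Neg A y"
  by (rule neg_eqI[symmetric]) (use assms in \<open>simp_all add: add_left_commute[of y "Neg A x"]\<close>)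

lemma mono_arrI:
  assumes "m \<in> Arr A"
    and "\<And>g. g \<in> Arr A \<Longrightarrow> Cod A g = Dom A m \<Longrightarrow> m \<cdot> g = Zero A (Dom A g) (Cod A m)
            \<Longrightarrow> g = Zero A (Dom A g) (Dom A m)"
  shows "mono_arr A m"
  unfolding mono_arr_def
proof (intro conjI allI ballI impI)
  fix W g h
  assume gh: "g \<in> Hom A W (Dom A m)" "h \<in> Hom A W (Dom A m)" and eq: "m \<cdot> g = m \<cdot> h"
  have "g \<oplus> Neg A h = Zero A (Dom A (g \<oplus> Neg A h)) (Dom A m)"
    by (rule assms(2)) (use gh eq assms(1) in \<open>auto simp: Hom_iff\<close>)
  then have "g \<oplus> Neg A h = Zero A W (Dom A m)"
    using gh by (simp add: Hom_iff)
  then show "g = h"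
    by - (rule eq_if_diff_zero, use gh in \<open>auto simp: Hom_iff\<close>)
qed fact

lemma epi_arrI:
  assumes "e \<in> Arr A"
    and "\<And>g. g \<in> Arr A \<Longrightarrow> Dom A g = Cod A e \<Longrightarrow> g \<cdot> e = Zero A (Dom A e) (Cod A g)
            \<Longrightarrow> g = Zero A (Cod A e) (Cod A g)"
  shows "epi_arr A e"
  unfolding epi_arr_def
proof (intro conjI allI ballI impI)
  fix W g h
  assume gh: "g \<in> Hom A (Cod A e) W" "h \<in> Hom A (Cod A e) W" and eq: "g \<cdot> e = h \<cdot> e"
  have "g \<oplus> Neg A h = Zero A (Cod A e) (Cod A (g \<oplus> Neg A h))"
    by (rule assms(2)) (use gh eq assms(1) in \<open>auto simp: Hom_iff\<close>)
  then have "g \<oplus> Neg A h = Zero A (Cod A e) W"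
    using gh by (simp add: Hom_iff)
  then show "g = h"
    by - (rule eq_if_diff_zero, use gh in \<open>auto simp: Hom_iff\<close>)
qed fact

lemma epi_zeroD:
  assumes "epi_arr A e" "g \<in> Arr A" "Dom A g = Cod A e" "g \<cdot> e = Zero A (Dom A e) (Cod A g)"
  shows "g = Zero A (Cod A e) (Cod A g)"
proof -
  have "e \<in> Arr A" using assms(1) by (simp add: epi_arr_def)
  then show ?thesis
    by - (rule epi_arrD[OF assms(1)], use assms in \<open>auto\<close>)
qed

lemma mono_zeroD:
  assumes "mono_arr A m" "g \<in> Arr A" "Cod A g = Dom A m" "m \<cdot> g = Zero A (Dom A g) (Cod A m)"
  shows "g = Zero A (Dom A g) (Dom A m)"
proof -
  have "m \<in> Arr A" using assms(1) by (simp add: mono_arr_def)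
  then show ?thesis
    by - (rule mono_arrD[OF assms(1)], use assms in \<open>auto\<close>)
qed

lemma is_kernelD:
  assumes "is_kernel A f k"
  shows "f \<in> Arr A" "k \<in> Arr A" "Cod A k = Dom A f" "f \<cdot> k = Zero A (Dom A k) (Cod A f)"
  using assms by (auto simp: is_kernel_def)

lemma is_kernel_factor:
  assumes "is_kernel A f k" "g \<in> Arr A" "Cod A g = Dom A f" "f \<cdot> g = Zero A (Dom A g) (Cod A f)"
  obtains h where "h \<in> Arr A" "Dom A h = Dom A g" "Cod A h = Dom A k" "k \<cdot> h = g"
proof -
  have "g \<in> Hom A (Dom A g) (Dom A f)" using assms by (simp add: Hom_iff)
  then obtain h where "h \<in> Hom A (Dom A g) (Dom A k)" "k \<cdot> h = g"
    using assms(1,4) unfolding is_kernel_def by blast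
  then show thesis using that by (auto simp: Hom_iff)
qed

lemma is_kernel_mono: "is_kernel A f k \<Longrightarrow> mono_arr A k"
proof (rule mono_arrI)
  assume k: "is_kernel A f k"
  note kD = is_kernelD[OF k]
  show "k \<in> Arr A" by fact
  fix g assume g: "g \<in> Arr A" "Cod A g = Dom A k" "k \<cdot> g = Zero A (Dom A g) (Cod A k)"
  have "\<exists>!h. h \<in> Hom A (Dom A g) (Dom A k) \<and> k \<cdot> h = Zero A (Dom A g) (Dom A f)"
    using k g(1) kD unfolding is_kernel_def by (auto simp: Hom_iff)
  moreover have "g \<in> Hom A (Dom A g) (Dom A k) \<and> k \<cdot> g = Zero A (Dom A g) (Dom A f)"
    using g kD by (auto simp: Hom_iff)
  moreover have "Zero A (Dom A g) (Dom A k) \<in> Hom A (Dom A g) (Dom A k) \<and>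
     k \<cdot> Zero A (Dom A g) (Dom A k) = Zero A (Dom A g) (Dom A f)"
    using g kD by (auto simp: Hom_iff)
  ultimately show "g = Zero A (Dom A g) (Dom A k)" by blast
qed

lemma is_cokernelD:
  assumes "is_cokernel A f q"
  shows "f \<in> Arr A" "q \<in> Arr A" "Dom A q = Cod A f" "q \<cdot> f = Zero A (Dom A f) (Cod A q)"
  using assms by (auto simp: is_cokernel_def)

lemma is_cokernel_factor:
  assumes "is_cokernel A f q" "g \<in> Arr A" "Dom A g = Cod A f" "g \<cdot> f = Zero A (Dom A f) (Cod A g)"
  obtains h where "h \<in> Arr A" "Dom A h = Cod A q" "Cod A h = Cod A g" "h \<cdot> q = g"
proof -
  have "g \<in> Hom A (Cod A f) (Cod A g)" using assms by (simp add: Hom_iff)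
  then obtain h where "h \<in> Hom A (Cod A q) (Cod A g)" "h \<cdot> q = g"
    using assms(1,4) unfolding is_cokernel_def by blast
  then show thesis using that by (auto simp: Hom_iff)
qed

lemma is_cokernel_epi: "is_cokernel A f q \<Longrightarrow> epi_arr A q"
proof (rule epi_arrI)
  assume q: "is_cokernel A f q"
  note qD = is_cokernelD[OF q]
  show "q \<in> Arr A" by fact
  fix g assume g: "g \<in> Arr A" "Dom A g = Cod A q" "g \<cdot> q = Zero A (Dom A q) (Cod A g)"
  have "\<exists>!h. h \<in> Hom A (Cod A q) (Cod A g) \<and> h \<cdot> q = Zero A (Cod A f) (Cod A g)"
    using q g(1) qD unfolding is_cokernel_def by (auto simp: Hom_iff)
  moreover have "g \<in> Hom A (Cod A q) (Cod A g) \<and> g \<cdot> q = Zero A (Cod A f) (Cod A g)"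
    using g qD by (auto simp: Hom_iff)
  moreover have "Zero A (Cod A q) (Cod A g) \<in> Hom A (Cod A q) (Cod A g) \<and>
     Zero A (Cod A q) (Cod A g) \<cdot> q = Zero A (Cod A f) (Cod A g)"
    using g qD by (auto simp: Hom_iff)
  ultimately show "g = Zero A (Cod A q) (Cod A g)" by blast
qed

end

section \<open>Images, lifting and factorization in an abelian category\<close>

context abelian_category
begin

lemma kernel_arr_kernel: "f \<in> Arr A \<Longrightarrow> is_kernel A f (kernel_arr A f)"
  unfolding kernel_arr_def using ex_kernel by (rule someI_ex)

lemma cokernel_arr_cokernel: "f \<in> Arr A \<Longrightarrow> is_cokernel A f (cokernel_arr A f)"
  unfolding cokernel_arr_def using ex_cokernel by (rule someI_ex)

lemma biproduct_is_biproduct: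
  "X \<in> Obj A \<Longrightarrow> Y \<in> Obj A \<Longrightarrow> is_biproduct A X Y (biproduct A X Y)"
  unfolding biproduct_def using ex_biproduct by (rule someI_ex)

text \<open>By normality \<open>m\<close> is the kernel of some \<open>f\<close>. Being epi,
  \<open>m\<close> forces \<open>f\<close> to be zero, so the identity factors through
  \<open>m\<close>.\<close>

lemma mono_epi_iso:
  assumes m: "mono_arr A m" and e: "epi_arr A m"
  shows "iso_arr A m"
proof -
  obtain f where f: "is_kernel A f m" using mono_normal[OF m] by blast
  note fD = is_kernelD[OF f]
  have "f = Zero A (Cod A m) (Cod A f)"
    by - (rule epi_zeroD[OF e], use fD in \<open>auto\<close>)
  then have "f \<cdot> Id A (Cod A m) = Zero A (Dom A (Id A (Cod A m))) (Cod A f)"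
    using fD by simp
  then obtain r where r: "r \<in> Arr A" "Dom A r = Cod A m" "Cod A r = Dom A m" "m \<cdot> r = Id A (Cod A m)"
    using is_kernel_factor[OF f, of "Id A (Cod A m)"] fD by auto
  have "m \<cdot> (r \<cdot> m) = (m \<cdot> r) \<cdot> m"
    using r(1-3) fD by simp
  then have "m \<cdot> (r \<cdot> m) = m \<cdot> Id A (Dom A m)"
    using r fD by simp
  then have "r \<cdot> m = Id A (Dom A m)"
    by - (rule mono_arrD[OF m], use r fD in \<open>auto\<close>)
  then have "inverse_pair A m r"
    using r fD by (simp add: inverse_pair_def Hom_iff)
  then show ?thesis by (auto simp: iso_arr_def)
qed

text \<open>The kernel \<open>k\<close> of the cokernel of \<open>b\<close> is the image of
  \<open>b\<close>. If \<open>t\<close> kills \<open>e\<close>, then \<open>b\<close> factors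
  through \<open>k \<cdot> j\<close>, with \<open>j\<close> the kernel of \<open>t\<close>.
  Normality makes this subobject the kernel of some \<open>c\<close>. Now \<open>c\<close> kills
  \<open>b\<close>, hence factors through \<open>q\<close> and kills \<open>k\<close>; so the whole
  image lies in the kernel of \<open>t\<close>.\<close>

lemma image_factor_epi:
  assumes q: "is_cokernel A b q" and k: "is_kernel A q k"
    and e: "e \<in> Arr A" "Dom A e = Dom A b" "Cod A e = Dom A k" "k \<cdot> e = b"
  shows "epi_arr A e"
proof (rule epi_arrI[OF e(1)])
  fix t assume t: "t \<in> Arr A" "Dom A t = Cod A e" "t \<cdot> e = Zero A (Dom A e) (Cod A t)"
  note qD = is_cokernelD[OF q] and kD = is_kernelD[OF k]
  define j where "j = kernel_arr A t"
  have j: "is_kernel A t j" unfolding j_def by (rule kernel_arr_kernel) fact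
  note jD = is_kernelD[OF j]
  obtain e' where e': "e' \<in> Arr A" "Dom A e' = Dom A e" "Cod A e' = Dom A j" "j \<cdot> e' = e"
    using is_kernel_factor[OF j, of e] e t by auto
  have "mono_arr A (k \<cdot> j)"
  proof (rule mono_arrI)
    show "k \<cdot> j \<in> Arr A" using kD jD e t by simp
    fix g assume g: "g \<in> Arr A" "Cod A g = Dom A (k \<cdot> j)"
      "(k \<cdot> j) \<cdot> g = Zero A (Dom A g) (Cod A (k \<cdot> j))"
    have "j \<cdot> g = Zero A (Dom A (j \<cdot> g)) (Dom A k)"
      by - (rule mono_zeroD[OF is_kernel_mono[OF k]], use g kD jD e t in \<open>auto\<close>)
    then have "g = Zero A (Dom A g) (Dom A j)"
      by - (rule mono_zeroD[OF is_kernel_mono[OF j]], use g kD jD e t in \<open>auto\<close>)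
    then show "g = Zero A (Dom A g) (Dom A (k \<cdot> j))"
      using kD jD e t by simp
  qed
  then obtain c where c: "is_kernel A c (k \<cdot> j)" using mono_normal by blast
  note cD = is_kernelD[OF c]
  have ccod: "Dom A c = Cod A b" using cD kD jD e t qD by simp
  have "c \<cdot> b = (c \<cdot> (k \<cdot> j)) \<cdot> e'"
    using cD(1-3) kD(1-3) jD(1-3) e e' t(1,2) qD ccod by simp
  also have "\<dots> = Zero A (Dom A b) (Cod A c)"
    unfolding cD(4) using cD kD jD e e' t(1,2) by simp
  finally obtain c' where c': "c' \<in> Arr A" "Dom A c' = Cod A q" "Cod A c' = Cod A c" "c' \<cdot> q = c"
    using is_cokernel_factor[OF q, of c] cD ccod by auto
  have "c \<cdot> k = c' \<cdot> (q \<cdot> k)"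
    using c' cD(1) kD(1-3) by (subst comp_assoc[symmetric]) auto
  then have "c \<cdot> k = Zero A (Dom A k) (Cod A c)"
    using c' cD kD by simp
  then obtain r where r: "r \<in> Arr A" "Dom A r = Dom A k" "Cod A r = Dom A (k \<cdot> j)" "(k \<cdot> j) \<cdot> r = k"
    using is_kernel_factor[OF c, of k] kD cD ccod qD by auto
  have r': "Cod A r = Dom A j" using r kD jD e t by simp
  have "k \<cdot> (j \<cdot> r) = k \<cdot> Id A (Dom A k)"
    using r kD jD e t r' by simp
  then have jr: "j \<cdot> r = Id A (Dom A k)"
    by - (rule mono_arrD[OF is_kernel_mono[OF k]], use r r' kD jD e t in \<open>auto\<close>)
  have "t = (t \<cdot> j) \<cdot> r"
    using jr r r' jD(1-3) t e by simp
  also have "\<dots> = Zero A (Cod A e) (Cod A t)"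
    unfolding jD(4) using r r' jD(1-3) t e by simp
  finally show "t = Zero A (Cod A e) (Cod A t)" .
qed

text \<open>Exactness at the target of \<open>b\<close>: an arrow killed by the cokernel lands in
  the image, and a projective lifts it along the epi from the source of \<open>b\<close> onto that
  image.\<close>

lemma projective_lift_cokernel:
  assumes T: "projective_obj A T" and q: "is_cokernel A b q"
    and z: "z \<in> Arr A" "Dom A z = T" "Cod A z = Cod A b" "q \<cdot> z = Zero A T (Cod A q)"
  obtains w where "w \<in> Arr A" "Dom A w = T" "Cod A w = Dom A b" "b \<cdot> w = z"
proof -
  note qD = is_cokernelD[OF q]
  define k where "k = kernel_arr A q"
  have k: "is_kernel A q k" unfolding k_def by (rule kernel_arr_kernel) fact
  note kD = is_kernelD[OF k]
  obtain e where e: "e \<in> Arr A" "Dom A e = Dom A b" "Cod A e = Dom A k" "k \<cdot> e = b"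
    using is_kernel_factor[OF k, of b] qD by auto
  obtain z' where z': "z' \<in> Arr A" "Dom A z' = Dom A z" "Cod A z' = Dom A k" "k \<cdot> z' = z"
    using is_kernel_factor[OF k, of z] qD z by auto
  obtain w where w: "w \<in> Arr A" "Dom A w = T" "Cod A w = Dom A e" "e \<cdot> w = z'"
    using projective_objD[OF T image_factor_epi[OF q k e], of z'] z' z e by auto
  have "b \<cdot> w = k \<cdot> (e \<cdot> w)"
    using e w(1-3) kD(1-3) by (subst comp_assoc[symmetric]) auto
  then show ?thesis
    using w z' e by (intro that[of w]) auto
qed

text \<open>By normality \<open>e\<close> is the cokernel of some \<open>f\<close>, and
  \<open>f\<close> factors through \<open>k\<close>; so whatever kills \<open>k\<close> also kills
  \<open>f\<close>.\<close>

lemma epi_factor_kernel: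
  assumes e: "epi_arr A e" and k: "is_kernel A e k"
    and h: "h \<in> Arr A" "Dom A h = Dom A e" "h \<cdot> k = Zero A (Dom A k) (Cod A h)"
  obtains r where "r \<in> Arr A" "Dom A r = Cod A e" "Cod A r = Cod A h" "r \<cdot> e = h"
proof -
  obtain f where f: "is_cokernel A f e" using epi_normal[OF e] by blast
  note fD = is_cokernelD[OF f] and kD = is_kernelD[OF k]
  obtain f' where f': "f' \<in> Arr A" "Dom A f' = Dom A f" "Cod A f' = Dom A k" "k \<cdot> f' = f"
    using is_kernel_factor[OF k, of f] fD by auto
  have "h \<cdot> f = (h \<cdot> k) \<cdot> f'" using f' kD(1-3) h(1,2) by simp
  also have "\<dots> = Zero A (Dom A f) (Cod A h)" unfolding h(3) using f' kD(1-3) h(1,2) by simp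
  finally show ?thesis
    using is_cokernel_factor[OF f, of h] h fD that by auto
qed

end

section \<open>Homology through generalized elements\<close>

definition cycle_elem ::
  "('o, 'm, 'z) preadditive_data_scheme \<Rightarrow> ('o, 'm) chain_complex \<Rightarrow> int \<Rightarrow> 'm \<Rightarrow> bool" where
  "cycle_elem A X n z \<longleftrightarrow> z \<in> Arr A \<and> Cod A z = ob X n \<and>
     diff X n \<cdot>\<^bsub>A\<^esub> z = Zero A (Dom A z) (ob X (n - 1))"

text \<open>The witness has the same domain as \<open>z\<close>. For a general domain this can be
  stronger than having zero class in homology; for a projective domain the two agree, by
  \<open>boundary_elemD\<close> and \<open>homology_class_zeroD\<close>.\<close>

definition boundary_elem ::
  "('o, 'm, 'z) preadditive_data_scheme \<Rightarrow> ('o, 'm) chain_complex \<Rightarrow> int \<Rightarrow> 'm \<Rightarrow> bool" where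
  "boundary_elem A X n z \<longleftrightarrow>
     (\<exists>w \<in> Hom A (Dom A z) (ob X (n + 1)). z = diff X (n + 1) \<cdot>\<^bsub>A\<^esub> w)"

text \<open>Shaped so that \<open>boundary_arr\<close> and \<open>cycle_map\<close> are instances of
  it once the domains are evaluated.\<close>

definition cycle_lift ::
  "('o, 'm, 'z) preadditive_data_scheme \<Rightarrow> ('o, 'm) chain_complex \<Rightarrow> int \<Rightarrow> 'm \<Rightarrow> 'm" where
  "cycle_lift A X n z =
     (THE h. h \<in> Hom A (Dom A z) (cycles A n X) \<and> cycle_incl A n X \<cdot>\<^bsub>A\<^esub> h = z)"

definition homology_class ::
  "('o, 'm, 'z) preadditive_data_scheme \<Rightarrow> ('o, 'm) chain_complex \<Rightarrow> int \<Rightarrow> 'm \<Rightarrow> 'm" where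
  "homology_class A X n z = homology_proj A n X \<cdot>\<^bsub>A\<^esub> cycle_lift A X n z"

context abelian_category
begin

lemma chain_complexD [simp]:
  assumes "is_chain_complex A X"
  shows "ob X n \<in> Obj A" "diff X n \<in> Arr A" "Dom A (diff X n) = ob X n"
    "Cod A (diff X n) = ob X (n - 1)"
  using assms by (auto simp: is_chain_complex_def Hom_iff)

text \<open>The double shift appears as \<open>n - 1 - 1\<close>, the form in which consecutive
  differentials produce it, instead of the \<open>n - 2\<close> of the definition.\<close>

lemma chain_complexI:
  assumes "\<And>n. ob X n \<in> Obj A" "\<And>n. diff X n \<in> Arr A" "\<And>n. Dom A (diff X n) = ob X n"
    "\<And>n. Cod A (diff X n) = ob X (n - 1)"
    "\<And>n. diff X (n - 1) \<cdot> diff X n = Zero A (ob X n) (ob X (n - 1 - 1))"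
  shows "is_chain_complex A X"
proof -
  have "n - 1 - 1 = n - (2 :: int)" for n by simp
  then have "diff X (n - 1) \<cdot> diff X n = Zero A (ob X n) (ob X (n - 2))" for n
    using assms(5)[of n] by metis
  then show ?thesis using assms(1-4) unfolding is_chain_complex_def Hom_iff by blast
qed

text \<open>The middle degree is a variable with a side equation, so that the rule matches however
  the index has been normalized.\<close>

lemma diff_diff [simp]:
  assumes "is_chain_complex A X" "m = n - 1"
  shows "diff X m \<cdot> diff X n = Zero A (ob X n) (ob X (m - 1))"
  using assms by (auto simp: is_chain_complex_def)

lemma diff_diff_comp [simp]:
  assumes "is_chain_complex A X" "m = n - 1" "f \<in> Arr A" "Cod A f = ob X n"
  shows "diff X m \<cdot> (diff X n \<cdot> f) = Zero A (Dom A f) (ob X (m - 1))"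
proof -
  have "diff X m \<cdot> (diff X n \<cdot> f) = (diff X m \<cdot> diff X n) \<cdot> f"
    by (subst comp_assoc) (use assms in auto)
  also have "\<dots> = Zero A (ob X n) (ob X (m - 1)) \<cdot> f"
    by (subst diff_diff) (use assms in auto)
  finally show ?thesis using assms by simp
qed

lemma chain_mapD:
  assumes "is_chain_map A (X, f, Y)"
  shows "is_chain_complex A X" "is_chain_complex A Y"
    "f n \<in> Arr A" "Dom A (f n) = ob X n" "Cod A (f n) = ob Y n"
    "diff Y n \<cdot> f n = f (n - 1) \<cdot> diff X n"
  using assms by (auto simp: is_chain_map_def Hom_iff)

lemma chain_map_comp_diff:
  assumes "is_chain_map A (X, f, Y)" "g \<in> Arr A" "Cod A g = ob X n"
  shows "diff Y n \<cdot> (f n \<cdot> g) = f (n - 1) \<cdot> (diff X n \<cdot> g)"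
proof -
  note fD = chain_mapD[OF assms(1)]
  have "diff Y n \<cdot> (f n \<cdot> g) = (diff Y n \<cdot> f n) \<cdot> g"
    by (subst comp_assoc) (use fD(1-5) assms(2,3) in auto)
  also have "\<dots> = (f (n - 1) \<cdot> diff X n) \<cdot> g" by (simp only: fD(6))
  also have "\<dots> = f (n - 1) \<cdot> (diff X n \<cdot> g)"
    by (subst comp_assoc) (use fD(1-5) assms(2,3) in auto)
  finally show ?thesis .
qed

lemma chain_mapI:
  assumes "is_chain_complex A X" "is_chain_complex A Y"
    "\<And>n. f n \<in> Arr A" "\<And>n. Dom A (f n) = ob X n" "\<And>n. Cod A (f n) = ob Y n"
    "\<And>n. diff Y n \<cdot> f n = f (n - 1) \<cdot> diff X n"
  shows "is_chain_map A (X, f, Y)"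
  using assms by (auto simp: is_chain_map_def Hom_iff)

lemma cycle_incl_kernel: "is_chain_complex A X \<Longrightarrow> is_kernel A (diff X n) (cycle_incl A n X)"
  unfolding cycle_incl_def by (rule kernel_arr_kernel) simp

lemma cycle_incl [simp]:
  assumes "is_chain_complex A X"
  shows "cycle_incl A n X \<in> Arr A" "Dom A (cycle_incl A n X) = cycles A n X"
    "Cod A (cycle_incl A n X) = ob X n" "cycles A n X \<in> Obj A"
    "diff X n \<cdot> cycle_incl A n X = Zero A (cycles A n X) (ob X (n - 1))"
  using is_kernelD[OF cycle_incl_kernel[OF assms, of n]] assms
  by (auto simp: cycles_def)

lemma cycle_elem_incl: "is_chain_complex A X \<Longrightarrow> cycle_elem A X n (cycle_incl A n X)"
  by (simp add: cycle_elem_def)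

lemma cycle_elemD:
  assumes "cycle_elem A X n z"
  shows "z \<in> Arr A" "Cod A z = ob X n" "diff X n \<cdot> z = Zero A (Dom A z) (ob X (n - 1))"
  using assms by (auto simp: cycle_elem_def)

lemma cycle_factor_unique:
  assumes X: "is_chain_complex A X" and z: "cycle_elem A X n z"
  shows "\<exists>!h. h \<in> Hom A (Dom A z) (cycles A n X) \<and> cycle_incl A n X \<cdot> h = z"
  using cycle_incl_kernel[OF X, of n] X z
  by (auto simp: is_kernel_def cycle_elem_def Hom_iff)

lemma cycle_lift:
  assumes X: "is_chain_complex A X" and z: "cycle_elem A X n z"
  shows "cycle_lift A X n z \<in> Arr A" "Dom A (cycle_lift A X n z) = Dom A z"
    "Cod A (cycle_lift A X n z) = cycles A n X" "cycle_incl A n X \<cdot> cycle_lift A X n z = z"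
  using theI'[OF cycle_factor_unique[OF assms]] unfolding cycle_lift_def by (auto simp: Hom_iff)

lemma cycle_lift_eqI:
  assumes X: "is_chain_complex A X"
    and h: "h \<in> Arr A" "Cod A h = cycles A n X" "cycle_incl A n X \<cdot> h = z"
  shows "cycle_lift A X n z = h" "cycle_elem A X n z"
proof -
  have "diff X n \<cdot> (cycle_incl A n X \<cdot> h) = (diff X n \<cdot> cycle_incl A n X) \<cdot> h"
    by (subst comp_assoc) (use X h(1,2) in auto)
  then have "diff X n \<cdot> (cycle_incl A n X \<cdot> h) = Zero A (Dom A h) (ob X (n - 1))"
    using X h(1,2) by simp
  then show z: "cycle_elem A X n z"
    using X h by (auto simp: cycle_elem_def)
  have "Dom A h = Dom A z" using h X by auto
  then show "cycle_lift A X n z = h"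
    using cycle_lift[OF X z] h cycle_factor_unique[OF X z] by (auto simp: Hom_iff)
qed

lemma boundary_arr [simp]:
  assumes X: "is_chain_complex A X"
  shows "boundary_arr A n X \<in> Arr A" "Dom A (boundary_arr A n X) = ob X (n + 1)"
    "Cod A (boundary_arr A n X) = cycles A n X"
    "cycle_incl A n X \<cdot> boundary_arr A n X = diff X (n + 1)"
proof -
  have d: "cycle_elem A X n (diff X (n + 1))"
    using X by (simp add: cycle_elem_def)
  have "boundary_arr A n X = cycle_lift A X n (diff X (n + 1))"
    using X by (simp add: boundary_arr_def cycle_lift_def)
  then show "boundary_arr A n X \<in> Arr A" "Dom A (boundary_arr A n X) = ob X (n + 1)"
    "Cod A (boundary_arr A n X) = cycles A n X"
    "cycle_incl A n X \<cdot> boundary_arr A n X = diff X (n + 1)"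
    using cycle_lift[OF X d] X by auto
qed

lemma homology_proj_cokernel:
  "is_chain_complex A X \<Longrightarrow> is_cokernel A (boundary_arr A n X) (homology_proj A n X)"
  unfolding homology_proj_def by (rule cokernel_arr_cokernel) simp

lemma homology_proj [simp]:
  assumes "is_chain_complex A X"
  shows "homology_proj A n X \<in> Arr A" "Dom A (homology_proj A n X) = cycles A n X"
    "Cod A (homology_proj A n X) = homology A n X" "homology A n X \<in> Obj A"
    "homology_proj A n X \<cdot> boundary_arr A n X = Zero A (ob X (n + 1)) (homology A n X)"
  using is_cokernelD[OF homology_proj_cokernel[OF assms, of n]] assms
  by (auto simp: homology_def)

lemma homology_proj_epi: "is_chain_complex A X \<Longrightarrow> epi_arr A (homology_proj A n X)"
  by (rule is_cokernel_epi[OF homology_proj_cokernel])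

lemma homology_class_arr [simp]:
  assumes "is_chain_complex A X" "cycle_elem A X n z"
  shows "homology_class A X n z \<in> Arr A" "Dom A (homology_class A X n z) = Dom A z"
    "Cod A (homology_class A X n z) = homology A n X"
  using assms cycle_lift[OF assms] by (simp_all add: homology_class_def)

lemma homology_class_incl:
  assumes "is_chain_complex A X"
  shows "homology_class A X n (cycle_incl A n X) = homology_proj A n X"
proof -
  have "cycle_lift A X n (cycle_incl A n X) = Id A (cycles A n X)"
    using assms by (intro cycle_lift_eqI) auto
  then show ?thesis using assms by (simp add: homology_class_def)
qed

lemma cycle_elem_comp:
  assumes X: "is_chain_complex A X" and z: "cycle_elem A X n z"
    and t: "t \<in> Arr A" "Cod A t = Dom A z"
  shows "cycle_elem A X n (z \<cdot> t)" "homology_class A X n (z \<cdot> t) = homology_class A X n z \<cdot> t"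
proof -
  note l = cycle_lift[OF X z]
  have eq: "cycle_incl A n X \<cdot> (cycle_lift A X n z \<cdot> t) = z \<cdot> t"
    using l t X comp_assoc[of t "cycle_lift A X n z" "cycle_incl A n X"] by simp
  have "cycle_lift A X n (z \<cdot> t) = cycle_lift A X n z \<cdot> t" "cycle_elem A X n (z \<cdot> t)"
    by (rule cycle_lift_eqI[OF X _ _ eq]; use l(1-3) t in simp)+
  then show "cycle_elem A X n (z \<cdot> t)"
      "homology_class A X n (z \<cdot> t) = homology_class A X n z \<cdot> t"
    using l t X by (simp_all add: homology_class_def)
qed

lemma cycle_elem_add:
  assumes X: "is_chain_complex A X" and z: "cycle_elem A X n z" "cycle_elem A X n z'"
    and dom: "Dom A z = Dom A z'"
  shows "cycle_elem A X n (z \<oplus> z')"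
    "homology_class A X n (z \<oplus> z') = homology_class A X n z \<oplus> homology_class A X n z'"
proof -
  note l = cycle_lift[OF X z(1)] cycle_lift[OF X z(2)]
  have eq: "cycle_incl A n X \<cdot> (cycle_lift A X n z \<oplus> cycle_lift A X n z') = z \<oplus> z'"
    using l X dom by simp
  have "cycle_lift A X n (z \<oplus> z') = cycle_lift A X n z \<oplus> cycle_lift A X n z'"
      "cycle_elem A X n (z \<oplus> z')"
    by (rule cycle_lift_eqI[OF X _ _ eq]; use l dom in simp)+
  then show "cycle_elem A X n (z \<oplus> z')"
      "homology_class A X n (z \<oplus> z') = homology_class A X n z \<oplus> homology_class A X n z'"
    using l X dom by (simp_all add: homology_class_def)
qed

lemma boundary_elemD:
  assumes X: "is_chain_complex A X" and z: "boundary_elem A X n z"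
  shows "cycle_elem A X n z" "homology_class A X n z = Zero A (Dom A z) (homology A n X)"
proof -
  obtain w where w: "w \<in> Arr A" "Dom A w = Dom A z" "Cod A w = ob X (n + 1)"
      and zw: "z = diff X (n + 1) \<cdot> w"
    using z by (auto simp: boundary_elem_def Hom_iff)
  have eq: "cycle_incl A n X \<cdot> (boundary_arr A n X \<cdot> w) = z"
    unfolding zw using w X comp_assoc[of w "boundary_arr A n X" "cycle_incl A n X"] by simp
  have l: "cycle_lift A X n z = boundary_arr A n X \<cdot> w" "cycle_elem A X n z"
    by (rule cycle_lift_eqI[OF X _ _ eq]; use w X in simp)+
  then show "cycle_elem A X n z" by simp
  have "homology_proj A n X \<cdot> (boundary_arr A n X \<cdot> w)
      = (homology_proj A n X \<cdot> boundary_arr A n X) \<cdot> w"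
    by (subst comp_assoc) (use w X in auto)
  also have "\<dots> = Zero A (Dom A z) (homology A n X)"
    using w X by simp
  finally show "homology_class A X n z = Zero A (Dom A z) (homology A n X)"
    by (simp add: homology_class_def l)
qed

text \<open>A zero class means that the lift to the cycles is killed by the cokernel of
  \<open>boundary_arr\<close>. Projectivity of the domain then allows a lift along
  \<open>boundary_arr\<close> itself, without passing to a cover.\<close>

lemma homology_class_zeroD:
  assumes X: "is_chain_complex A X" and z: "cycle_elem A X n z" and T: "projective_obj A (Dom A z)"
    and 0: "homology_class A X n z = Zero A (Dom A z) (homology A n X)"
  shows "boundary_elem A X n z"
proof -
  note l = cycle_lift[OF X z]
  obtain w where w: "w \<in> Arr A" "Dom A w = Dom A z" "Cod A w = ob X (n + 1)"
    "boundary_arr A n X \<cdot> w = cycle_lift A X n z"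
    using projective_lift_cokernel[OF T homology_proj_cokernel[OF X], of "cycle_lift A X n z" n]
      l X 0 by (auto simp: homology_class_def)
  have "z = diff X (n + 1) \<cdot> w"
    using comp_assoc[of w "boundary_arr A n X" "cycle_incl A n X"] w X l(4) by simp
  then show ?thesis
    unfolding boundary_elem_def using w by (auto simp: Hom_iff)
qed

lemma homology_class_surj:
  assumes X: "is_chain_complex A X" and T: "projective_obj A T"
    and h: "h \<in> Arr A" "Dom A h = T" "Cod A h = homology A n X"
  obtains z where "cycle_elem A X n z" "Dom A z = T" "homology_class A X n z = h"
proof -
  obtain y where y: "y \<in> Arr A" "Dom A y = T" "Cod A y = cycles A n X" "homology_proj A n X \<cdot> y = h"
    using projective_objD[OF T homology_proj_epi[OF X], of h n] h X by auto
  note l = cycle_lift_eqI[OF X y(1,3) refl]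
  show ?thesis
  proof (rule that[OF l(2)])
    show "Dom A (cycle_incl A n X \<cdot> y) = T" using X y by simp
    show "homology_class A X n (cycle_incl A n X \<cdot> y) = h"
      using l y by (simp add: homology_class_def)
  qed
qed

lemma homology_ext:
  assumes X: "is_chain_complex A X"
    and g: "g \<in> Arr A" "Dom A g = homology A n X" and g': "g' \<in> Arr A" "Dom A g' = homology A n X"
    and cod: "Cod A g = Cod A g'"
    and eq: "g \<cdot> homology_proj A n X = g' \<cdot> homology_proj A n X"
  shows "g = g'"
  by (rule epi_arrD[OF homology_proj_epi[OF X] g(1) g'(1) cod _ _ eq]) (use g g' X in auto)

lemma cycle_elem_map:
  assumes f: "is_chain_map A (X, f, Y)" and z: "cycle_elem A X n z"
  shows "cycle_elem A Y n (f n \<cdot> z)"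
  using chain_map_comp_diff[OF f, of z n] chain_mapD[OF f] cycle_elemD[OF z]
  by (simp add: cycle_elem_def)

lemma boundary_elem_map:
  assumes f: "is_chain_map A (X, f, Y)" and z: "boundary_elem A X n z"
  shows "boundary_elem A Y n (f n \<cdot> z)"
proof -
  obtain w where w: "w \<in> Arr A" "Dom A w = Dom A z" "Cod A w = ob X (n + 1)"
      and zw: "z = diff X (n + 1) \<cdot> w"
    using z by (auto simp: boundary_elem_def Hom_iff)
  have "f n \<cdot> z = diff Y (n + 1) \<cdot> (f (n + 1) \<cdot> w)"
    unfolding zw using chain_map_comp_diff[OF f, of w "n + 1"] w by simp
  then show ?thesis
    unfolding boundary_elem_def using w zw chain_mapD[OF f]
    by (intro bexI[of _ "f (n + 1) \<cdot> w"]) (auto simp: Hom_iff)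
qed

lemma cycle_map:
  assumes f: "is_chain_map A (X, f, Y)"
  shows "cycle_map A n (X, f, Y) = cycle_lift A Y n (f n \<cdot> cycle_incl A n X)"
  using chain_mapD[OF f] by (simp add: cycle_map_def cycle_lift_def)

lemma homology_map_unique:
  assumes f: "is_chain_map A (X, f, Y)"
  shows "\<exists>!h. h \<in> Hom A (homology A n X) (homology A n Y) \<and>
    h \<cdot> homology_proj A n X = homology_class A Y n (f n \<cdot> cycle_incl A n X)"
proof -
  note fD = chain_mapD[OF f]
  let ?z = "f n \<cdot> cycle_incl A n X"
  have z: "cycle_elem A Y n ?z"
    by (rule cycle_elem_map[OF f cycle_elem_incl[OF fD(1)]])
  \<comment> \<open>The differential is regarded as a generalized element, with the identity as
    witness. Its image under \<open>f\<close> is again a boundary, so the class of \<open>?z\<close>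
    kills \<open>boundary_arr\<close> and descends to homology.\<close>
  have "boundary_elem A X n (diff X (n + 1))"
    unfolding boundary_elem_def using fD(1)
    by (intro bexI[of _ "Id A (ob X (n + 1))"]) (auto simp: Hom_iff)
  then have "boundary_elem A Y n (f n \<cdot> diff X (n + 1))"
    by (rule boundary_elem_map[OF f])
  also have "f n \<cdot> diff X (n + 1) = ?z \<cdot> boundary_arr A n X"
    using fD(1-5) by simp
  finally have "homology_class A Y n ?z \<cdot> boundary_arr A n X = Zero A (ob X (n + 1)) (homology A n Y)"
    using boundary_elemD(2)[OF fD(2), of n "?z \<cdot> boundary_arr A n X"] cycle_elem_comp(2)[OF fD(2) z, of "boundary_arr A n X"]
      fD(1-5) by simp
  then show ?thesis
    using homology_proj_cokernel[OF fD(1), of n] z fD(1-5)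
    by (auto simp: is_cokernel_def Hom_iff)
qed

lemma homology_map [simp]:
  assumes f: "is_chain_map A (X, f, Y)"
  shows "homology_map A n (X, f, Y) \<in> Arr A"
    "Dom A (homology_map A n (X, f, Y)) = homology A n X"
    "Cod A (homology_map A n (X, f, Y)) = homology A n Y"
    "homology_map A n (X, f, Y) \<cdot> homology_proj A n X
      = homology_class A Y n (f n \<cdot> cycle_incl A n X)"
  using theI'[OF homology_map_unique[OF f, of n]]
  by (auto simp: homology_map_def cycle_map[OF f] homology_class_def Hom_iff)

lemma homology_map_class:
  assumes f: "is_chain_map A (X, f, Y)" and z: "cycle_elem A X n z"
  shows "homology_map A n (X, f, Y) \<cdot> homology_class A X n z = homology_class A Y n (f n \<cdot> z)"
proof -
  note fD = chain_mapD[OF f] and l = cycle_lift[OF chain_mapD(1)[OF f] z]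
  have "homology_map A n (X, f, Y) \<cdot> homology_class A X n z
      = (homology_map A n (X, f, Y) \<cdot> homology_proj A n X) \<cdot> cycle_lift A X n z"
    unfolding homology_class_def
    by (subst comp_assoc) (use l f fD in auto)
  also have "\<dots> = homology_class A Y n (f n \<cdot> cycle_incl A n X) \<cdot> cycle_lift A X n z"
    using f by simp
  also have "\<dots> = homology_class A Y n ((f n \<cdot> cycle_incl A n X) \<cdot> cycle_lift A X n z)"
    by (rule cycle_elem_comp(2)[symmetric])
      (use l fD cycle_elem_map[OF f cycle_elem_incl[OF fD(1)]] in auto)
  also have "(f n \<cdot> cycle_incl A n X) \<cdot> cycle_lift A X n z = f n \<cdot> z"
    by (subst comp_assoc) (use l fD in auto)
  finally show ?thesis .
qed

lemma homology_map_eqI: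
  assumes f: "is_chain_map A (X, f, Y)"
    and g: "g \<in> Arr A" "Dom A g = homology A n X" "Cod A g = homology A n Y"
    and eq: "g \<cdot> homology_proj A n X = homology_class A Y n (f n \<cdot> cycle_incl A n X)"
  shows "homology_map A n (X, f, Y) = g"
  by (rule homology_ext[OF chain_mapD(1)[OF f], of _ n]) (use f g eq in auto)

section \<open>The category of chain complexes and functoriality of homology\<close>

lemma category_Ch: "category (Ch A)"
proof
  fix f g X Y Z
  assume "f \<in> Hom (Ch A) X Y" "g \<in> Hom (Ch A) Y Z"
  then obtain f' g' where f: "f = (X, f', Y)" "is_chain_map A (X, f', Y)"
      and g: "g = (Y, g', Z)" "is_chain_map A (Y, g', Z)"
    by (cases f; cases g) (auto simp: Hom_iff Ch_def)
  note fD = chain_mapD[OF f(2)] and gD = chain_mapD[OF g(2)]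
  have "is_chain_map A (X, \<lambda>n. g' n \<cdot> f' n, Z)"
  proof (rule chain_mapI)
    fix n
    have "diff Z n \<cdot> (g' n \<cdot> f' n) = g' (n - 1) \<cdot> (diff Y n \<cdot> f' n)"
      by (rule chain_map_comp_diff[OF g(2)]) (use fD in auto)
    then show "diff Z n \<cdot> (g' n \<cdot> f' n) = (g' (n - 1) \<cdot> f' (n - 1)) \<cdot> diff X n"
      using fD gD by simp
  qed (use fD gD in auto)
  then show "g \<cdot>\<^bsub>Ch A\<^esub> f \<in> Hom (Ch A) X Z"
    by (auto simp: Hom_iff Ch_def f g)
next
  fix X assume "X \<in> Obj (Ch A)"
  then have X: "is_chain_complex A X" by (simp add: Ch_def)
  have "is_chain_map A (X, \<lambda>n. Id A (ob X n), X)"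
    by (rule chain_mapI) (use X in auto)
  then show "Id (Ch A) X \<in> Hom (Ch A) X X"
    by (auto simp: Hom_iff Ch_def)
next
  fix f X Y assume "f \<in> Hom (Ch A) X Y"
  then obtain f' where f: "f = (X, f', Y)" "is_chain_map A (X, f', Y)"
    by (cases f) (auto simp: Hom_iff Ch_def)
  show "f \<cdot>\<^bsub>Ch A\<^esub> Id (Ch A) X = f" "Id (Ch A) Y \<cdot>\<^bsub>Ch A\<^esub> f = f"
    using chain_mapD[OF f(2)] by (auto simp: Ch_def f)
next
  fix f g h W X Y Z
  assume "f \<in> Hom (Ch A) W X" "g \<in> Hom (Ch A) X Y" "h \<in> Hom (Ch A) Y Z"
  then show "h \<cdot>\<^bsub>Ch A\<^esub> (g \<cdot>\<^bsub>Ch A\<^esub> f) = (h \<cdot>\<^bsub>Ch A\<^esub> g) \<cdot>\<^bsub>Ch A\<^esub> f"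
    by (cases f; cases g; cases h) (auto simp: Hom_iff Ch_def chain_mapD)
qed (auto simp: Ch_def is_chain_map_def)

lemma Ch_simps [simp]:
  "X \<in> Obj (Ch A) \<longleftrightarrow> is_chain_complex A X"
  "(X, f, Y) \<in> Arr (Ch A) \<longleftrightarrow> is_chain_map A (X, f, Y)"
  "Dom (Ch A) (X, f, Y) = X" "Cod (Ch A) (X, f, Y) = Y"
  "Id (Ch A) X = (X, \<lambda>n. Id A (ob X n), X)"
  "(Y', g, Z) \<cdot>\<^bsub>Ch A\<^esub> (X, f, Y) = (X, \<lambda>n. g n \<cdot> f n, Z)"
  by (auto simp: Ch_def)

lemma chain_map_id: "is_chain_complex A X \<Longrightarrow> is_chain_map A (X, \<lambda>n. Id A (ob X n), X)"
  using category.id_arr(1)[OF category_Ch, of X] by simp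

lemma chain_map_comp:
  "is_chain_map A (X, f, Y) \<Longrightarrow> is_chain_map A (Y, g, Z)
    \<Longrightarrow> is_chain_map A (X, \<lambda>n. g n \<cdot> f n, Z)"
  using category.comp_arr(1)[OF category_Ch, of "(X, f, Y)" "(Y, g, Z)"] by simp

lemma chain_map_zero:
  "is_chain_complex A X \<Longrightarrow> is_chain_complex A Y \<Longrightarrow> is_chain_map A (zero_map A X Y)"
  unfolding zero_map_def by (rule chain_mapI) auto

lemma homology_map_id:
  assumes "is_chain_complex A X"
  shows "homology_map A n (X, \<lambda>n. Id A (ob X n), X) = Id A (homology A n X)"
  by (rule homology_map_eqI[OF chain_map_id[OF assms]])
    (use assms homology_class_incl[OF assms, of n] in auto)

lemma homology_map_comp:
  assumes f: "is_chain_map A (X, f, Y)" and g: "is_chain_map A (Y, g, Z)"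
  shows "homology_map A n (X, \<lambda>n. g n \<cdot> f n, Z)
    = homology_map A n (Y, g, Z) \<cdot> homology_map A n (X, f, Y)"
proof (rule homology_map_eqI[OF chain_map_comp[OF f g]])
  note fD = chain_mapD[OF f] and gD = chain_mapD[OF g]
  have z: "cycle_elem A Y n (f n \<cdot> cycle_incl A n X)"
    by (rule cycle_elem_map[OF f cycle_elem_incl[OF fD(1)]])
  have "(homology_map A n (Y, g, Z) \<cdot> homology_map A n (X, f, Y)) \<cdot> homology_proj A n X
      = homology_map A n (Y, g, Z) \<cdot> homology_class A Y n (f n \<cdot> cycle_incl A n X)"
    using f g fD by simp
  also have "\<dots> = homology_class A Z n (g n \<cdot> (f n \<cdot> cycle_incl A n X))"
    by (rule homology_map_class[OF g z])
  finally show "(homology_map A n (Y, g, Z) \<cdot> homology_map A n (X, f, Y)) \<cdot> homology_proj A n X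
      = homology_class A Z n ((g n \<cdot> f n) \<cdot> cycle_incl A n X)"
    using fD gD by simp
qed (use f g in auto)

lemma homology_map_zero:
  assumes "is_chain_complex A X" "is_chain_complex A Y"
  shows "homology_map A n (zero_map A X Y) = Zero A (homology A n X) (homology A n Y)"
  unfolding zero_map_def
proof (rule homology_map_eqI)
  show "is_chain_map A (X, \<lambda>n. Zero A (ob X n) (ob Y n), Y)"
    using chain_map_zero[OF assms] by (simp add: zero_map_def)
  have "boundary_elem A Y n (Zero A (cycles A n X) (ob Y n))"
    unfolding boundary_elem_def using assms
    by (intro bexI[of _ "Zero A (cycles A n X) (ob Y (n + 1))"]) (auto simp: Hom_iff)
  then show "Zero A (homology A n X) (homology A n Y) \<cdot> homology_proj A n X
      = homology_class A Y n (Zero A (ob X n) (ob Y n) \<cdot> cycle_incl A n X)"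
    using boundary_elemD(2)[OF assms(2)] assms by simp
qed (use assms in auto)

lemma cycle_elem_neg:
  assumes X: "is_chain_complex A X" and z: "cycle_elem A X n z"
  shows "cycle_elem A X n (Neg A z)"
    "homology_class A X n (Neg A z) = Neg A (homology_class A X n z)"
proof -
  have "Dom A z \<in> Obj A" using cycle_elemD(1)[OF z] by simp
  then show nz: "cycle_elem A X n (Neg A z)"
    using X cycle_elemD[OF z] by (simp add: cycle_elem_def)
  have "boundary_elem A X n (z \<oplus> Neg A z)"
    unfolding boundary_elem_def using X cycle_elemD[OF z] \<open>Dom A z \<in> Obj A\<close>
    by (intro bexI[of _ "Zero A (Dom A z) (ob X (n + 1))"]) (auto simp: Hom_iff)
  then have "homology_class A X n z \<oplus> homology_class A X n (Neg A z) = Zero A (Dom A z) (homology A n X)"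
    using boundary_elemD(2)[OF X, of n "z \<oplus> Neg A z"] cycle_elem_add(2)[OF X z nz]
      cycle_elemD[OF z] X \<open>Dom A z \<in> Obj A\<close> by simp
  then show "homology_class A X n (Neg A z) = Neg A (homology_class A X n z)"
    by - (rule neg_eqI, use X z nz cycle_elemD[OF z] in auto)
qed

text \<open>The conclusion is additive, with no difference on the left, because this is the form of
  a degreewise homotopy.\<close>

lemma homology_class_eqD:
  assumes X: "is_chain_complex A X" and z: "cycle_elem A X n z" "cycle_elem A X n z'"
    and T: "Dom A z = T" "Dom A z' = T" "projective_obj A T"
    and eq: "homology_class A X n z = homology_class A X n z'"
  obtains w where "w \<in> Arr A" "Dom A w = T" "Cod A w = ob X (n + 1)"
    "z = z' \<oplus> diff X (n + 1) \<cdot> w"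
proof -
  note zD = cycle_elemD[OF z(1)] cycle_elemD[OF z(2)]
  note nz = cycle_elem_neg[OF X z(2)]
  have "boundary_elem A X n (Neg A z' \<oplus> z)"
  proof (rule homology_class_zeroD[OF X])
    show "cycle_elem A X n (Neg A z' \<oplus> z)"
      by (rule cycle_elem_add(1)[OF X nz(1) z(1)]) (use zD T in auto)
    show "projective_obj A (Dom A (Neg A z' \<oplus> z))" using zD T by simp
    show "homology_class A X n (Neg A z' \<oplus> z) = Zero A (Dom A (Neg A z' \<oplus> z)) (homology A n X)"
      using cycle_elem_add(2)[OF X nz(1) z(1)] nz(2) zD T eq X z by simp
  qed
  then obtain w where w: "w \<in> Arr A" "Dom A w = T" "Cod A w = ob X (n + 1)"
    "Neg A z' \<oplus> z = diff X (n + 1) \<cdot> w"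
    using zD T by (auto simp: boundary_elem_def Hom_iff)
  have "z = z' \<oplus> (Neg A z' \<oplus> z)"
    using zD T by simp
  with w show ?thesis using that[of w] by simp
qed

lemma homology_class_add_boundary:
  assumes X: "is_chain_complex A X" and z: "cycle_elem A X n z"
    and w: "w \<in> Arr A" "Dom A w = Dom A z" "Cod A w = ob X (n + 1)"
  shows "cycle_elem A X n (z \<oplus> diff X (n + 1) \<cdot> w)"
    "homology_class A X n (z \<oplus> diff X (n + 1) \<cdot> w) = homology_class A X n z"
proof -
  have b: "boundary_elem A X n (diff X (n + 1) \<cdot> w)"
    unfolding boundary_elem_def using w X by (intro bexI[of _ w]) (auto simp: Hom_iff)
  note bD = boundary_elemD[OF X b]
  have dom: "Dom A z = Dom A (diff X (n + 1) \<cdot> w)" using w X by simp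
  show "cycle_elem A X n (z \<oplus> diff X (n + 1) \<cdot> w)"
    by (rule cycle_elem_add(1)[OF X z bD(1) dom])
  show "homology_class A X n (z \<oplus> diff X (n + 1) \<cdot> w) = homology_class A X n z"
    using cycle_elem_add(2)[OF X z bD(1) dom] bD(2) X z w by simp
qed

section \<open>Quasi-isomorphisms in terms of generalized elements\<close>

lemma quasi_iso_chain_map: "(X, f, Y) \<in> quasi_isos A \<Longrightarrow> is_chain_map A (X, f, Y)"
  by (simp add: quasi_isos_def)

text \<open>With projective domains, bijectivity in homology becomes a statement about actual cycles
  and boundaries. Together with the next lemma, this is what the lifting arguments use.\<close>

lemma quasi_iso_injective:
  assumes f: "(X, f, Y) \<in> quasi_isos A" and z: "cycle_elem A X n z" and T: "projective_obj A (Dom A z)"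
    and b: "boundary_elem A Y n (f n \<cdot> z)"
  shows "boundary_elem A X n z"
proof (rule homology_class_zeroD[OF _ z T])
  note f' = quasi_iso_chain_map[OF f]
  note fD = chain_mapD[OF f']
  show X: "is_chain_complex A X" by fact
  obtain g where g: "inverse_pair A (homology_map A n (X, f, Y)) g"
    using f by (auto simp: quasi_isos_def iso_arr_def)
  note gD = inverse_pairD[OF g]
  have fz: "homology_map A n (X, f, Y) \<cdot> homology_class A X n z = Zero A (Dom A z) (homology A n Y)"
    using homology_map_class[OF f' z] boundary_elemD(2)[OF fD(2) b] cycle_elemD[OF z] fD by simp
  have "homology_class A X n z = (g \<cdot> homology_map A n (X, f, Y)) \<cdot> homology_class A X n z"
    unfolding gD(5) using f' X z by simp
  also have "\<dots> = g \<cdot> (homology_map A n (X, f, Y) \<cdot> homology_class A X n z)"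
    by (rule comp_assoc) (use gD(1-4) f' X z in auto)
  finally show "homology_class A X n z = Zero A (Dom A z) (homology A n X)"
    unfolding fz using gD(1-4) f' cycle_elemD[OF z] by simp
qed

lemma quasi_iso_surjective:
  assumes f: "(X, f, Y) \<in> quasi_isos A" and y: "cycle_elem A Y n y"
    and T: "Dom A y = T" "projective_obj A T"
  obtains z w where "cycle_elem A X n z" "Dom A z = T"
    "w \<in> Arr A" "Dom A w = T" "Cod A w = ob Y (n + 1)" "y = f n \<cdot> z \<oplus> diff Y (n + 1) \<cdot> w"
proof -
  note f' = quasi_iso_chain_map[OF f]
  note fD = chain_mapD[OF f']
  obtain g where g: "inverse_pair A (homology_map A n (X, f, Y)) g"
    using f by (auto simp: quasi_isos_def iso_arr_def)
  note gD = inverse_pairD[OF g]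
  obtain z where z: "cycle_elem A X n z" "Dom A z = T"
      "homology_class A X n z = g \<cdot> homology_class A Y n y"
    using homology_class_surj[OF fD(1) T(2), of "g \<cdot> homology_class A Y n y" n]
      gD(1-4) f' fD y T(1) by auto
  have "homology_class A Y n (f n \<cdot> z) = homology_map A n (X, f, Y) \<cdot> (g \<cdot> homology_class A Y n y)"
    using homology_map_class[OF f' z(1)] z(3) by simp
  also have "\<dots> = (homology_map A n (X, f, Y) \<cdot> g) \<cdot> homology_class A Y n y"
    by (rule comp_assoc[symmetric]) (use gD(1-4) f' fD y in auto)
  also have "\<dots> = homology_class A Y n y"
    unfolding gD(6) using f' fD y by simp
  finally have eq: "homology_class A Y n y = homology_class A Y n (f n \<cdot> z)" ..
  show ?thesis
    by (rule homology_class_eqD[OF fD(2) y cycle_elem_map[OF f' z(1)] T(1) _ T(2) eq])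
      (use z fD cycle_elemD[OF z(1)] that in auto)
qed

end

locale abelian_category_enough_projectives = abelian_category +
  assumes enough: "enough_projectives A"
begin

lemma projective_cover:
  assumes "X \<in> Obj A"
  obtains T e where "projective_obj A T" "epi_arr A e" "e \<in> Arr A" "Dom A e = T" "Cod A e = X"
proof -
  obtain T where T: "projective_obj A T" "\<exists>e\<in>Hom A T X. epi_arr A e"
    using enough assms unfolding enough_projectives_def by blast
  then obtain e where "e \<in> Hom A T X" "epi_arr A e" by blast
  with T(1) show thesis by (intro that[of T e]) (auto simp: Hom_iff)
qed

text \<open>Projectives suffice as test objects: after precomposition with an epi from a projective,
  an arrow into homology is represented by a cycle, and the epi can be cancelled afterwards. This
  shows that the map in homology is mono and epi, hence an isomorphism.\<close>

lemma quasi_isoI: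
  assumes f: "is_chain_map A (X, f, Y)"
    and inj: "\<And>n z. projective_obj A (Dom A z) \<Longrightarrow> cycle_elem A X n z
      \<Longrightarrow> boundary_elem A Y n (f n \<cdot> z) \<Longrightarrow> boundary_elem A X n z"
    and surj: "\<And>n y. projective_obj A (Dom A y) \<Longrightarrow> cycle_elem A Y n y
      \<Longrightarrow> \<exists>z. cycle_elem A X n z \<and> Dom A z = Dom A y \<and>
             homology_class A Y n (f n \<cdot> z) = homology_class A Y n y"
  shows "(X, f, Y) \<in> quasi_isos A"
proof -
  note fD = chain_mapD[OF f]
  have "iso_arr A (homology_map A n (X, f, Y))" for n
  proof (rule mono_epi_iso)
    show "mono_arr A (homology_map A n (X, f, Y))"
    proof (rule mono_arrI)
      fix g assume g: "g \<in> Arr A" "Cod A g = Dom A (homology_map A n (X, f, Y))"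
        "homology_map A n (X, f, Y) \<cdot> g = Zero A (Dom A g) (Cod A (homology_map A n (X, f, Y)))"
      obtain T t where t: "projective_obj A T" "epi_arr A t" "t \<in> Arr A" "Dom A t = T" "Cod A t = Dom A g"
        using projective_cover[of "Dom A g"] g by auto
      obtain z where z: "cycle_elem A X n z" "Dom A z = T" "homology_class A X n z = g \<cdot> t"
        using homology_class_surj[OF fD(1) t(1), of "g \<cdot> t" n] g t f by auto
      have "homology_class A Y n (f n \<cdot> z) = homology_map A n (X, f, Y) \<cdot> (g \<cdot> t)"
        using homology_map_class[OF f z(1)] z(3) by simp
      also have "\<dots> = (homology_map A n (X, f, Y) \<cdot> g) \<cdot> t"
        by (rule comp_assoc[symmetric]) (use g t f in auto)
      also have "\<dots> = Zero A (Dom A (f n \<cdot> z)) (homology A n Y)"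
        unfolding g(3) using g(1) t z f fD cycle_elemD[OF z(1)] by simp
      finally have "boundary_elem A Y n (f n \<cdot> z)"
        by (rule homology_class_zeroD[OF fD(2) cycle_elem_map[OF f z(1)], rotated])
          (use t z fD cycle_elemD[OF z(1)] in auto)
      then have "boundary_elem A X n z" using inj t z by auto
      then have "g \<cdot> t = Zero A (Dom A t) (Cod A g)"
        using boundary_elemD(2)[OF fD(1), of n z] z t g f by simp
      then have "g = Zero A (Cod A t) (Cod A g)"
        by - (rule epi_zeroD[OF t(2)], use g t in auto)
      then show "g = Zero A (Dom A g) (Dom A (homology_map A n (X, f, Y)))"
        unfolding t(5) g(2)[symmetric] .
    qed (use f in simp)
    show "epi_arr A (homology_map A n (X, f, Y))"
    proof (rule epi_arrI)
      fix g assume g: "g \<in> Arr A" "Dom A g = Cod A (homology_map A n (X, f, Y))"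
        "g \<cdot> homology_map A n (X, f, Y) = Zero A (Dom A (homology_map A n (X, f, Y))) (Cod A g)"
      obtain T t where t: "projective_obj A T" "epi_arr A t" "t \<in> Arr A" "Dom A t = T"
          "Cod A t = homology A n Y"
        using projective_cover[of "homology A n Y"] fD by auto
      obtain y where y: "cycle_elem A Y n y" "Dom A y = T" "homology_class A Y n y = t"
        using homology_class_surj[OF fD(2) t(1), of t n] t by auto
      obtain z where z: "cycle_elem A X n z" "Dom A z = T" "homology_class A Y n (f n \<cdot> z) = t"
        using surj[of y n] t y by auto
      have "g \<cdot> t = g \<cdot> (homology_map A n (X, f, Y) \<cdot> homology_class A X n z)"
        using homology_map_class[OF f z(1)] z(3) by simp
      also have "\<dots> = (g \<cdot> homology_map A n (X, f, Y)) \<cdot> homology_class A X n z"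
        by (rule comp_assoc[symmetric]) (use g(1,2) f fD z in auto)
      also have "\<dots> = Zero A (Dom A t) (Cod A g)"
        unfolding g(3) using g(1) f fD z t by simp
      finally have "g = Zero A (Cod A t) (Cod A g)"
        by - (rule epi_zeroD[OF t(2)], use g t f in auto)
      then show "g = Zero A (Cod A (homology_map A n (X, f, Y))) (Cod A g)"
        unfolding t(5) homology_map(3)[OF f] .
    qed (use f in simp)
  qed
  then show ?thesis using f by (simp add: quasi_isos_def)
qed

end

section \<open>Localization by zigzags\<close>

locale category_with_weak_equivalences = category C for C (structure) +
  fixes W
  assumes weak_equivalences: "W \<subseteq> Arr C"
begin

abbreviation "zpath \<equiv> is_zigzag C W"
abbreviation "zclass \<equiv> zigzag_class C W"

lemma letter_Obj:
  assumes "letter_in C W l"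
  shows "letter_src C l \<in> Obj C" "letter_tgt C l \<in> Obj C"
  using assms weak_equivalences by (cases l; auto)+

lemma is_zigzag_Obj:
  assumes "zpath X ls Y"
  shows "X \<in> Obj C" "Y \<in> Obj C"
  using assms by (induction ls arbitrary: X) (auto simp: letter_Obj)

lemma is_zigzag_append:
  "zpath X (us @ vs) Z \<longleftrightarrow> (\<exists>Y. zpath X us Y \<and> zpath Y vs Z)"
  by (induction us arbitrary: X) (auto dest: is_zigzag_Obj)

lemma mem_zigzags [simp]: "(X, ls, Y) \<in> zigzags C W \<longleftrightarrow> zpath X ls Y"
  by (simp add: zigzags_def)

lemma zigzag_step_ends:
  "zigzag_step C W p q \<Longrightarrow> fst p = fst q \<and> snd (snd p) = snd (snd q)"
  by (auto simp: zigzag_step_def)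

lemma zigzag_stepI:
  assumes "elem_reduction C W ls ls'" "zpath X ls Y" "zpath X ls' Y"
  shows "zigzag_step C W (X, ls, Y) (X, ls', Y)"
  unfolding zigzag_step_def using assms
  by (intro conjI exI[of _ X] exI[of _ Y] exI[of _ "[]"] exI[of _ ls] exI[of _ ls']) auto

text \<open>The source of the well-definedness statements: endpoints, actions of letters and the
  shift are all obtained by choosing a suitable \<open>F\<close>.\<close>

lemma equivclp_zigzag_invariant:
  assumes "equivclp (zigzag_step C W) p q" "\<And>p q. zigzag_step C W p q \<Longrightarrow> F p = F q"
  shows "F p = F q"
  using assms(1) by (induction rule: equivclp_induct) (use assms(2) in metis)+

lemma equiv_zigzag_rel: "equiv (zigzags C W) (zigzag_rel C W)"
proof (rule equivI)
  show "zigzag_rel C W \<subseteq> zigzags C W \<times> zigzags C W"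
    by (auto simp: zigzag_rel_def)
  show "refl_on (zigzags C W) (zigzag_rel C W)"
    by (auto simp: refl_on_def zigzag_rel_def)
  show "sym (zigzag_rel C W)"
    by (auto simp: sym_def zigzag_rel_def intro: equivclp_sym)
  show "trans (zigzag_rel C W)"
    by (auto simp: trans_def zigzag_rel_def intro: equivclp_trans)
qed

lemma zigzag_class_eq_iff:
  "p \<in> zigzags C W \<Longrightarrow> q \<in> zigzags C W
    \<Longrightarrow> zclass p = zclass q \<longleftrightarrow> equivclp (zigzag_step C W) p q"
  unfolding zigzag_class_def
  by (subst eq_equiv_class_iff[OF equiv_zigzag_rel]) (auto simp: zigzag_rel_def)

lemma zigzag_class_stepI: "zigzag_step C W p q \<Longrightarrow> zclass p = zclass q"
  by (subst zigzag_class_eq_iff) (use zigzag_step_def[of C W p q] in auto)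

lemma mem_zigzag_class:
  "q \<in> zclass p \<longleftrightarrow>
     p \<in> zigzags C W \<and> q \<in> zigzags C W \<and> equivclp (zigzag_step C W) p q"
  by (auto simp: zigzag_class_def zigzag_rel_def)

lemma zigzag_class_self: "p \<in> zigzags C W \<Longrightarrow> p \<in> zclass p"
  by (simp add: mem_zigzag_class)

lemma mem_zigzag_class_ends:
  assumes "q \<in> zclass p"
  shows "fst q = fst p" "snd (snd q) = snd (snd p)"
proof -
  have "equivclp (zigzag_step C W) p q" using assms by (simp add: mem_zigzag_class)
  from equivclp_zigzag_invariant[OF this, of fst] equivclp_zigzag_invariant[OF this, of "\<lambda>p. snd (snd p)"]
  show "fst q = fst p" "snd (snd q) = snd (snd p)"
    using zigzag_step_ends by metis+
qed

lemma mem_zigzag_class_eq: "q \<in> zclass p \<Longrightarrow> zclass q = zclass p"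
  by (subst zigzag_class_eq_iff) (auto simp: mem_zigzag_class equivclp_sym)

lemma zigzag_step_join:
  assumes "zigzag_step C W (X, us, Y) (X, us', Y)" "zpath X' as X" "zpath Y bs Y'"
  shows "zigzag_step C W (X', as @ us @ bs, Y') (X', as @ us' @ bs, Y')"
proof -
  obtain us1 ls ls' vs where *: "us = us1 @ ls @ vs" "us' = us1 @ ls' @ vs" "elem_reduction C W ls ls'"
    and zz: "zpath X us Y" "zpath X us' Y"
    using assms(1) by (auto simp: zigzag_step_def)
  have "zpath X' (as @ us @ bs) Y'" "zpath X' (as @ us' @ bs) Y'"
    using zz assms(2,3) unfolding is_zigzag_append by blast+
  then show ?thesis
    unfolding zigzag_step_def mem_zigzags
    by (intro conjI exI[of _ X'] exI[of _ Y'] exI[of _ "as @ us1"] exI[of _ ls] exI[of _ ls']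
      exI[of _ "vs @ bs"]) (simp_all add: *)
qed

text \<open>Concatenation is a congruence, which makes composition in the localization
  single-valued. One factor is varied at a time while the other is held fixed.\<close>

lemma zigzag_class_join:
  assumes us: "(X, us', Y) \<in> zclass (X, us, Y)"
    and vs: "(Y, vs', Z) \<in> zclass (Y, vs, Z)"
  shows "zclass (X, us' @ vs', Z) = zclass (X, us @ vs, Z)"
proof -
  have zz: "zpath X us Y" "zpath Y vs Z" "zpath Y vs' Z"
    and eq: "equivclp (zigzag_step C W) (X, us, Y) (X, us', Y)"
      "equivclp (zigzag_step C W) (Y, vs, Z) (Y, vs', Z)"
    using us vs by (auto simp: mem_zigzag_class)
  let ?K = "zclass"
  have 1: "?K (X, us @ vs', Z) = ?K (X, us' @ vs', Z)"
  proof -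
    \<comment> \<open>The endpoints belong to the induction claim because an intermediate
      \<open>p\<close> is an arbitrary triple; only with them can a step be extended by
      \<open>vs'\<close>.\<close>
    have "?K (fst p, fst (snd p) @ vs', Z) = ?K (X, us @ vs', Z) \<and> fst p = X \<and> snd (snd p) = Y"
      if "equivclp (zigzag_step C W) (X, us, Y) p" for p
      using that
    proof (induction rule: equivclp_induct)
      case (step p q)
      obtain as bs where pq: "p = (X, as, Y)" "q = (X, bs, Y)"
        using step by (cases p; cases q) (auto dest: zigzag_step_ends)
      have "zigzag_step C W (X, as @ vs', Z) (X, bs @ vs', Z) \<or> zigzag_step C W (X, bs @ vs', Z) (X, as @ vs', Z)"
        using step.hyps(2) zigzag_step_join[of X as Y bs X "[]" vs' Z]
          zigzag_step_join[of X bs Y as X "[]" vs' Z] zz is_zigzag_Obj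
        unfolding pq by auto
      then have "?K (X, as @ vs', Z) = ?K (X, bs @ vs', Z)"
        using zigzag_class_stepI by metis
      then show ?case using step.IH pq by simp
    qed simp
    from this[OF eq(1)] show ?thesis by simp
  qed
  have 2: "?K (X, us @ vs, Z) = ?K (X, us @ vs', Z)"
  proof -
    have "?K (X, us @ fst (snd p), Z) = ?K (X, us @ vs, Z) \<and> fst p = Y \<and> snd (snd p) = Z"
      if "equivclp (zigzag_step C W) (Y, vs, Z) p" for p
      using that
    proof (induction rule: equivclp_induct)
      case (step p q)
      obtain as bs where pq: "p = (Y, as, Z)" "q = (Y, bs, Z)"
        using step by (cases p; cases q) (auto dest: zigzag_step_ends)
      have "zigzag_step C W (X, us @ as, Z) (X, us @ bs, Z) \<or> zigzag_step C W (X, us @ bs, Z) (X, us @ as, Z)"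
        using step.hyps(2) zigzag_step_join[of Y as Z bs X us "[]" Z]
          zigzag_step_join[of Y bs Z as X us "[]" Z] zz is_zigzag_Obj
        unfolding pq by auto
      then have "?K (X, us @ as, Z) = ?K (X, us @ bs, Z)"
        using zigzag_class_stepI by metis
      then show ?case using step.IH pq by simp
    qed simp
    from this[OF eq(2)] show ?thesis by simp
  qed
  from 1 2 show ?thesis by simp
qed

section \<open>The localization as a category, and the functor to it\<close>

abbreviation "L \<equiv> localization C W"

lemma localization_Obj [simp]: "Obj L = Obj C"
  by (simp add: localization_def)

lemma localization_Id: "Id L X = zclass (X, [], X)"
  by (simp add: localization_def)

lemma zigzag_class_arr:
  assumes "zpath X ls Y"
  shows "zclass (X, ls, Y) \<in> Arr L" "Dom L (zclass (X, ls, Y)) = X"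
    "Cod L (zclass (X, ls, Y)) = Y"
proof -
  let ?k = "zclass (X, ls, Y)"
  show "?k \<in> Arr L"
    using assms by (auto simp: localization_def zigzag_class_def intro!: quotientI)
  have mem: "(X, ls, Y) \<in> ?k" using assms by (intro zigzag_class_self) simp
  have "(\<lambda>(X, ls, Y). X) ` ?k = {X}"
    using mem_zigzag_class_ends(1)[of _ "(X, ls, Y)"] mem by force
  moreover have "(\<lambda>(X, ls, Y). Y) ` ?k = {Y}"
    using mem_zigzag_class_ends(2)[of _ "(X, ls, Y)"] mem by force
  ultimately show "Dom L ?k = X" "Cod L ?k = Y"
    by (simp_all add: localization_def)
qed

lemma localization_arrE:
  assumes "\<phi> \<in> Hom L X Y"
  obtains ls where "zpath X ls Y" "\<phi> = zclass (X, ls, Y)"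
proof -
  have "\<phi> \<in> zigzags C W // zigzag_rel C W"
    using assms by (auto simp: Hom_iff localization_def)
  then obtain p where p: "p \<in> zigzags C W" "\<phi> = zclass p"
    by (auto simp: zigzag_class_def elim: quotientE)
  obtain X' ls Y' where "p = (X', ls, Y')" by (cases p)
  then have "zpath X' ls Y'" "\<phi> = zclass (X', ls, Y')"
    using p by auto
  moreover from this have "X' = X" "Y' = Y"
    using assms zigzag_class_arr by (auto simp: Hom_iff)
  ultimately show ?thesis using that by simp
qed

text \<open>The union defining \<open>Comp\<close> runs over all representatives; by congruence its
  members coincide.\<close>

lemma zigzag_class_comp:
  assumes us: "zpath X us Y" and vs: "zpath Y vs Z"
  shows "zclass (Y, vs, Z) \<cdot>\<^bsub>L\<^esub> zclass (X, us, Y)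
    = zclass (X, us @ vs, Z)"
proof -
  let ?k = "zclass"
  have "?k (zigzag_join p q) = ?k (X, us @ vs, Z)"
    if mem: "p \<in> ?k (X, us, Y)" "q \<in> ?k (Y, vs, Z)" for p q
  proof -
    obtain us' vs' where pq: "p = (X, us', Y)" "q = (Y, vs', Z)"
      using mem_zigzag_class_ends[OF mem(1)] mem_zigzag_class_ends[OF mem(2)]
      by (cases p; cases q) auto
    then show ?thesis
      using zigzag_class_join[of X us' Y us vs' Z vs] mem by (simp add: zigzag_join_def)
  qed
  moreover have "(X, us, Y) \<in> ?k (X, us, Y)" "(Y, vs, Z) \<in> ?k (Y, vs, Z)"
    using us vs by (auto intro: zigzag_class_self)
  ultimately show ?thesis
    by (auto simp: localization_def)
qed

lemma category_localization: "category L"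
proof
  show "Id L X \<in> Hom L X X" if "X \<in> Obj L" for X
    using that zigzag_class_arr[of X "[]" X] by (simp add: Hom_iff localization_Id)
  show "\<psi> \<cdot>\<^bsub>L\<^esub> \<phi> \<in> Hom L X Z" if \<phi>: "\<phi> \<in> Hom L X Y" and \<psi>: "\<psi> \<in> Hom L Y Z" for \<phi> \<psi> X Y Z
  proof -
    obtain us vs where us: "zpath X us Y" "\<phi> = zclass (X, us, Y)"
      and vs: "zpath Y vs Z" "\<psi> = zclass (Y, vs, Z)"
      using \<phi> \<psi> by (metis localization_arrE)
    have "zpath X (us @ vs) Z" using us vs is_zigzag_append by blast
    then show ?thesis
      unfolding us(2) vs(2) zigzag_class_comp[OF us(1) vs(1)] Hom_iff
      using zigzag_class_arr by blast
  qed
  show "\<phi> \<cdot>\<^bsub>L\<^esub> Id L X = \<phi>" "Id L Y \<cdot>\<^bsub>L\<^esub> \<phi> = \<phi>" if "\<phi> \<in> Hom L X Y" for \<phi> X Y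
  proof -
    obtain us where us: "zpath X us Y" "\<phi> = zclass (X, us, Y)"
      using \<open>\<phi> \<in> Hom L X Y\<close> by (rule localization_arrE)
    show "\<phi> \<cdot>\<^bsub>L\<^esub> Id L X = \<phi>" "Id L Y \<cdot>\<^bsub>L\<^esub> \<phi> = \<phi>"
      using us is_zigzag_Obj[OF us(1)] zigzag_class_comp[of X "[]" X us Y] zigzag_class_comp[of X us Y "[]" Y]
      by (simp_all add: localization_Id)
  qed
  show "\<chi> \<cdot>\<^bsub>L\<^esub> (\<psi> \<cdot>\<^bsub>L\<^esub> \<phi>) = (\<chi> \<cdot>\<^bsub>L\<^esub> \<psi>) \<cdot>\<^bsub>L\<^esub> \<phi>"
    if homs: "\<phi> \<in> Hom L U X" "\<psi> \<in> Hom L X Y" "\<chi> \<in> Hom L Y Z" for \<phi> \<psi> \<chi> U X Y Z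
  proof -
    obtain us where us: "zpath U us X" "\<phi> = zclass (U, us, X)"
      using homs(1) by (rule localization_arrE)
    obtain vs where vs: "zpath X vs Y" "\<psi> = zclass (X, vs, Y)"
      using homs(2) by (rule localization_arrE)
    obtain ws where ws: "zpath Y ws Z" "\<chi> = zclass (Y, ws, Z)"
      using homs(3) by (rule localization_arrE)
    note zz = us vs ws
    have "zpath U (us @ vs) Y" "zpath X (vs @ ws) Z"
      using zz is_zigzag_append by blast+
    then show ?thesis
      using zz by (simp add: zigzag_class_comp)
  qed
  show "Dom L \<phi> \<in> Obj L" "Cod L \<phi> \<in> Obj L" if \<phi>: "\<phi> \<in> Arr L" for \<phi>
  proof -
    have "\<phi> \<in> Hom L (Dom L \<phi>) (Cod L \<phi>)" using \<phi> by (simp add: Hom_iff)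
    then obtain ls where "zpath (Dom L \<phi>) ls (Cod L \<phi>)"
      by (rule localization_arrE)
    then show "Dom L \<phi> \<in> Obj L" "Cod L \<phi> \<in> Obj L"
      using is_zigzag_Obj by auto
  qed
qed

abbreviation "Q \<equiv> loc_functor C W"

lemma loc_functor_arr [simp]:
  assumes "f \<in> Arr C"
  shows "Q f \<in> Arr L" "Dom L (Q f) = Dom C f" "Cod L (Q f) = Cod C f"
  using assms zigzag_class_arr[of "Dom C f" "[Fwd f]" "Cod C f"] by (auto simp: loc_functor_def)

lemma loc_functor_comp:
  assumes "f \<in> Arr C" "g \<in> Arr C" "Cod C f = Dom C g"
  shows "Q (g \<cdot> f) = Q g \<cdot>\<^bsub>L\<^esub> Q f"
proof -
  have "Q g \<cdot>\<^bsub>L\<^esub> Q f = zclass (Dom C f, [Fwd f, Fwd g], Cod C g)"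
    using assms zigzag_class_comp[of "Dom C f" "[Fwd f]" "Cod C f" "[Fwd g]" "Cod C g"]
    by (simp add: loc_functor_def)
  also have "\<dots> = zclass (Dom C f, [Fwd (g \<cdot> f)], Cod C g)"
  proof (rule zigzag_class_stepI)
    show "zigzag_step C W (Dom C f, [Fwd f, Fwd g], Cod C g) (Dom C f, [Fwd (g \<cdot> f)], Cod C g)"
      by (rule zigzag_stepI[OF elem_reduction.Comp]) (use assms in auto)
  qed
  finally show ?thesis using assms by (simp add: loc_functor_def)
qed

lemma loc_functor_id:
  assumes "X \<in> Obj C"
  shows "Q (Id C X) = Id L X"
proof -
  have "zigzag_step C W (X, [Fwd (Id C X)], X) (X, [], X)"
    by (rule zigzag_stepI[OF elem_reduction.Id]) (use assms in auto)
  then show ?thesis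
    using zigzag_class_stepI assms by (simp add: loc_functor_def localization_Id)
qed

lemma loc_functor_inverse:
  assumes "s \<in> W"
  shows "inverse_pair L (Q s) (zclass (Cod C s, [Inv s], Dom C s))"
proof -
  have s: "s \<in> Arr C" using assms weak_equivalences by auto
  have "zigzag_step C W (Dom C s, [Fwd s, Inv s], Dom C s) (Dom C s, [], Dom C s)"
    by (rule zigzag_stepI[OF elem_reduction.Fwd_Inv]) (use assms s in auto)
  then have 1: "zclass (Cod C s, [Inv s], Dom C s) \<cdot>\<^bsub>L\<^esub> Q s = Id L (Dom C s)"
    using zigzag_class_stepI assms s
      zigzag_class_comp[of "Dom C s" "[Fwd s]" "Cod C s" "[Inv s]" "Dom C s"]
    by (simp add: loc_functor_def localization_Id)
  have "zigzag_step C W (Cod C s, [Inv s, Fwd s], Cod C s) (Cod C s, [], Cod C s)"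
    by (rule zigzag_stepI[OF elem_reduction.Inv_Fwd]) (use assms s in auto)
  then have 2: "Q s \<cdot>\<^bsub>L\<^esub> zclass (Cod C s, [Inv s], Dom C s) = Id L (Cod C s)"
    using zigzag_class_stepI assms s
      zigzag_class_comp[of "Cod C s" "[Inv s]" "Dom C s" "[Fwd s]" "Cod C s"]
    by (simp add: loc_functor_def localization_Id)
  show ?thesis
    unfolding inverse_pair_def Hom_iff
    using 1 2 s assms zigzag_class_arr[of "Cod C s" "[Inv s]" "Dom C s"] by simp
qed

lemma zigzag_class_Cons:
  assumes "zpath X (l # ls) Y"
  shows "zclass (X, l # ls, Y)
    = zclass (letter_tgt C l, ls, Y) \<cdot>\<^bsub>L\<^esub> zclass (X, [l], letter_tgt C l)"
  using zigzag_class_comp[of X "[l]" "letter_tgt C l" ls Y] assms letter_Obj by simp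

end

text \<open>An action of the letters determines a set-valued functor on the localization.\<close>

locale zigzag_action = category_with_weak_equivalences +
  fixes F :: "'a \<Rightarrow> 'e set" and act :: "'b letter \<Rightarrow> 'e \<Rightarrow> 'e"
  assumes act_mem: "letter_in C W l \<Longrightarrow> x \<in> F (letter_src C l) \<Longrightarrow> act l x \<in> F (letter_tgt C l)"
    and act_Comp: "f \<in> Arr C \<Longrightarrow> g \<in> Arr C \<Longrightarrow> Cod C f = Dom C g \<Longrightarrow> x \<in> F (Dom C f)
      \<Longrightarrow> act (Fwd (g \<cdot> f)) x = act (Fwd g) (act (Fwd f) x)"
    and act_Id: "X \<in> Obj C \<Longrightarrow> x \<in> F X \<Longrightarrow> act (Fwd (Id C X)) x = x"
    and act_Fwd_Inv: "s \<in> W \<Longrightarrow> x \<in> F (Dom C s) \<Longrightarrow> act (Inv s) (act (Fwd s) x) = x"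
    and act_Inv_Fwd: "s \<in> W \<Longrightarrow> x \<in> F (Cod C s) \<Longrightarrow> act (Fwd s) (act (Inv s) x) = x"
begin

definition acts :: "'b letter list \<Rightarrow> 'e \<Rightarrow> 'e" where
  "acts ls x = foldl (\<lambda>x l. act l x) x ls"

lemma acts_simps [simp]:
  "acts [] x = x" "acts (l # ls) x = acts ls (act l x)" "acts (us @ vs) x = acts vs (acts us x)"
  by (simp_all add: acts_def)

lemma acts_mem: "zpath X ls Y \<Longrightarrow> x \<in> F X \<Longrightarrow> acts ls x \<in> F Y"
  by (induction ls arbitrary: X x) (auto dest: act_mem)

lemma acts_elem_reduction:
  "elem_reduction C W ls ls' \<Longrightarrow> zpath X ls Y \<Longrightarrow> x \<in> F X \<Longrightarrow> acts ls x = acts ls' x"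
  by (induction rule: elem_reduction.induct)
    (auto simp: act_Comp act_Id act_Fwd_Inv act_Inv_Fwd)

lemma acts_zigzag_class_eq:
  assumes eq: "zclass (X, us, Y) = zclass (X, vs, Y)"
    and us: "zpath X us Y" and vs: "zpath X vs Y" and x: "x \<in> F X"
  shows "acts us x = acts vs x"
proof -
  have "equivclp (zigzag_step C W) (X, us, Y) (X, vs, Y)"
    using eq us vs zigzag_class_eq_iff by simp
  \<comment> \<open>Moves relate zigzags between arbitrary objects, whereas \<open>x\<close> may
    only be acted on from \<open>X\<close>. The guard on the source makes the statement invariant
    under all moves.\<close>
  then have "(fst (X, us, Y) = X \<longrightarrow> acts (fst (snd (X, us, Y))) x = acts us x)
      = (fst (X, vs, Y) = X \<longrightarrow> acts (fst (snd (X, vs, Y))) x = acts us x)"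
  proof (rule equivclp_zigzag_invariant)
    fix p q assume step: "zigzag_step C W p q"
    obtain X' Y' as ls ls' bs where pq: "p = (X', as @ ls @ bs, Y')" "q = (X', as @ ls' @ bs, Y')"
        "elem_reduction C W ls ls'" and zz: "zpath X' (as @ ls @ bs) Y'"
      using step unfolding zigzag_step_def by auto
    have "acts ls (acts as x) = acts ls' (acts as x)" if "X' = X"
      using zz x pq(3) that acts_mem acts_elem_reduction unfolding is_zigzag_append by blast
    then show "(fst p = X \<longrightarrow> acts (fst (snd p)) x = acts us x)
      = (fst q = X \<longrightarrow> acts (fst (snd q)) x = acts us x)"
      by (auto simp: pq)
  qed
  then show ?thesis by simp
qed

lemma act_loc_functor_eq:
  assumes "f \<in> Hom C X Y" "g \<in> Hom C X Y" "Q f = Q g" "x \<in> F X"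
  shows "act (Fwd f) x = act (Fwd g) x"
  using acts_zigzag_class_eq[of X "[Fwd f]" Y "[Fwd g]" x] assms
  by (auto simp: Hom_iff loc_functor_def)

end

section \<open>Set-valued functors given by elements modulo an equivalence relation\<close>

context category_with_weak_equivalences
begin

text \<open>On the quotients \<open>El X // R X\<close> the arrows in \<open>W\<close> act
  bijectively, by \<open>inj\<close> and \<open>surj\<close>, so the quotients carry a zigzag action
  and arrows with equal images under \<open>Q\<close> act equally on classes. The laws
  \<open>comp\<close> and \<open>id\<close> are literal equalities because \<open>F\<close> will be
  composition with a chain map.\<close>

lemma loc_functor_eq_setoid:
  fixes El :: "'a \<Rightarrow> 'e set"
  assumes equiv: "\<And>X. X \<in> Obj C \<Longrightarrow> equiv (El X) (R X)"
    and cong: "\<And>f x y. f \<in> Arr C \<Longrightarrow> (x, y) \<in> R (Dom C f) \<Longrightarrow> (F f x, F f y) \<in> R (Cod C f)"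
    and comp: "\<And>f g x. f \<in> Arr C \<Longrightarrow> g \<in> Arr C \<Longrightarrow> Cod C f = Dom C g \<Longrightarrow> x \<in> El (Dom C f)
      \<Longrightarrow> F (g \<cdot> f) x = F g (F f x)"
    and id: "\<And>X x. X \<in> Obj C \<Longrightarrow> x \<in> El X \<Longrightarrow> F (Id C X) x = x"
    and inj: "\<And>s x y. s \<in> W \<Longrightarrow> x \<in> El (Dom C s) \<Longrightarrow> y \<in> El (Dom C s)
      \<Longrightarrow> (F s x, F s y) \<in> R (Cod C s) \<Longrightarrow> (x, y) \<in> R (Dom C s)"
    and surj: "\<And>s y. s \<in> W \<Longrightarrow> y \<in> El (Cod C s) \<Longrightarrow> \<exists>x \<in> El (Dom C s). (y, F s x) \<in> R (Cod C s)"
    and f: "f \<in> Hom C X Y" and g: "g \<in> Hom C X Y" and eq: "Q f = Q g" and x: "x \<in> El X"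
  shows "(F f x, F g x) \<in> R Y"
proof -
  \<comment> \<open>Forward letters act by the saturated image and formal inverses by the preimage,
    so no representative has to be chosen.\<close>
  define act where "act = (\<lambda>l E. case l of Fwd f \<Rightarrow> R (Cod C f) `` (F f ` E)
    | Inv s \<Rightarrow> {x \<in> El (Dom C s). F s x \<in> E})"
  have refl: "(x, x) \<in> R X" if "X \<in> Obj C" "x \<in> El X" for X x
    using equiv[OF that(1)] that(2) by (auto simp: equiv_def refl_on_def)
  have mem: "F f x \<in> El (Cod C f)" if "f \<in> Arr C" "x \<in> El (Dom C f)" for f x
    using cong[OF that(1) refl[OF _ that(2)]] equiv[of "Cod C f"] that(1)
    by (auto simp: equiv_def refl_on_def)
  have act_Fwd: "act (Fwd f) (R (Dom C f) `` {x}) = R (Cod C f) `` {F f x}"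
    if f: "f \<in> Arr C" and x: "x \<in> El (Dom C f)" for f x
  proof -
    have "R (Cod C f) `` {F f y} = R (Cod C f) `` {F f x}" if "(x, y) \<in> R (Dom C f)" for y
      using equiv_class_eq[OF equiv cong[OF f that]] f by auto
    then have "(\<Union>y\<in>R (Dom C f) `` {x}. R (Cod C f) `` {F f y})
        = (\<Union>y\<in>R (Dom C f) `` {x}. R (Cod C f) `` {F f x})"
      by (intro SUP_cong) auto
    also have "\<dots> = R (Cod C f) `` {F f x}"
      using refl[of "Dom C f" x] f x by (subst UN_constant) auto
    finally show ?thesis by (simp add: act_def Image_eq_UN[of _ "F f ` _"])
  qed
  have act_Inv: "act (Inv s) (R (Cod C s) `` {F s x}) = R (Dom C s) `` {x}"
    if s: "s \<in> W" and x: "x \<in> El (Dom C s)" for s x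
  proof -
    have s': "s \<in> Arr C" using s weak_equivalences by auto
    have "y \<in> El (Dom C s)" if "(x, y) \<in> R (Dom C s)" for y
      using that equiv[of "Dom C s"] s' by (auto simp: equiv_def refl_on_def)
    then show ?thesis
      using inj[OF s x] cong[OF s', of x] by (auto simp: act_def)
  qed
  interpret zigzag_action C W "\<lambda>X. El X // R X" act
  proof
    show "act l E \<in> El (letter_tgt C l) // R (letter_tgt C l)"
      if l: "letter_in C W l" and E: "E \<in> El (letter_src C l) // R (letter_src C l)" for l E
    proof (cases l)
      case (Fwd f)
      obtain x where "x \<in> El (Dom C f)" "E = R (Dom C f) `` {x}"
        using E by (auto simp: Fwd elim: quotientE)
      then show ?thesis using l act_Fwd mem by (auto simp: Fwd intro!: quotientI)
    next
      case (Inv s)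
      obtain y where y: "y \<in> El (Cod C s)" "E = R (Cod C s) `` {y}"
        using E by (auto simp: Inv elim: quotientE)
      obtain x where x: "x \<in> El (Dom C s)" "(y, F s x) \<in> R (Cod C s)"
        using surj[OF _ y(1)] l by (auto simp: Inv)
      have "s \<in> Arr C" using l weak_equivalences by (auto simp: Inv)
      then have "E = R (Cod C s) `` {F s x}"
        unfolding y(2) by (intro equiv_class_eq[OF equiv x(2)]) simp
      then show ?thesis using l act_Inv[OF _ x(1)] x(1) by (auto simp: Inv intro!: quotientI)
    qed
    show "act (Fwd (g \<cdot> f)) E = act (Fwd g) (act (Fwd f) E)"
      if fg: "f \<in> Arr C" "g \<in> Arr C" "Cod C f = Dom C g" and E: "E \<in> El (Dom C f) // R (Dom C f)"
      for f g E
    proof -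
      obtain x where x: "x \<in> El (Dom C f)" "E = R (Dom C f) `` {x}"
        using E by (auto elim: quotientE)
      show ?thesis
        using act_Fwd[of f x] act_Fwd[of g "F f x"] act_Fwd[of "g \<cdot> f" x] mem[of f x] comp[of f g x] fg x
        by simp
    qed
    show "act (Fwd (Id C X)) E = E" if "X \<in> Obj C" "E \<in> El X // R X" for X E
      using that act_Fwd[of "Id C X"] id by (auto elim!: quotientE)
    show "act (Inv s) (act (Fwd s) E) = E" if s: "s \<in> W" and E: "E \<in> El (Dom C s) // R (Dom C s)" for s E
      using E act_Fwd[of s] act_Inv[OF s] s weak_equivalences by (auto elim!: quotientE)
    show "act (Fwd s) (act (Inv s) E) = E" if s: "s \<in> W" and E: "E \<in> El (Cod C s) // R (Cod C s)" for s E
    proof -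
      have s': "s \<in> Arr C" using s weak_equivalences by auto
      obtain y where y: "y \<in> El (Cod C s)" "E = R (Cod C s) `` {y}"
        using E by (auto elim: quotientE)
      obtain x where x: "x \<in> El (Dom C s)" "(y, F s x) \<in> R (Cod C s)"
        using surj[OF s y(1)] by auto
      have "E = R (Cod C s) `` {F s x}"
        unfolding y(2) by (intro equiv_class_eq[OF equiv x(2)]) (use s' in simp)
      then show ?thesis using act_Inv[OF s x(1)] act_Fwd[OF s' x(1)] by simp
    qed
  qed
  have XY: "X \<in> Obj C" "Y \<in> Obj C" "f \<in> Arr C" "g \<in> Arr C" using f g by (auto simp: Hom_iff)
  have "act (Fwd f) (R X `` {x}) = act (Fwd g) (R X `` {x})"
    by (rule act_loc_functor_eq[OF f g eq]) (use x in \<open>auto intro: quotientI\<close>)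
  then have "R Y `` {F f x} = R Y `` {F g x}"
    using act_Fwd[of f x] act_Fwd[of g x] f g x XY by (simp add: Hom_iff)
  then show ?thesis
    using eq_equiv_class[OF _ equiv[OF XY(2)]] mem[of g x] g x by (auto simp: Hom_iff)
qed

end

section \<open>Cones\<close>

context preadditive_category
begin

lemma is_biproductD:
  assumes "is_biproduct A X Y B"
  shows "bobj B \<in> Obj A"
    "inj1 B \<in> Arr A" "Dom A (inj1 B) = X" "Cod A (inj1 B) = bobj B"
    "inj2 B \<in> Arr A" "Dom A (inj2 B) = Y" "Cod A (inj2 B) = bobj B"
    "prj1 B \<in> Arr A" "Dom A (prj1 B) = bobj B" "Cod A (prj1 B) = X"
    "prj2 B \<in> Arr A" "Dom A (prj2 B) = bobj B" "Cod A (prj2 B) = Y"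
    "prj1 B \<cdot> inj1 B = Id A X" "prj2 B \<cdot> inj2 B = Id A Y"
    "prj2 B \<cdot> inj1 B = Zero A X Y" "prj1 B \<cdot> inj2 B = Zero A Y X"
    "(inj1 B \<cdot> prj1 B) \<oplus> (inj2 B \<cdot> prj2 B) = Id A (bobj B)"
  using assms by (auto simp: is_biproduct_def Hom_iff)

lemma biproduct_comp:
  assumes B: "is_biproduct A X Y B"
  shows "f \<in> Arr A \<Longrightarrow> Cod A f = X \<Longrightarrow> prj1 B \<cdot> (inj1 B \<cdot> f) = f"
    "f \<in> Arr A \<Longrightarrow> Cod A f = Y \<Longrightarrow> prj2 B \<cdot> (inj2 B \<cdot> f) = f"
    "f \<in> Arr A \<Longrightarrow> Cod A f = X \<Longrightarrow> prj2 B \<cdot> (inj1 B \<cdot> f) = Zero A (Dom A f) Y"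
    "f \<in> Arr A \<Longrightarrow> Cod A f = Y \<Longrightarrow> prj1 B \<cdot> (inj2 B \<cdot> f) = Zero A (Dom A f) X"
proof -
  note BD = is_biproductD[OF B]
  have obj: "X \<in> Obj A" "Y \<in> Obj A" using BD by force+
  show "prj1 B \<cdot> (inj1 B \<cdot> f) = f" if "f \<in> Arr A" "Cod A f = X"
    using comp_assoc[of f "inj1 B" "prj1 B"] BD(1-13) that by (simp add: BD(14))
  show "prj2 B \<cdot> (inj2 B \<cdot> f) = f" if "f \<in> Arr A" "Cod A f = Y"
    using comp_assoc[of f "inj2 B" "prj2 B"] BD(1-13) that by (simp add: BD(15))
  show "prj2 B \<cdot> (inj1 B \<cdot> f) = Zero A (Dom A f) Y" if "f \<in> Arr A" "Cod A f = X"
    using comp_assoc[of f "inj1 B" "prj2 B"] BD(1-13) that obj by (simp add: BD(16))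
  show "prj1 B \<cdot> (inj2 B \<cdot> f) = Zero A (Dom A f) X" if "f \<in> Arr A" "Cod A f = Y"
    using comp_assoc[of f "inj2 B" "prj1 B"] BD(1-13) that obj by (simp add: BD(17))
qed

lemma biproduct_decompose:
  assumes B: "is_biproduct A X Y B" and f: "f \<in> Arr A" "Cod A f = bobj B"
  shows "f = (inj1 B \<cdot> (prj1 B \<cdot> f)) \<oplus> (inj2 B \<cdot> (prj2 B \<cdot> f))"
proof -
  note BD = is_biproductD[OF B]
  have "f = ((inj1 B \<cdot> prj1 B) \<oplus> (inj2 B \<cdot> prj2 B)) \<cdot> f"
    unfolding BD(18) using f by simp
  then show ?thesis using BD(1-13) f by simp
qed

lemma biproduct_ext:
  assumes B: "is_biproduct A X Y B" and f: "f \<in> Arr A" "Dom A f = bobj B"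
    and g: "g \<in> Arr A" "Dom A g = bobj B" and cod: "Cod A f = Cod A g"
    and eq: "f \<cdot> inj1 B = g \<cdot> inj1 B" "f \<cdot> inj2 B = g \<cdot> inj2 B"
  shows "f = g"
proof -
  note BD = is_biproductD[OF B]
  have *: "h = (h \<cdot> inj1 B) \<cdot> prj1 B \<oplus> (h \<cdot> inj2 B) \<cdot> prj2 B"
    if h: "h \<in> Arr A" "Dom A h = bobj B" for h
  proof -
    have "h = h \<cdot> ((inj1 B \<cdot> prj1 B) \<oplus> (inj2 B \<cdot> prj2 B))"
      unfolding BD(18) using h by simp
    then show ?thesis using BD(1-13) h by simp
  qed
  show ?thesis using *[OF f] *[OF g] eq by simp
qed

end

context abelian_category
begin

lemma cone_biproduct:
  assumes "is_chain_map A (X, f, Y)"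
  shows "is_biproduct A (ob Y n) (ob X (n - 1)) (cone_summands A (X, f, Y) n)"
  using chain_mapD[OF assms] by (simp add: cone_summands_def biproduct_is_biproduct)

lemma cone_ob: "ob (cone A (X, f, Y)) n = bobj (cone_summands A (X, f, Y) n)"
  by (simp add: cone_def Let_def)

lemma cone_diff:
  assumes f: "is_chain_map A (X, f, Y)"
  defines "B \<equiv> cone_summands A (X, f, Y)"
  shows "diff (cone A (X, f, Y)) n \<in> Arr A" "Dom A (diff (cone A (X, f, Y)) n) = bobj (B n)"
    "Cod A (diff (cone A (X, f, Y)) n) = bobj (B (n - 1))"
    "diff (cone A (X, f, Y)) n \<cdot> inj1 (B n) = inj1 (B (n - 1)) \<cdot> diff Y n"
    "diff (cone A (X, f, Y)) n \<cdot> inj2 (B n) =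
       (inj1 (B (n - 1)) \<cdot> f (n - 1)) \<oplus> (inj2 (B (n - 1)) \<cdot> Neg A (diff X (n - 1)))"
proof -
  note fD = chain_mapD[OF f]
  note BD = is_biproductD[OF cone_biproduct[OF f], folded B_def]
  show "diff (cone A (X, f, Y)) n \<in> Arr A" "Dom A (diff (cone A (X, f, Y)) n) = bobj (B n)"
    "Cod A (diff (cone A (X, f, Y)) n) = bobj (B (n - 1))"
    "diff (cone A (X, f, Y)) n \<cdot> inj1 (B n) = inj1 (B (n - 1)) \<cdot> diff Y n"
    "diff (cone A (X, f, Y)) n \<cdot> inj2 (B n) =
       (inj1 (B (n - 1)) \<cdot> f (n - 1)) \<oplus> (inj2 (B (n - 1)) \<cdot> Neg A (diff X (n - 1)))"
    using fD(1-5) BD(1-17) by (simp_all add: cone_def Let_def flip: B_def)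
qed

lemma cone_complex:
  assumes f: "is_chain_map A (X, f, Y)"
  shows "is_chain_complex A (cone A (X, f, Y))"
proof -
  define B where "B = cone_summands A (X, f, Y)"
  define d where "d = diff (cone A (X, f, Y))"
  note fD = chain_mapD[OF f]
  note B = cone_biproduct[OF f, folded B_def]
  note BD = is_biproductD[OF B]
  note dD = cone_diff[OF f, folded B_def d_def]
  have dd: "d (n - 1) \<cdot> d n = Zero A (bobj (B n)) (bobj (B (n - 1 - 1)))" for n
  proof (rule biproduct_ext[OF B])
    have "(d (n - 1) \<cdot> d n) \<cdot> inj1 (B n) = d (n - 1) \<cdot> (d n \<cdot> inj1 (B n))"
      by (rule comp_assoc) (use dD(1-3) BD(1-13) in auto)
    also have "\<dots> = (d (n - 1) \<cdot> inj1 (B (n - 1))) \<cdot> diff Y n"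
      unfolding dD(4)[of n] using dD(1-3) BD(1-13) fD(1-5) by simp
    also have "\<dots> = Zero A (ob Y n) (bobj (B (n - 1 - 1)))"
      unfolding dD(4)[of "n - 1"] using dD(1-3) BD(1-13) fD(1-5) by simp
    finally show "(d (n - 1) \<cdot> d n) \<cdot> inj1 (B n) = Zero A (bobj (B n)) (bobj (B (n - 1 - 1))) \<cdot> inj1 (B n)"
      using BD(1-13) by simp
    have "(d (n - 1) \<cdot> d n) \<cdot> inj2 (B n) = d (n - 1) \<cdot> (d n \<cdot> inj2 (B n))"
      by (rule comp_assoc) (use dD(1-3) BD(1-13) in auto)
    \<comment> \<open>The two contributions to the first summand are \<open>diff Y\<close> after
      \<open>f\<close>, and minus \<open>f\<close> after \<open>diff X\<close>. They cancel because
      \<open>f\<close> is a chain map, which is the purpose of the sign in the cone.\<close>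
    also have "\<dots> = (d (n - 1) \<cdot> inj1 (B (n - 1))) \<cdot> f (n - 1)
        \<oplus> Neg A ((d (n - 1) \<cdot> inj2 (B (n - 1))) \<cdot> diff X (n - 1))"
      unfolding dD(5)[of n] using dD(1-3) BD(1-13) fD(1-5) by simp
    also have "\<dots> = Zero A (ob X (n - 1)) (bobj (B (n - 1 - 1)))"
      unfolding dD(4)[of "n - 1"] dD(5)[of "n - 1"] using dD(1-3) BD(1-13) fD by simp
    finally show "(d (n - 1) \<cdot> d n) \<cdot> inj2 (B n) = Zero A (bobj (B n)) (bobj (B (n - 1 - 1))) \<cdot> inj2 (B n)"
      using BD(1-13) by simp
  qed (use dD(1-3) BD(1-13) in auto)
  show ?thesis
    by (rule chain_complexI) (use dD(1-3) BD(1) dd in \<open>simp_all add: cone_ob flip: B_def d_def\<close>)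
qed

lemma cone_incl_chain_map:
  assumes f: "is_chain_map A (X, f, Y)"
  shows "is_chain_map A (cone_incl A (X, f, Y))"
proof -
  note BD = is_biproductD[OF cone_biproduct[OF f]]
  show ?thesis
    unfolding cone_incl_def prod.case
    by (rule chain_mapI[OF chain_mapD(2)[OF f] cone_complex[OF f]])
      (use BD(1-13) cone_diff(4)[OF f] in \<open>auto simp: cone_ob\<close>)
qed

lemma shift_complex_complex:
  assumes X: "is_chain_complex A X"
  shows "is_chain_complex A (shift_complex A X)"
  by (rule chain_complexI) (use X in \<open>simp_all add: shift_complex_def\<close>)

text \<open>The counterpart of \<open>cone_diff\<close> for projections: it reads off the two
  components of an equation between arrows into a cone.\<close>

lemma cone_diff_prj:
  assumes f: "is_chain_map A (X, f, Y)"
  defines "B \<equiv> cone_summands A (X, f, Y)"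
  shows "prj1 (B (n - 1)) \<cdot> diff (cone A (X, f, Y)) n
      = (diff Y n \<cdot> prj1 (B n)) \<oplus> (f (n - 1) \<cdot> prj2 (B n))"
    "prj2 (B (n - 1)) \<cdot> diff (cone A (X, f, Y)) n = Neg A (diff X (n - 1) \<cdot> prj2 (B n))"
proof -
  note fD = chain_mapD[OF f]
  note B = cone_biproduct[OF f, folded B_def]
  note BD = is_biproductD[OF B]
  show "prj1 (B (n - 1)) \<cdot> diff (cone A (X, f, Y)) n
      = (diff Y n \<cdot> prj1 (B n)) \<oplus> (f (n - 1) \<cdot> prj2 (B n))"
    "prj2 (B (n - 1)) \<cdot> diff (cone A (X, f, Y)) n = Neg A (diff X (n - 1) \<cdot> prj2 (B n))"
    using fD(1-5) BD(1-17) biproduct_comp[OF B]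
    by (simp_all add: cone_def Let_def neg_zero flip: B_def)
qed

lemma cone_proj_chain_map:
  assumes f: "is_chain_map A (X, f, Y)"
  shows "is_chain_map A (cone_proj A (X, f, Y))"
proof -
  note fD = chain_mapD[OF f] and BD = is_biproductD[OF cone_biproduct[OF f]]
  show ?thesis
    unfolding cone_proj_def prod.case
    by (intro chain_mapI cone_complex[OF f] shift_complex_complex[OF fD(1)])
      (use BD(1-13) fD(1-5) cone_diff_prj(2)[OF f] in \<open>simp_all add: shift_complex_def cone_ob\<close>)
qed

text \<open>A chain map out of a cone is a chain map \<open>\<phi>\<close> out of the target of \<open>f\<close> together with a
  null-homotopy \<open>k\<close> of \<open>\<phi> \<cdot> f\<close>.\<close>

lemma cone_desc:
  assumes f: "is_chain_map A (X, f, Y)" and \<phi>: "is_chain_map A (Y, \<phi>, Z)"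
    and k: "\<And>n. k n \<in> Arr A" "\<And>n. Dom A (k n) = ob X (n - 1)" "\<And>n. Cod A (k n) = ob Z n"
      "\<And>n. (diff Z n \<cdot> k n) \<oplus> (k (n - 1) \<cdot> diff X (n - 1)) = \<phi> (n - 1) \<cdot> f (n - 1)"
  defines "B \<equiv> cone_summands A (X, f, Y)"
  assumes F_def: "\<And>n. F n = (\<phi> n \<cdot> prj1 (B n)) \<oplus> (k n \<cdot> prj2 (B n))"
  shows "is_chain_map A (cone A (X, f, Y), F, Z)" "F n \<cdot> inj1 (B n) = \<phi> n"
    "F n \<cdot> inj2 (B n) = k n"
proof -
  define d where "d = diff (cone A (X, f, Y))"
  note fD = chain_mapD[OF f] and pD = chain_mapD[OF \<phi>]
  note B = cone_biproduct[OF f, folded B_def]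
  note BD = is_biproductD[OF B]
  note dD = cone_diff[OF f, folded B_def d_def]
  have F: "F n \<in> Arr A" "Dom A (F n) = bobj (B n)" "Cod A (F n) = ob Z n" for n
    using BD(1-13) pD k(1-3) by (simp_all add: F_def)
  have F1: "F n \<cdot> inj1 (B n) = \<phi> n" for n
    using BD(1-17) pD(1-5) k(1-3) by (simp add: F_def)
  have F2: "F n \<cdot> inj2 (B n) = k n" for n
    using BD(1-17) pD(1-5) k(1-3) fD(1-5) by (simp add: F_def)
  show "F n \<cdot> inj1 (B n) = \<phi> n" "F n \<cdot> inj2 (B n) = k n" by fact+
  have comm: "diff Z n \<cdot> F n = F (n - 1) \<cdot> d n" for n
  proof (rule biproduct_ext[OF B])
    have "(diff Z n \<cdot> F n) \<cdot> inj1 (B n) = diff Z n \<cdot> (F n \<cdot> inj1 (B n))"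
      "(diff Z n \<cdot> F n) \<cdot> inj2 (B n) = diff Z n \<cdot> (F n \<cdot> inj2 (B n))"
      by (rule comp_assoc; use F BD(1-13) pD in simp)+
    then have L: "(diff Z n \<cdot> F n) \<cdot> inj1 (B n) = \<phi> (n - 1) \<cdot> diff Y n"
       "(diff Z n \<cdot> F n) \<cdot> inj2 (B n) = diff Z n \<cdot> k n"
      unfolding F1 F2 using pD(6) by simp_all
    have "(F (n - 1) \<cdot> d n) \<cdot> inj1 (B n) = F (n - 1) \<cdot> (d n \<cdot> inj1 (B n))"
      by (rule comp_assoc) (use F BD(1-13) dD(1-3) in simp_all)
    also have "\<dots> = (F (n - 1) \<cdot> inj1 (B (n - 1))) \<cdot> diff Y n"
      unfolding dD(4) by (rule comp_assoc[symmetric]) (use F BD(1-13) pD in simp_all)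
    finally show "(diff Z n \<cdot> F n) \<cdot> inj1 (B n) = (F (n - 1) \<cdot> d n) \<cdot> inj1 (B n)"
      unfolding L F1 ..
    have "(F (n - 1) \<cdot> d n) \<cdot> inj2 (B n) = F (n - 1) \<cdot> (d n \<cdot> inj2 (B n))"
      by (rule comp_assoc) (use F BD(1-13) dD(1-3) in simp_all)
    also have "\<dots> = (F (n - 1) \<cdot> inj1 (B (n - 1))) \<cdot> f (n - 1)
        \<oplus> Neg A ((F (n - 1) \<cdot> inj2 (B (n - 1))) \<cdot> diff X (n - 1))"
      unfolding dD(5) using F BD(1-13) pD(1-5) fD(1-5) by simp
    \<comment> \<open>The homotopy equation replaces \<open>\<phi>\<close> after \<open>f\<close>;
      the minus sign of the cone differential then removes its second term.\<close>
    also have "\<dots> = ((diff Z n \<cdot> k n) \<oplus> (k (n - 1) \<cdot> diff X (n - 1))) \<oplus> Neg A (k (n - 1) \<cdot> diff X (n - 1))"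
      unfolding F1 F2 k(4) ..
    also have "\<dots> = diff Z n \<cdot> k n"
      using fD(1-5) pD(1-5) k(1-3) by simp
    finally show "(diff Z n \<cdot> F n) \<cdot> inj2 (B n) = (F (n - 1) \<cdot> d n) \<cdot> inj2 (B n)"
      unfolding L ..
  qed (use F dD(1-3) BD(1-13) pD(1-5) in auto)
  show "is_chain_map A (cone A (X, f, Y), F, Z)"
    by (intro chain_mapI cone_complex[OF f])
      (use F comm pD in \<open>simp_all add: cone_ob flip: B_def d_def\<close>)
qed

end

section \<open>Complexes with zero differential\<close>

definition zero_diff ::
  "('o, 'm, 'z) preadditive_data_scheme \<Rightarrow> ('o, 'm) chain_complex \<Rightarrow> bool" where
  "zero_diff A P \<longleftrightarrow> is_chain_complex A P \<and> (\<forall>n. diff P n = Zero A (ob P n) (ob P (n - 1)))"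

definition zero_diff_complex ::
  "('o, 'm, 'z) preadditive_data_scheme \<Rightarrow> (int \<Rightarrow> 'o) \<Rightarrow> ('o, 'm) chain_complex" where
  "zero_diff_complex A p = \<lparr>ob = p, diff = \<lambda>n. Zero A (p n) (p (n - 1))\<rparr>"

context abelian_category
begin

lemma ob_zero_diff_complex [simp]: "ob (zero_diff_complex A p) = p"
  by (simp add: zero_diff_complex_def)

lemma zero_diffD:
  assumes "zero_diff A P"
  shows "is_chain_complex A P" "diff P n = Zero A (ob P n) (ob P (n - 1))"
  using assms by (auto simp: zero_diff_def)

lemma zero_diff_complex: "(\<And>n. p n \<in> Obj A) \<Longrightarrow> zero_diff A (zero_diff_complex A p)"
  unfolding zero_diff_def by (auto intro!: chain_complexI simp: zero_diff_complex_def)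

text \<open>With zero differential on the source, commuting with differentials says only that each
  \<open>z n\<close> is a cycle, so the degrees can be chosen independently.\<close>

lemma zero_diff_chain_map:
  assumes P: "zero_diff A P" and X: "is_chain_complex A X"
    and z: "\<And>n. cycle_elem A X n (z n)" "\<And>n. Dom A (z n) = ob P n"
  shows "is_chain_map A (P, z, X)"
  by (rule chain_mapI) (use zero_diffD[OF P] cycle_elemD[OF z(1)] z(2) X in auto)

lemma zero_diff_chain_map_cycle:
  assumes P: "zero_diff A P" and f: "is_chain_map A (P, f, X)"
  shows "cycle_elem A X n (f n)"
  using chain_mapD[OF f] zero_diffD[OF P] by (simp add: cycle_elem_def)

lemma zero_diff_cycle:
  assumes P: "zero_diff A P" and z: "z \<in> Arr A" "Cod A z = ob P n"
  shows "cycle_elem A P n z"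
  using zero_diffD[OF P] z by (simp add: cycle_elem_def)

lemma zero_diff_boundary:
  assumes P: "zero_diff A P" and z: "boundary_elem A P n z"
  shows "z = Zero A (Dom A z) (ob P n)"
proof -
  obtain w where "w \<in> Arr A" "Dom A w = Dom A z" "Cod A w = ob P (n + 1)" and zw: "z = diff P (n + 1) \<cdot> w"
    using z by (auto simp: boundary_elem_def Hom_iff)
  then show ?thesis
    using zero_diffD(1)[OF P] zero_diffD(2)[OF P, of "n + 1"] by (subst zw) simp
qed

text \<open>The identity of \<open>ob P n\<close> is a cycle through which every cycle of
  \<open>P\<close> in degree \<open>n\<close> factors. Evaluating there shows that the class of
  \<open>f n\<close> carries the map in homology.\<close>

lemma homology_map_zero_diff:
  assumes P: "zero_diff A P" and f: "is_chain_map A (P, f, X)"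
  shows "homology_map A n (P, f, X) \<cdot> homology_class A P n (Id A (ob P n)) = homology_class A X n (f n)"
proof -
  have "cycle_elem A P n (Id A (ob P n))"
    by (rule zero_diff_cycle[OF P]) (use zero_diffD[OF P] in auto)
  from homology_map_class[OF f this] show ?thesis using chain_mapD[OF f] by simp
qed

end

context abelian_category_enough_projectives
begin

sublocale Ch: category_with_weak_equivalences "Ch A" "quasi_isos A"
  by (intro category_with_weak_equivalences.intro category_Ch category_with_weak_equivalences_axioms.intro)
    (auto simp: quasi_isos_def)

sublocale D: category "localization (Ch A) (quasi_isos A)"
  by (rule Ch.category_localization)

abbreviation comp_L (infixr "\<bullet>" 70) where "\<psi> \<bullet> \<phi> \<equiv> Comp Ch.L \<psi> \<phi>"

text \<open>The two ends of the cylinder \<open>cone (inj2 : P \<rightarrow> P \<oplus> P)\<close> become equal in the localization, since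
  the cylinder projects quasi-isomorphically onto \<open>P\<close>.\<close>

lemma loc_functor_homotopic:
  assumes P: "zero_diff A P"
    and f: "is_chain_map A (P, f, Y)" and g: "is_chain_map A (P, g, Y)"
    and k: "\<And>n. k n \<in> Arr A" "\<And>n. Dom A (k n) = ob P n" "\<And>n. Cod A (k n) = ob Y (n + 1)"
      "\<And>n. g n = f n \<oplus> diff Y (n + 1) \<cdot> k n"
  shows "Ch.Q (P, f, Y) = Ch.Q (P, g, Y)"
proof -
  note PD = zero_diffD[OF P] and fD = chain_mapD[OF f] and gD = chain_mapD[OF g]
  define B where "B = (\<lambda>n. biproduct A (ob P n) (ob P n))"
  have B: "is_biproduct A (ob P n) (ob P n) (B n)" for n
    unfolding B_def using PD(1) by (simp add: biproduct_is_biproduct)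
  note BD = is_biproductD[OF B]
  define P2 where "P2 = zero_diff_complex A (\<lambda>n. bobj (B n))"
  have P2: "zero_diff A P2" unfolding P2_def by (rule zero_diff_complex) (rule BD(1))
  have ob_P2: "ob P2 n = bobj (B n)" for n by (simp add: P2_def)
  note P2D = zero_diffD[OF P2, unfolded ob_P2]
  \<comment> \<open>An element of \<open>P2\<close> is read as a pair (start, difference). The cone
    on \<open>j\<close> makes the difference null-homotopic, and the two ends of the cylinder are
    \<open>(1, 0)\<close> and \<open>(1, 1)\<close>, called \<open>i0\<close> and \<open>i1\<close>
    below.\<close>
  define j where "j = (\<lambda>n. inj2 (B n))"
  have to_P2: "is_chain_map A (P, h, P2)"
    if "\<And>n. h n \<in> Arr A" "\<And>n. Dom A (h n) = ob P n" "\<And>n. Cod A (h n) = bobj (B n)" for h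
    by (rule zero_diff_chain_map[OF P P2D(1)])
      (use that in \<open>auto intro!: zero_diff_cycle[OF P2] simp: ob_P2\<close>)
  have j: "is_chain_map A (P, j, P2)"
    by (rule to_P2) (use BD in \<open>auto simp: j_def\<close>)
  define C where "C = cone_summands A (P, j, P2)"
  define Cyl where "Cyl = cone A (P, j, P2)"
  note Cb = cone_biproduct[OF j, folded C_def, unfolded ob_P2]
  note CD = is_biproductD[OF Cb]
  have Cyl: "is_chain_complex A Cyl" unfolding Cyl_def by (rule cone_complex[OF j])
  have ob_Cyl: "ob Cyl n = bobj (C n)" for n by (simp add: Cyl_def C_def cone_ob)
  note dC = cone_diff[OF j, folded C_def Cyl_def]
  have d1: "diff Cyl n \<cdot> inj1 (C n) = Zero A (bobj (B n)) (bobj (C (n - 1)))" for n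
    unfolding dC(4) using P2D(1) CD(1-4)[of "n - 1"] BD(1)[of "n - 1"] BD(1)[of n] by (simp add: P2D(2))
  have d2: "diff Cyl n \<cdot> inj2 (C n) = inj1 (C (n - 1)) \<cdot> inj2 (B (n - 1))" for n
    unfolding dC(5) using PD CD(1-13)[of "n - 1"] BD(1-13)[of "n - 1"] by (simp add: j_def)

  \<comment> \<open>Forgetting the difference kills \<open>j\<close> strictly, so the zero
    null-homotopy \<open>k0\<close> extends this projection to the cylinder.\<close>
  define \<phi> where "\<phi> = (\<lambda>n. prj1 (B n))"
  have \<phi>: "is_chain_map A (P2, \<phi>, P)"
    by (rule zero_diff_chain_map[OF P2 PD(1)])
      (use BD in \<open>auto intro!: zero_diff_cycle[OF P] simp: ob_P2 \<phi>_def\<close>)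
  define k0 where "k0 = (\<lambda>n. Zero A (ob P (n - 1)) (ob P n))"
  have k0: "(diff P n \<cdot> k0 n) \<oplus> (k0 (n - 1) \<cdot> diff P (n - 1)) = \<phi> (n - 1) \<cdot> j (n - 1)" for n
    using PD BD(1-17)[of "n - 1"] by (simp add: k0_def \<phi>_def j_def)
  define p where "p = (\<lambda>n. (\<phi> n \<cdot> prj1 (C n)) \<oplus> (k0 n \<cdot> prj2 (C n)))"
  note p_raw = cone_desc[OF j \<phi> _ _ _ k0, folded C_def Cyl_def, OF _ _ _ p_def[THEN fun_cong]]
  have p: "is_chain_map A (Cyl, p, P)"
    by (rule p_raw) (use PD in \<open>auto simp: k0_def\<close>)
  have "p n \<cdot> inj1 (C n) = \<phi> n" for n
    by (rule p_raw) (use PD in \<open>auto simp: k0_def\<close>)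
  then have p1: "p n \<cdot> inj1 (C n) = prj1 (B n)" for n
    by (simp add: \<phi>_def)
  have p2: "p n \<cdot> inj2 (C n) = k0 n" for n
    by (rule p_raw) (use PD in \<open>auto simp: k0_def\<close>)
  note pD = chain_mapD[OF p, unfolded ob_Cyl]

  \<comment> \<open>\<open>f\<close> on the start and \<open>diff Y\<close> after \<open>k\<close>
    on the difference: on the two ends this gives \<open>f\<close>, and \<open>f\<close> plus that
    boundary, which is \<open>g\<close>.\<close>
  define \<psi> where "\<psi> = (\<lambda>n. (f n \<cdot> prj1 (B n)) \<oplus> (diff Y (n + 1) \<cdot> (k n \<cdot> prj2 (B n))))"
  have \<psi>: "is_chain_map A (P2, \<psi>, Y)"
  proof (rule zero_diff_chain_map[OF P2 fD(2)])
    fix n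
    show "Dom A (\<psi> n) = ob P2 n"
      using fD(1-5) k BD(1-13)[of n] by (simp add: \<psi>_def ob_P2)
    have "diff Y n \<cdot> (f n \<cdot> prj1 (B n)) = f (n - 1) \<cdot> (diff P n \<cdot> prj1 (B n))"
      by (rule chain_map_comp_diff[OF f]) (use BD(1-13)[of n] in auto)
    then show "cycle_elem A Y n (\<psi> n)"
      using fD(1-5) k(1-3) BD(1-13)[of n] PD by (simp add: \<psi>_def cycle_elem_def)
  qed
  \<comment> \<open>In degree \<open>n\<close> the second summand of the cone is
    \<open>ob P (n - 1)\<close>, hence the shift. The term with the differential of \<open>P\<close>
    vanishes, so \<open>k\<close> alone is a null-homotopy of \<open>\<psi>\<close> after
    \<open>j\<close>.\<close>
  define k' where "k' = (\<lambda>n. k (n - 1))"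
  have k': "(diff Y n \<cdot> k' n) \<oplus> (k' (n - 1) \<cdot> diff P (n - 1)) = \<psi> (n - 1) \<cdot> j (n - 1)" for n
    using fD(1-5) k(1-3) k(3)[of "n - 1"] k(3)[of "n - 1 - 1"] BD(1-17)[of "n - 1"] PD
    by (simp add: k'_def \<psi>_def j_def)
  define F where "F = (\<lambda>n. (\<psi> n \<cdot> prj1 (C n)) \<oplus> (k' n \<cdot> prj2 (C n)))"
  note F_raw = cone_desc[OF j \<psi> _ _ _ k', folded C_def Cyl_def, OF _ _ _ F_def[THEN fun_cong]]
  have F: "is_chain_map A (Cyl, F, Y)"
    by (rule F_raw) (use k(1-3) k(3)[of "_ - 1"] in \<open>auto simp: k'_def\<close>)
  have F1: "F n \<cdot> inj1 (C n) = \<psi> n" for n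
    by (rule F_raw) (use k(1-3) k(3)[of "_ - 1"] in \<open>auto simp: k'_def\<close>)
  note FD = chain_mapD[OF F, unfolded ob_Cyl]

  have incl: "is_chain_map A (P, \<lambda>n. inj1 (C n) \<cdot> h n, Cyl)"
    if "\<And>n. h n \<in> Arr A" "\<And>n. Dom A (h n) = ob P n" "\<And>n. Cod A (h n) = bobj (B n)" for h
    using chain_map_comp[OF to_P2[OF that] cone_incl_chain_map[OF j, unfolded cone_incl_def prod.case]]
    by (simp add: C_def Cyl_def)
  define i0 where "i0 = (\<lambda>n. inj1 (C n) \<cdot> inj1 (B n))"
  define i1 where "i1 = (\<lambda>n. inj1 (C n) \<cdot> (inj1 (B n) \<oplus> inj2 (B n)))"
  have i0: "is_chain_map A (P, i0, Cyl)" unfolding i0_def by (rule incl) (use BD in auto)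
  have i1: "is_chain_map A (P, i1, Cyl)" unfolding i1_def by (rule incl) (use BD in auto)

  have comp_incl: "G n \<cdot> (inj1 (C n) \<cdot> h) = (G n \<cdot> inj1 (C n)) \<cdot> h"
    if "is_chain_map A (Cyl, G, Z)" "h \<in> Arr A" "Cod A h = bobj (B n)" for G Z h n
    by (rule comp_assoc[symmetric])
      (use that chain_mapD[OF that(1), unfolded ob_Cyl] CD(1-4)[of n] in auto)
  have pi: "p n \<cdot> i0 n = Id A (ob P n)" "p n \<cdot> i1 n = Id A (ob P n)" for n
    using comp_incl[OF p, of "inj1 (B n)" n] comp_incl[OF p, of "inj1 (B n) \<oplus> inj2 (B n)" n]
      BD(1-17)[of n] PD by (simp_all add: i0_def i1_def p1)
  have Fi: "F n \<cdot> i0 n = f n" "F n \<cdot> i1 n = g n" for n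
    using comp_incl[OF F, of "inj1 (B n)" n] comp_incl[OF F, of "inj1 (B n) \<oplus> inj2 (B n)" n]
      BD(1-17)[of n] PD fD(1-5) k by (simp_all add: i0_def i1_def F1 \<psi>_def)

  have "(Cyl, p, P) \<in> quasi_isos A"
  proof (rule quasi_isoI[OF p])
    fix n z assume z: "cycle_elem A Cyl n z" and b: "boundary_elem A P n (p n \<cdot> z)"
    define T where "T = Dom A z"
    note zD = cycle_elemD[OF z, unfolded ob_Cyl, folded T_def]
    have T: "T \<in> Obj A" using zD(1) by (simp add: T_def)
    define z1 z2 where "z1 = prj1 (C n) \<cdot> z" and "z2 = prj2 (C n) \<cdot> z"
    have z1: "z1 \<in> Arr A" "Dom A z1 = T" "Cod A z1 = bobj (B n)"
      and z2: "z2 \<in> Arr A" "Dom A z2 = T" "Cod A z2 = ob P (n - 1)"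
      using zD(1,2) CD(1-13)[of n] by (simp_all add: z1_def z2_def T_def)
    have z_eq: "z = inj1 (C n) \<cdot> z1 \<oplus> inj2 (C n) \<cdot> z2"
      unfolding z1_def z2_def by (rule biproduct_decompose[OF Cb zD(1,2)])
    have split: "h \<cdot> z = (h \<cdot> inj1 (C n)) \<cdot> z1 \<oplus> (h \<cdot> inj2 (C n)) \<cdot> z2"
      if "h \<in> Arr A" "Dom A h = bobj (C n)" for h
      unfolding z_eq using that z1 z2 CD(1-7)[of n] by simp
    have "p n \<cdot> z = prj1 (B n) \<cdot> z1"
      using split[of "p n"] pD(3-5) z1 z2 PD BD(1-13)[of n] by (simp add: p1 p2 k0_def)
    then have z1_0: "prj1 (B n) \<cdot> z1 = Zero A T (ob P n)"
      using zero_diff_boundary[OF P b] z1 BD(1-13)[of n] by simp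
    \<comment> \<open>The cone differential embeds the second component \<open>z2\<close> by split
      monos, so a cycle has \<open>z2\<close> zero.\<close>
    have "diff Cyl n \<cdot> z = inj1 (C (n - 1)) \<cdot> (inj2 (B (n - 1)) \<cdot> z2)"
      using split[of "diff Cyl n"] dC(1-3)[of n] z1 z2 CD(1-7)[of "n - 1"] BD(1-7)[of "n - 1"]
      by (simp add: d1 d2)
    then have "prj1 (C (n - 1)) \<cdot> (inj1 (C (n - 1)) \<cdot> (inj2 (B (n - 1)) \<cdot> z2))
        = prj1 (C (n - 1)) \<cdot> Zero A T (bobj (C (n - 1)))"
      using zD(3) by (simp add: ob_Cyl)
    then have "inj2 (B (n - 1)) \<cdot> z2 = Zero A T (bobj (B (n - 1)))"
      using biproduct_comp(1)[OF Cb, of "inj2 (B (n - 1)) \<cdot> z2" "n - 1"] z2 BD(1-7)[of "n - 1"]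
        CD(1-13)[of "n - 1"] T by simp
    then have "prj2 (B (n - 1)) \<cdot> (inj2 (B (n - 1)) \<cdot> z2) = prj2 (B (n - 1)) \<cdot> Zero A T (bobj (B (n - 1)))"
      by simp
    then have z2_0: "z2 = Zero A T (ob P (n - 1))"
      using biproduct_comp(2)[OF B, of z2 "n - 1"] z2 BD(1-13)[of "n - 1"] T by simp
    \<comment> \<open>The start component of \<open>z1\<close> is zero, so \<open>z1\<close> is a
      pure difference. Placed in the second summand one degree up, that difference has boundary
      \<open>z\<close>.\<close>
    define w where "w = inj2 (C (n + 1)) \<cdot> (prj2 (B n) \<cdot> z1)"
    have c: "prj2 (B n) \<cdot> z1 \<in> Arr A" "Dom A (prj2 (B n) \<cdot> z1) = T" "Cod A (prj2 (B n) \<cdot> z1) = ob P n"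
      using z1 BD(1-13)[of n] by simp_all
    have i2: "inj2 (C (n + 1)) \<in> Arr A" "Dom A (inj2 (C (n + 1))) = ob P n"
        "Cod A (inj2 (C (n + 1))) = bobj (C (n + 1))"
      using CD(5-7)[of "n + 1"] by simp_all
    have w: "w \<in> Arr A" "Dom A w = T" "Cod A w = ob Cyl (n + 1)"
      using c i2 by (simp_all add: w_def ob_Cyl)
    have "diff Cyl (n + 1) \<cdot> w = (diff Cyl (n + 1) \<cdot> inj2 (C (n + 1))) \<cdot> (prj2 (B n) \<cdot> z1)"
      unfolding w_def by (rule comp_assoc[symmetric]) (use c i2 dC(1-3)[of "n + 1"] in auto)
    also have "\<dots> = inj1 (C n) \<cdot> (inj2 (B n) \<cdot> (prj2 (B n) \<cdot> z1))"
      unfolding d2 using c CD(2-4)[of n] BD(1-7)[of n] by simp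
    also have "\<dots> = inj1 (C n) \<cdot> z1"
      using biproduct_decompose[OF B z1(1,3)] z1_0 BD(1-13)[of n] c T by simp
    also have "\<dots> = z"
      unfolding z_eq z2_0 using z1 CD(1-7)[of n] T by simp
    finally show "boundary_elem A Cyl n z"
      unfolding boundary_elem_def T_def[symmetric] using w by (intro bexI[of _ w]) (simp_all add: Hom_iff)
  next
    fix n y assume y: "cycle_elem A P n y"
    note yD = cycle_elemD[OF y]
    \<comment> \<open>Surjectivity in homology holds because \<open>i0\<close> is a strict section
      of \<open>p\<close>.\<close>
    have "p n \<cdot> (i0 n \<cdot> y) = (p n \<cdot> i0 n) \<cdot> y"
      by (rule comp_assoc[symmetric]) (use yD chain_mapD[OF i0] pD in \<open>auto simp: ob_Cyl\<close>)
    then show "\<exists>z. cycle_elem A Cyl n z \<and> Dom A z = Dom A y \<and>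
        homology_class A P n (p n \<cdot> z) = homology_class A P n y"
      using cycle_elem_map[OF i0 y] yD chain_mapD[OF i0]
      by (intro exI[of _ "i0 n \<cdot> y"]) (simp add: pi)
  qed
  note p_inv = D.inverse_pairD[OF Ch.loc_functor_inverse[OF this]]
  have Q0: "Ch.Q (Cyl, p, P) \<bullet> Ch.Q (P, i, Cyl) = Id Ch.L P" "Ch.Q (Cyl, F, Y) \<bullet> Ch.Q (P, i, Cyl) = Ch.Q (P, \<lambda>n. F n \<cdot> i n, Y)"
    if "is_chain_map A (P, i, Cyl)" "\<And>n. p n \<cdot> i n = Id A (ob P n)" for i
    using Ch.loc_functor_comp[of "(P, i, Cyl)" "(Cyl, p, P)"] Ch.loc_functor_comp[of "(P, i, Cyl)" "(Cyl, F, Y)"]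
      Ch.loc_functor_id[of P] that p F PD by simp_all
  have "Ch.Q (P, i0, Cyl) = Ch.Q (P, i1, Cyl)"
  proof -
    have "x = y" if "Ch.Q (Cyl, p, P) \<bullet> x = Ch.Q (Cyl, p, P) \<bullet> y"
      "x \<in> Hom Ch.L P Cyl" "y \<in> Hom Ch.L P Cyl" for x y
    proof -
      let ?r = "Ch.zclass (Cod (Ch A) (Cyl, p, P), [Inv (Cyl, p, P)], Dom (Ch A) (Cyl, p, P))"
      have "?r \<bullet> (Ch.Q (Cyl, p, P) \<bullet> u) = u" if "u \<in> Hom Ch.L P Cyl" for u
        using p_inv p that D.comp_assoc[of u "Ch.Q (Cyl, p, P)" ?r] by (simp add: Hom_iff)
      then show ?thesis using that by metis
    qed
    then show ?thesis
      using Q0(1)[OF i0 pi(1)] Q0(1)[OF i1 pi(2)] i0 i1 by (simp add: Hom_iff)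
  qed
  then show ?thesis
    using Q0(2)[OF i0 pi(1)] Q0(2)[OF i1 pi(2)] by (simp add: Fi)
qed

end

section \<open>Homology and maps in the derived category\<close>

context abelian_category_enough_projectives
begin

lemma letter_cases:
  assumes "letter_in (Ch A) (quasi_isos A) l"
  obtains (Fwd) X f Y where "l = Fwd (X, f, Y)" "is_chain_map A (X, f, Y)"
  | (Inv) X f Y where "l = Inv (X, f, Y)" "(X, f, Y) \<in> quasi_isos A"
proof (cases l)
  case (Fwd \<phi>)
  then show ?thesis using assms that(1) by (cases \<phi>) auto
next
  case (Inv \<phi>)
  then show ?thesis using assms that(2) by (cases \<phi>) auto
qed

lemma quasi_iso_inverse:
  assumes "(X, f, Y) \<in> quasi_isos A"
  shows "inverse_pair A (homology_map A n (X, f, Y)) (inverse_arr A (homology_map A n (X, f, Y)))"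
  using assms by (intro inverse_arr_pair) (auto simp: quasi_isos_def)

lemma homology_letter_arr:
  assumes "letter_in (Ch A) (quasi_isos A) l"
  shows "homology_letter A n l \<in> Arr A" "Dom A (homology_letter A n l) = homology A n (letter_src (Ch A) l)"
    "Cod A (homology_letter A n l) = homology A n (letter_tgt (Ch A) l)"
  using assms
  by (cases rule: letter_cases;
      use inverse_pairD(1-4)[OF quasi_iso_inverse] quasi_iso_chain_map in force)+

text \<open>An action lives on sets, so homology is probed by arrows from a fixed object
  \<open>K\<close>. Taking \<open>K\<close> to be the homology of the source and starting at its
  identity recovers the composite of the letters.\<close>

lemma zigzag_action_homology:
  assumes K: "K \<in> Obj A"
  shows "zigzag_action (Ch A) (quasi_isos A) (\<lambda>Y. Hom A K (homology A n Y))
    (\<lambda>l h. homology_letter A n l \<cdot> h)"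
proof
  show "homology_letter A n l \<cdot> h \<in> Hom A K (homology A n (letter_tgt (Ch A) l))"
    if "letter_in (Ch A) (quasi_isos A) l" "h \<in> Hom A K (homology A n (letter_src (Ch A) l))" for l h
    using homology_letter_arr[OF that(1), of n] that(2) by (simp add: Hom_iff)
  show "homology_letter A n (Fwd (\<psi> \<cdot>\<^bsub>Ch A\<^esub> \<phi>)) \<cdot> h
      = homology_letter A n (Fwd \<psi>) \<cdot> (homology_letter A n (Fwd \<phi>) \<cdot> h)"
    if arr: "\<phi> \<in> Arr (Ch A)" "\<psi> \<in> Arr (Ch A)" "Cod (Ch A) \<phi> = Dom (Ch A) \<psi>"
      and h: "h \<in> Hom A K (homology A n (Dom (Ch A) \<phi>))" for \<phi> \<psi> h
  proof -
    obtain X f Y g Z where "\<phi> = (X, f, Y)" "\<psi> = (Y, g, Z)"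
      using arr(3) by (cases \<phi>; cases \<psi>) auto
    then show ?thesis
      using arr h by (simp add: homology_map_comp Hom_iff)
  qed
  show "homology_letter A n (Fwd (Id (Ch A) X)) \<cdot> h = h"
    if "X \<in> Obj (Ch A)" "h \<in> Hom A K (homology A n X)" for X h
    using that by (simp add: homology_map_id Hom_iff)
  show "homology_letter A n (Inv s) \<cdot> (homology_letter A n (Fwd s) \<cdot> h) = h"
    if s: "s \<in> quasi_isos A" and h: "h \<in> Hom A K (homology A n (Dom (Ch A) s))" for s h
  proof -
    obtain X f Y where s': "s = (X, f, Y)" by (cases s)
    note inv = inverse_pairD[OF quasi_iso_inverse[OF s[unfolded s']], of n]
    have "is_chain_map A (X, f, Y)" using s quasi_iso_chain_map s' by auto
    then show ?thesis
      using comp_assoc[of h "homology_map A n (X, f, Y)" "inverse_arr A (homology_map A n (X, f, Y))"]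
        inv h by (simp add: s' Hom_iff)
  qed
  show "homology_letter A n (Fwd s) \<cdot> (homology_letter A n (Inv s) \<cdot> h) = h"
    if s: "s \<in> quasi_isos A" and h: "h \<in> Hom A K (homology A n (Cod (Ch A) s))" for s h
  proof -
    obtain X f Y where s': "s = (X, f, Y)" by (cases s)
    note inv = inverse_pairD[OF quasi_iso_inverse[OF s[unfolded s']], of n]
    have "is_chain_map A (X, f, Y)" using s quasi_iso_chain_map s' by auto
    then show ?thesis
      using comp_assoc[of h "inverse_arr A (homology_map A n (X, f, Y))" "homology_map A n (X, f, Y)"]
        inv h by (simp add: s' Hom_iff)
  qed
qed

text \<open>Justifies \<open>the_elem\<close> in the definition of \<open>homology_derived\<close>:
  all representatives of a class have the same composite.\<close>

lemma homology_derived_class: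
  assumes zz: "Ch.zpath X ls Y"
  shows "homology_derived A n (Ch.zclass (X, ls, Y))
    = homology_zigzag A n (X, ls, Y)"
proof -
  have X: "is_chain_complex A X" using Ch.is_zigzag_Obj[OF zz] by simp
  interpret H: zigzag_action "Ch A" "quasi_isos A" "\<lambda>Y. Hom A (homology A n X) (homology A n Y)"
      "\<lambda>l h. homology_letter A n l \<cdot> h"
    by (rule zigzag_action_homology) (use X in simp)
  let ?k = "Ch.zclass (X, ls, Y)"
  have "homology_zigzag A n q = homology_zigzag A n (X, ls, Y)" if q: "q \<in> ?k" for q
  proof -
    obtain us where us: "q = (X, us, Y)"
      using Ch.mem_zigzag_class_ends[OF q] by (cases q) auto
    have "H.acts us (Id A (homology A n X)) = H.acts ls (Id A (homology A n X))"
      using H.acts_zigzag_class_eq[of X us Y ls] Ch.mem_zigzag_class_eq[OF q] q us X zz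
      by (simp add: Ch.mem_zigzag_class Hom_iff)
    then show ?thesis by (simp add: us homology_zigzag_def H.acts_def)
  qed
  moreover have "(X, ls, Y) \<in> ?k" by (rule Ch.zigzag_class_self) (use zz in simp)
  ultimately have "homology_zigzag A n ` ?k = {homology_zigzag A n (X, ls, Y)}" by blast
  then show ?thesis by (simp add: homology_derived_def)
qed

text \<open>The fold composes on the left as it travels, so the induction needs an arbitrary initial
  \<open>h\<close>. The typing claim is proved alongside because associativity requires it.\<close>

lemma homology_letters_foldl:
  assumes "Ch.zpath X ls Y" "h \<in> Arr A" "Cod A h = homology A n X"
  shows "foldl (\<lambda>h l. homology_letter A n l \<cdot> h) h ls = homology_zigzag A n (X, ls, Y) \<cdot> h
    \<and> homology_zigzag A n (X, ls, Y) \<in> Hom A (homology A n X) (homology A n Y)"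
  using assms
proof (induction ls arbitrary: X h)
  case Nil
  then show ?case by (auto simp: homology_zigzag_def Hom_iff)
next
  case (Cons l ls)
  have l: "letter_in (Ch A) (quasi_isos A) l" "letter_src (Ch A) l = X"
      "Ch.zpath (letter_tgt (Ch A) l) ls Y"
    using Cons.prems(1) by auto
  note la = homology_letter_arr[OF l(1), of n, unfolded l(2)]
  have X: "homology A n X \<in> Obj A" using Cod_in_Obj[OF Cons.prems(2)] Cons.prems(3) by simp
  note IH = Cons.IH[OF l(3)]
  have "homology_zigzag A n (X, l # ls, Y) = homology_zigzag A n (letter_tgt (Ch A) l, ls, Y) \<cdot> homology_letter A n l"
    using IH[of "homology_letter A n l"] la X by (simp add: homology_zigzag_def)
  then show ?case
    using IH[of "homology_letter A n l \<cdot> h"] la Cons.prems(2,3) by (simp add: Hom_iff)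
qed

lemma homology_derived_Hom:
  assumes "\<phi> \<in> Hom Ch.L X Y"
  shows "homology_derived A n \<phi> \<in> Hom A (homology A n X) (homology A n Y)"
proof -
  obtain ls where ls: "Ch.zpath X ls Y" "\<phi> = Ch.zclass (X, ls, Y)"
    using assms by (rule Ch.localization_arrE)
  have "is_chain_complex A X" using Ch.is_zigzag_Obj[OF ls(1)] by simp
  then show ?thesis
    using homology_letters_foldl[OF ls(1), of "Id A (homology A n X)" n] ls
    by (simp add: homology_derived_class)
qed

lemma homology_derived_comp:
  assumes \<phi>: "\<phi> \<in> Hom Ch.L X Y" and \<psi>: "\<psi> \<in> Hom Ch.L Y Z"
  shows "homology_derived A n (\<psi> \<bullet> \<phi>) = homology_derived A n \<psi> \<cdot> homology_derived A n \<phi>"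
proof -
  obtain us where us: "Ch.zpath X us Y" "\<phi> = Ch.zclass (X, us, Y)"
    using \<phi> by (rule Ch.localization_arrE)
  obtain vs where vs: "Ch.zpath Y vs Z" "\<psi> = Ch.zclass (Y, vs, Z)"
    using \<psi> by (rule Ch.localization_arrE)
  have X: "is_chain_complex A X" using Ch.is_zigzag_Obj[OF us(1)] by simp
  have uv: "Ch.zpath X (us @ vs) Z"
    using us vs Ch.is_zigzag_append by blast
  have "homology_zigzag A n (X, us, Y) \<in> Hom A (homology A n X) (homology A n Y)"
    using homology_letters_foldl[OF us(1), of "Id A (homology A n X)" n] X by simp
  then have "homology_zigzag A n (X, us @ vs, Z) = homology_zigzag A n (Y, vs, Z) \<cdot> homology_zigzag A n (X, us, Y)"
    using homology_letters_foldl[OF vs(1), of "homology_zigzag A n (X, us, Y)" n]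
    by (simp add: homology_zigzag_def Hom_iff)
  then show ?thesis
    using us vs uv by (simp add: Ch.zigzag_class_comp homology_derived_class)
qed

lemma homology_derived_loc_functor:
  assumes f: "is_chain_map A (X, f, Y)"
  shows "homology_derived A n (Ch.Q (X, f, Y)) = homology_map A n (X, f, Y)"
  using homology_derived_class[of X "[Fwd (X, f, Y)]" Y n] f chain_mapD(1,2)[OF f]
  by (simp add: loc_functor_def homology_zigzag_def)

section \<open>Zero maps, and arrows out of complexes of projectives\<close>

lemma zero_map_comp:
  assumes f: "is_chain_map A (X, f, Y)" and Z: "is_chain_complex A Z"
  shows "zero_map A Y Z \<cdot>\<^bsub>Ch A\<^esub> (X, f, Y) = zero_map A X Z"
  using chain_mapD[OF f] Z by (simp add: zero_map_def)

text \<open>Zero arrows of the derived category are given as images of zero chain maps, so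
  absorption is proved letter by letter along a zigzag.\<close>

lemma loc_functor_zero_comp:
  assumes \<phi>: "\<phi> \<in> Hom Ch.L X Y" and Z: "is_chain_complex A Z"
  shows "Ch.Q (zero_map A Y Z) \<bullet> \<phi> = Ch.Q (zero_map A X Z)"
proof -
  have zero: "zero_map A V Z \<in> Arr (Ch A)" "Dom (Ch A) (zero_map A V Z) = V" "Cod (Ch A) (zero_map A V Z) = Z"
    if "is_chain_complex A V" for V
    using chain_map_zero[OF that Z] by (auto simp: zero_map_def)
  have zero_fwd: "Ch.Q (zero_map A V' Z) \<bullet> Ch.Q (V, f, V') = Ch.Q (zero_map A V Z)"
    if f: "is_chain_map A (V, f, V')" for V f V'
    using Ch.loc_functor_comp[of "(V, f, V')" "zero_map A V' Z"] zero[OF chain_mapD(2)[OF f]]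
      zero_map_comp[OF f Z] f by simp
  have letter: "Ch.Q (zero_map A (letter_tgt (Ch A) l) Z) \<bullet>
      Ch.zclass (letter_src (Ch A) l, [l], letter_tgt (Ch A) l)
      = Ch.Q (zero_map A (letter_src (Ch A) l) Z)"
    if "letter_in (Ch A) (quasi_isos A) l" for l
    using that
  proof (cases rule: letter_cases)
    case (Fwd V f V')
    then show ?thesis using zero_fwd[OF Fwd(2)] by (simp add: loc_functor_def[of _ _ "(V, f, V')"])
  next
    case (Inv V f V')
    note f = quasi_iso_chain_map[OF Inv(2)]
    note inv = D.inverse_pairD[OF Ch.loc_functor_inverse[OF Inv(2)], simplified]
    have 0: "Ch.Q (zero_map A V' Z) \<in> Arr Ch.L" "Dom Ch.L (Ch.Q (zero_map A V' Z)) = V'"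
      using zero[OF chain_mapD(2)[OF f]] by simp_all
    \<comment> \<open>For a formal inverse, the zero map out of \<open>V\<close> is first written as
      a zero map after \<open>f\<close>, and \<open>f\<close> then cancels.\<close>
    have "Ch.Q (zero_map A V Z) \<bullet> Ch.zclass (V', [Inv (V, f, V')], V)
      = (Ch.Q (zero_map A V' Z) \<bullet> Ch.Q (V, f, V')) \<bullet>
          Ch.zclass (V', [Inv (V, f, V')], V)"
      using zero_fwd[OF f] by simp
    also have "\<dots> = Ch.Q (zero_map A V' Z)"
      using inv 0 f by (subst D.comp_assoc) auto
    finally show ?thesis by (simp add: Inv)
  qed
  have "Ch.Q (zero_map A Y Z) \<bullet> Ch.zclass (X, ls, Y) = Ch.Q (zero_map A X Z)"
    if "Ch.zpath X ls Y" for ls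
    using that
  proof (induction ls arbitrary: X)
    case Nil
    then have Y: "X = Y" "is_chain_complex A Y" by auto
    show ?case
      using D.comp_id[of "Ch.Q (zero_map A Y Z)" Y] zero[OF Y(2)] Ch.loc_functor_arr[OF zero(1)[OF Y(2)]]
      by (simp add: Y Ch.localization_Id)
  next
    case (Cons l ls)
    let ?k = "Ch.zclass" and ?V = "letter_tgt (Ch A) l"
    have l: "letter_in (Ch A) (quasi_isos A) l" "letter_src (Ch A) l = X"
        "Ch.zpath ?V ls Y" "Ch.zpath X [l] ?V"
      using Cons.prems Ch.letter_Obj[of l] by auto
    have Y: "is_chain_complex A Y" using Ch.is_zigzag_Obj[OF l(3)] by simp
    have "Ch.Q (zero_map A Y Z) \<bullet> ?k (X, l # ls, Y)
        = Ch.Q (zero_map A Y Z) \<bullet> (?k (?V, ls, Y) \<bullet> ?k (X, [l], ?V))"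
      by (simp only: Ch.zigzag_class_Cons[OF Cons.prems])
    also have "\<dots> = (Ch.Q (zero_map A Y Z) \<bullet> ?k (?V, ls, Y)) \<bullet> ?k (X, [l], ?V)"
      by (rule D.comp_assoc[symmetric])
        (use Ch.zigzag_class_arr[OF l(3)] Ch.zigzag_class_arr[OF l(4)] zero[OF Y] in auto)
    also have "\<dots> = Ch.Q (zero_map A X Z)"
      using Cons.IH[OF l(3)] letter[OF l(1)] l(2) by simp
    finally show ?case .
  qed
  then show ?thesis
    using \<phi> by (metis Ch.localization_arrE)
qed

text \<open>Equal maps in homology give \<open>f n\<close> and \<open>g n\<close> the same class.
  Projectivity turns this into a boundary in each degree, and since \<open>P\<close> has zero
  differential these boundaries already form a homotopy.\<close>

lemma loc_functor_eq_if_homology_eq: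
  assumes P: "zero_diff A P" "\<And>n. projective_obj A (ob P n)"
    and f: "is_chain_map A (P, f, Y)" and g: "is_chain_map A (P, g, Y)"
    and eq: "\<And>n. homology_map A n (P, f, Y) = homology_map A n (P, g, Y)"
  shows "Ch.Q (P, f, Y) = Ch.Q (P, g, Y)"
proof -
  note fD = chain_mapD[OF f] and gD = chain_mapD[OF g]
  have "\<exists>w. w \<in> Arr A \<and> Dom A w = ob P n \<and> Cod A w = ob Y (n + 1) \<and> g n = f n \<oplus> diff Y (n + 1) \<cdot> w" for n
  proof -
    have "homology_class A Y n (g n) = homology_class A Y n (f n)"
      using homology_map_zero_diff[OF P(1) f, of n] homology_map_zero_diff[OF P(1) g, of n] eq by simp
    from homology_class_eqD[OF fD(2) zero_diff_chain_map_cycle[OF P(1) g]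
      zero_diff_chain_map_cycle[OF P(1) f] gD(4) fD(4) P(2) this]
    show ?thesis by metis
  qed
  then obtain k where "\<And>n. k n \<in> Arr A \<and> Dom A (k n) = ob P n \<and> Cod A (k n) = ob Y (n + 1) \<and>
      g n = f n \<oplus> diff Y (n + 1) \<cdot> k n"
    by metis
  then show ?thesis
    by (intro loc_functor_homotopic[OF P(1) f g, of k]) blast+
qed

text \<open>Each \<open>h n\<close> is a cycle, hence the image of a cycle of \<open>X\<close> up to
  a boundary. The cycles form a chain map because \<open>P\<close> has zero differential, and the
  boundaries form a homotopy.\<close>

lemma quasi_iso_lift:
  assumes P: "zero_diff A P" "\<And>n. projective_obj A (ob P n)"
    and s: "(X, s, Y) \<in> quasi_isos A" and h: "is_chain_map A (P, h, Y)"
  obtains h' where "is_chain_map A (P, h', X)" "Ch.Q (P, h, Y) = Ch.Q (X, s, Y) \<bullet> Ch.Q (P, h', X)"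
proof -
  note s' = quasi_iso_chain_map[OF s]
  note sD = chain_mapD[OF s'] and hD = chain_mapD[OF h]
  have "\<exists>z w. cycle_elem A X n z \<and> Dom A z = ob P n \<and> w \<in> Arr A \<and> Dom A w = ob P n \<and>
      Cod A w = ob Y (n + 1) \<and> h n = s n \<cdot> z \<oplus> diff Y (n + 1) \<cdot> w" for n
    using quasi_iso_surjective[OF s zero_diff_chain_map_cycle[OF P(1) h] hD(4) P(2)] by metis
  then obtain h' w where h': "\<And>n. cycle_elem A X n (h' n)" "\<And>n. Dom A (h' n) = ob P n"
    and w: "\<And>n. w n \<in> Arr A" "\<And>n. Dom A (w n) = ob P n" "\<And>n. Cod A (w n) = ob Y (n + 1)"
      "\<And>n. h n = s n \<cdot> h' n \<oplus> diff Y (n + 1) \<cdot> w n"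
    by metis
  have h'm: "is_chain_map A (P, h', X)"
    by (rule zero_diff_chain_map[OF P(1) sD(1) h'])
  have "Ch.Q (P, \<lambda>n. s n \<cdot> h' n, Y) = Ch.Q (P, h, Y)"
    by (rule loc_functor_homotopic[OF P(1) chain_map_comp[OF h'm s'] h w])
  then show ?thesis
    using that[OF h'm] Ch.loc_functor_comp[of "(P, h', X)" "(X, s, Y)"] h'm s' by simp
qed

text \<open>The zigzag is travelled starting at \<open>P\<close> while carrying a chain map out of
  \<open>P\<close>: forward letters are composed with it, and formal inverses are absorbed by
  \<open>quasi_iso_lift\<close>.\<close>

lemma localization_arr_from_projective:
  assumes P: "zero_diff A P" "\<And>n. projective_obj A (ob P n)" and \<phi>: "\<phi> \<in> Hom Ch.L P Y"
  obtains h where "is_chain_map A (P, h, Y)" "\<phi> = Ch.Q (P, h, Y)"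
proof -
  let ?k = "Ch.zclass"
  have *: "\<exists>h'. is_chain_map A (P, h', Y) \<and> ?k (X, ls, Y) \<bullet> Ch.Q (P, h, X) = Ch.Q (P, h', Y)"
    if "Ch.zpath X ls Y" "is_chain_map A (P, h, X)" for X ls h
    using that
  proof (induction ls arbitrary: X h)
    case Nil
    then show ?case
      using D.id_comp[of "Ch.Q (P, h, X)" X] by (auto simp: Ch.localization_Id intro!: exI[of _ h])
  next
    case (Cons l ls)
    let ?V = "letter_tgt (Ch A) l"
    note h = Cons.prems(2)
    have l: "letter_in (Ch A) (quasi_isos A) l" "letter_src (Ch A) l = X"
        "Ch.zpath ?V ls Y" "Ch.zpath X [l] ?V"
      using Cons.prems Ch.letter_Obj[of l] by auto
    obtain h1 where h1: "is_chain_map A (P, h1, ?V)"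
        "?k (X, [l], ?V) \<bullet> Ch.Q (P, h, X) = Ch.Q (P, h1, ?V)"
      using l(1)
    proof (cases rule: letter_cases)
      case (Fwd V f V')
      with l(2) have X: "V = X" by simp
      show ?thesis
        using that[of "\<lambda>n. f n \<cdot> h n"] Ch.loc_functor_comp[of "(P, h, X)" "(X, f, V')"]
          chain_map_comp[OF h, of f V'] Fwd h X by (simp add: loc_functor_def[of _ _ "(X, f, V')"])
    next
      case (Inv V s V')
      with l(2) have X: "V' = X" by simp
      obtain h' where h': "is_chain_map A (P, h', V)" "Ch.Q (P, h, X) = Ch.Q (V, s, X) \<bullet> Ch.Q (P, h', V)"
        using quasi_iso_lift[OF P, of V s X h] Inv h X by metis
      note inv = D.inverse_pairD[OF Ch.loc_functor_inverse[OF Inv(2)], simplified, unfolded X]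
      have "?k (X, [Inv (V, s, X)], V) \<bullet> Ch.Q (P, h, X)
          = (?k (X, [Inv (V, s, X)], V) \<bullet> Ch.Q (V, s, X)) \<bullet> Ch.Q (P, h', V)"
        unfolding h'(2)
        by (rule D.comp_assoc[symmetric])
          (use inv(1-4) h'(1) quasi_iso_chain_map[OF Inv(2)] X in auto)
      also have "\<dots> = Ch.Q (P, h', V)"
        using inv h'(1) quasi_iso_chain_map[OF Inv(2)] X by simp
      finally show ?thesis using that[of h'] h'(1) by (simp add: Inv X)
    qed
    have "?k (X, l # ls, Y) \<bullet> Ch.Q (P, h, X)
        = ?k (?V, ls, Y) \<bullet> (?k (X, [l], ?V) \<bullet> Ch.Q (P, h, X))"
      unfolding Ch.zigzag_class_Cons[OF Cons.prems(1)]
      by (rule D.comp_assoc)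
        (use Ch.zigzag_class_arr[OF l(3)] Ch.zigzag_class_arr[OF l(4)] h in auto)
    then show ?case
      using Cons.IH[OF l(3) h1(1)] h1(2) by auto
  qed
  obtain ls where ls: "Ch.zpath P ls Y" "\<phi> = ?k (P, ls, Y)"
    using \<phi> by (rule Ch.localization_arrE)
  have P': "is_chain_complex A P" using zero_diffD[OF P(1)] by blast
  have "\<phi> = \<phi> \<bullet> Ch.Q (P, \<lambda>n. Id A (ob P n), P)"
    using D.comp_id[of \<phi> P] \<phi> Ch.loc_functor_id[of P] P' by (simp add: Hom_iff)
  then show ?thesis
    using *[OF ls(1) chain_map_id[OF P']] ls(2) that by metis
qed

end

section \<open>Detecting maps out of two-term complexes of projectives\<close>

context abelian_category_enough_projectives
begin

text \<open>Homotopy classes of chain maps from the complex \<open>j : Q1 \<rightarrow> Q0\<close> of projectives (in degrees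
  \<open>n + 1\<close> and \<open>n\<close>) form a functor that inverts quasi-isomorphisms, hence is defined on the
  derived category.\<close>

lemma two_term_homotopic:
  assumes Q0: "projective_obj A Q0" and Q1: "projective_obj A Q1"
    and j: "j \<in> Arr A" "Dom A j = Q1" "Cod A j = Q0"
    and f: "is_chain_map A (X, f, Y)" and g: "is_chain_map A (X, g, Y)"
    and eq: "Ch.Q (X, f, Y) = Ch.Q (X, g, Y)"
    and a: "a \<in> Arr A" "Dom A a = Q0" "Cod A a = ob X n" "diff X n \<cdot> a = Zero A Q0 (ob X (n - 1))"
    and b: "b \<in> Arr A" "Dom A b = Q1" "Cod A b = ob X (n + 1)" "diff X (n + 1) \<cdot> b = a \<cdot> j"
  obtains h k where "h \<in> Arr A" "Dom A h = Q0" "Cod A h = ob Y (n + 1)"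
    "k \<in> Arr A" "Dom A k = Q1" "Cod A k = ob Y (n + 2)"
    "f n \<cdot> a = g n \<cdot> a \<oplus> diff Y (n + 1) \<cdot> h"
    "f (n + 1) \<cdot> b = g (n + 1) \<cdot> b \<oplus> (h \<cdot> j \<oplus> diff Y (n + 2) \<cdot> k)"
proof -
  \<comment> \<open>A chain map out of the two-term complex is encoded by its two components, so
    that no complex padded with zero objects has to be formed.\<close>
  define El where "El = (\<lambda>X :: ('a, 'b) chain_complex. {(a, b). a \<in> Hom A Q0 (ob X n) \<and> b \<in> Hom A Q1 (ob X (n + 1)) \<and>
    diff X n \<cdot> a = Zero A Q0 (ob X (n - 1)) \<and> diff X (n + 1) \<cdot> b = a \<cdot> j})"
  \<comment> \<open>A chain homotopy has just the components \<open>h\<close> and \<open>k\<close>;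
    the term \<open>h \<cdot> j\<close> comes from the differential of the two-term complex.\<close>
  define H where "H = (\<lambda>(X :: ('a, 'b) chain_complex) a b a' b'. \<exists>h \<in> Hom A Q0 (ob X (n + 1)). \<exists>k \<in> Hom A Q1 (ob X (n + 2)).
    a = a' \<oplus> diff X (n + 1) \<cdot> h \<and> b = b' \<oplus> (h \<cdot> j \<oplus> diff X (n + 2) \<cdot> k))"
  define R where "R = (\<lambda>X. {((a, b), (a', b')). (a, b) \<in> El X \<and> (a', b') \<in> El X \<and> H X a b a' b'})"
  define F :: "('a, 'b) chain_map \<Rightarrow> 'b \<times> 'b \<Rightarrow> 'b \<times> 'b"
    where "F = (\<lambda>(X, f, Y) (a, b). (f n \<cdot> a, f (n + 1) \<cdot> b))"
  \<comment> \<open>Normalization of indices can produce \<open>1 + n\<close> and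
    \<open>2 + n\<close>; these are turned back so that the rules on differentials match.\<close>
  note [simp] = add.commute[of 1 n] add.commute[of 2 n]
  have Qob: "Q0 \<in> Obj A" "Q1 \<in> Obj A" using Q0 Q1 by (auto simp: projective_obj_def)
  have ElD: "a \<in> Arr A" "Dom A a = Q0" "Cod A a = ob X n" "diff X n \<cdot> a = Zero A Q0 (ob X (n - 1))"
    "b \<in> Arr A" "Dom A b = Q1" "Cod A b = ob X (n + 1)" "diff X (n + 1) \<cdot> b = a \<cdot> j"
    if "(a, b) \<in> El X" for X a b
    using that by (auto simp: El_def Hom_iff)
  have ElI: "(a, b) \<in> El X" if "a \<in> Arr A" "Dom A a = Q0" "Cod A a = ob X n"
    "diff X n \<cdot> a = Zero A Q0 (ob X (n - 1))"
    "b \<in> Arr A" "Dom A b = Q1" "Cod A b = ob X (n + 1)" "diff X (n + 1) \<cdot> b = a \<cdot> j" for X a b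
    using that by (auto simp: El_def Hom_iff)
  have HI: "H X a b a' b'" if "h \<in> Arr A" "Dom A h = Q0" "Cod A h = ob X (n + 1)"
    "k \<in> Arr A" "Dom A k = Q1" "Cod A k = ob X (n + 2)"
    "a = a' \<oplus> diff X (n + 1) \<cdot> h" "b = b' \<oplus> (h \<cdot> j \<oplus> diff X (n + 2) \<cdot> k)" for X a b a' b' h k
    unfolding H_def
    by (rule bexI[of _ h], rule bexI[of _ k]) (use that in \<open>simp_all add: Hom_iff\<close>)
  have HE: thesis if "H X a b a' b'"
    "\<And>h k. \<lbrakk>h \<in> Arr A; Dom A h = Q0; Cod A h = ob X (n + 1);
      k \<in> Arr A; Dom A k = Q1; Cod A k = ob X (n + 2);
      a = a' \<oplus> diff X (n + 1) \<cdot> h; b = b' \<oplus> (h \<cdot> j \<oplus> diff X (n + 2) \<cdot> k)\<rbrakk> \<Longrightarrow> thesis"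
    for X a b a' b' thesis
    using that(1) unfolding H_def by (elim bexE conjE, intro that(2)) (auto simp: Hom_iff)
  have RI: "((a, b), (a', b')) \<in> R X" if "(a, b) \<in> El X" "(a', b') \<in> El X" "H X a b a' b'" for X a b a' b'
    using that by (simp add: R_def)
  have RD: "(a, b) \<in> El X" "(a', b') \<in> El X" "H X a b a' b'" if "((a, b), (a', b')) \<in> R X" for X a b a' b'
    using that by (simp_all add: R_def)

  have equiv: "equiv (El X) (R X)" if X: "is_chain_complex A X" for X
  proof (rule equivI)
    show "R X \<subseteq> El X \<times> El X" by (auto simp: R_def)
    have "((a, b), (a, b)) \<in> R X" if ab: "(a, b) \<in> El X" for a b
    proof (rule RI[OF ab ab HI])
      show "a = a \<oplus> diff X (n + 1) \<cdot> Zero A Q0 (ob X (n + 1))"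
        "b = b \<oplus> (Zero A Q0 (ob X (n + 1)) \<cdot> j \<oplus> diff X (n + 2) \<cdot> Zero A Q1 (ob X (n + 2)))"
        using ElD[OF ab] X Qob j by simp_all
    qed (use X Qob in simp_all)
    then show "refl_on (El X) (R X)" by (auto simp: refl_on_def)
    have "((a', b'), (a, b)) \<in> R X" if r: "((a, b), (a', b')) \<in> R X" for a b a' b'
    proof (rule RI[OF RD(2,1)[OF r] HE[OF RD(3)[OF r]]])
      note e = ElD[OF RD(1)[OF r]] and e' = ElD[OF RD(2)[OF r]]
      fix h k assume hk: "h \<in> Arr A" "Dom A h = Q0" "Cod A h = ob X (n + 1)"
        "k \<in> Arr A" "Dom A k = Q1" "Cod A k = ob X (n + 2)"
        "a = a' \<oplus> diff X (n + 1) \<cdot> h" "b = b' \<oplus> (h \<cdot> j \<oplus> diff X (n + 2) \<cdot> k)"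
      show "H X a' b' a b"
      proof (rule HI[of "Neg A h" _ "Neg A k"])
        show "a' = a \<oplus> diff X (n + 1) \<cdot> Neg A h"
          unfolding hk(7) using e' hk(1-6) X by simp
        have "b' = (b' \<oplus> (h \<cdot> j \<oplus> diff X (n + 2) \<cdot> k)) \<oplus> Neg A (h \<cdot> j \<oplus> diff X (n + 2) \<cdot> k)"
          using e' hk(1-6) X j by (subst add_assoc) auto
        also have "\<dots> = b \<oplus> (Neg A h \<cdot> j \<oplus> diff X (n + 2) \<cdot> Neg A k)"
          unfolding hk(8) using hk(1-6) X j by (simp add: neg_add)
        finally show "b' = b \<oplus> (Neg A h \<cdot> j \<oplus> diff X (n + 2) \<cdot> Neg A k)" .
      qed (use hk in simp_all)
    qed
    then show "sym (R X)" by (auto simp: sym_def)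
    have "((a, b), (a'', b'')) \<in> R X"
      if r: "((a, b), (a', b')) \<in> R X" and r': "((a', b'), (a'', b'')) \<in> R X" for a b a' b' a'' b''
    proof (rule RI[OF RD(1)[OF r] RD(2)[OF r'] HE[OF RD(3)[OF r]]])
      note e = ElD[OF RD(2)[OF r']]
      fix h k assume hk: "h \<in> Arr A" "Dom A h = Q0" "Cod A h = ob X (n + 1)"
        "k \<in> Arr A" "Dom A k = Q1" "Cod A k = ob X (n + 2)"
        "a = a' \<oplus> diff X (n + 1) \<cdot> h" "b = b' \<oplus> (h \<cdot> j \<oplus> diff X (n + 2) \<cdot> k)"
      show "H X a b a'' b''"
      proof (rule HE[OF RD(3)[OF r']])
        fix h' k' assume hk': "h' \<in> Arr A" "Dom A h' = Q0" "Cod A h' = ob X (n + 1)"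
          "k' \<in> Arr A" "Dom A k' = Q1" "Cod A k' = ob X (n + 2)"
          "a' = a'' \<oplus> diff X (n + 1) \<cdot> h'" "b' = b'' \<oplus> (h' \<cdot> j \<oplus> diff X (n + 2) \<cdot> k')"
        show ?thesis
        proof (rule HI[of "h' \<oplus> h" _ "k' \<oplus> k"])
          show "a = a'' \<oplus> diff X (n + 1) \<cdot> (h' \<oplus> h)"
            unfolding hk(7) hk'(7) using e hk(1-6) hk'(1-6) X by simp
          show "b = b'' \<oplus> ((h' \<oplus> h) \<cdot> j \<oplus> diff X (n + 2) \<cdot> (k' \<oplus> k))"
            unfolding hk(8) hk'(8) using e hk(1-6) hk'(1-6) X j
            by (simp add: add_left_commute[of "diff X (n + 2) \<cdot> k'" "h \<cdot> j"])
        qed (use hk(1-6) hk'(1-6) in simp_all)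
      qed
    qed
    then show "trans (R X)" by (auto simp: trans_def)
  qed

  have map_mem: "(f n \<cdot> a, f (n + 1) \<cdot> b) \<in> El Y"
    if f: "is_chain_map A (X, f, Y)" and ab: "(a, b) \<in> El X" for X f Y a b
  proof -
    note e = ElD[OF ab] and fD = chain_mapD[OF f]
    show ?thesis
      using chain_map_comp_diff[OF f, of a n] chain_map_comp_diff[OF f, of b "n + 1"] e fD(1-5) j Qob
      by (intro ElI) simp_all
  qed

  have cong: "(F \<phi> x, F \<phi> y) \<in> R (Cod (Ch A) \<phi>)"
    if \<phi>: "\<phi> \<in> Arr (Ch A)" and xy: "(x, y) \<in> R (Dom (Ch A) \<phi>)" for \<phi> x y
  proof -
    obtain X f Y where \<phi>': "\<phi> = (X, f, Y)" by (cases \<phi>)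
    obtain a b a' b' where xy': "x = (a, b)" "y = (a', b')" by (cases x; cases y)
    have f: "is_chain_map A (X, f, Y)" and r: "((a, b), (a', b')) \<in> R X"
      using \<phi> xy by (simp_all add: \<phi>' xy')
    note fD = chain_mapD[OF f] and e' = ElD[OF RD(2)[OF r]]
    have "H Y (f n \<cdot> a) (f (n + 1) \<cdot> b) (f n \<cdot> a') (f (n + 1) \<cdot> b')"
    proof (rule HE[OF RD(3)[OF r]])
      fix h k assume hk: "h \<in> Arr A" "Dom A h = Q0" "Cod A h = ob X (n + 1)"
        "k \<in> Arr A" "Dom A k = Q1" "Cod A k = ob X (n + 2)"
        "a = a' \<oplus> diff X (n + 1) \<cdot> h" "b = b' \<oplus> (h \<cdot> j \<oplus> diff X (n + 2) \<cdot> k)"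
      have fd: "diff Y (n + 1) \<cdot> (f (n + 1) \<cdot> h) = f n \<cdot> (diff X (n + 1) \<cdot> h)"
          "diff Y (n + 2) \<cdot> (f (n + 2) \<cdot> k) = f (n + 1) \<cdot> (diff X (n + 2) \<cdot> k)"
        using chain_map_comp_diff[OF f, of h "n + 1"] chain_map_comp_diff[OF f, of k "n + 2"] hk(1-6)
        by simp_all
      show ?thesis
      proof (rule HI[of "f (n + 1) \<cdot> h" _ "f (n + 2) \<cdot> k"])
        show "f n \<cdot> a = f n \<cdot> a' \<oplus> diff Y (n + 1) \<cdot> (f (n + 1) \<cdot> h)"
          unfolding hk(7) fd using e' hk(1-6) fD(1-5) by simp
        show "f (n + 1) \<cdot> b = f (n + 1) \<cdot> b' \<oplus> ((f (n + 1) \<cdot> h) \<cdot> j \<oplus> diff Y (n + 2) \<cdot> (f (n + 2) \<cdot> k))"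
          unfolding hk(8) fd using e' hk(1-6) fD(1-5) j by simp
      qed (use hk(1-6) fD(1-5) in simp_all)
    qed
    then show ?thesis
      using RI[OF map_mem[OF f RD(1)[OF r]] map_mem[OF f RD(2)[OF r]]] by (simp add: \<phi>' xy' F_def)
  qed

  have inj: "(x, y) \<in> R (Dom (Ch A) \<phi>)"
    if \<phi>: "\<phi> \<in> quasi_isos A" and x: "x \<in> El (Dom (Ch A) \<phi>)" and y: "y \<in> El (Dom (Ch A) \<phi>)"
      and xy: "(F \<phi> x, F \<phi> y) \<in> R (Cod (Ch A) \<phi>)" for \<phi> x y
  proof -
    obtain X s Y where \<phi>': "\<phi> = (X, s, Y)" by (cases \<phi>)
    obtain a b a' b' where xy': "x = (a, b)" "y = (a', b')" by (cases x; cases y)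
    have s: "(X, s, Y) \<in> quasi_isos A" and r: "((s n \<cdot> a, s (n + 1) \<cdot> b), (s n \<cdot> a', s (n + 1) \<cdot> b')) \<in> R Y"
      and El: "(a, b) \<in> El X" "(a', b') \<in> El X"
      using \<phi> xy x y by (simp_all add: \<phi>' xy' F_def)
    note s' = quasi_iso_chain_map[OF s]
    note sD = chain_mapD[OF s'] and e = ElD[OF El(1)] and e' = ElD[OF El(2)]
    have "H X a b a' b'"
    proof (rule HE[OF RD(3)[OF r]])
      fix h k assume hk: "h \<in> Arr A" "Dom A h = Q0" "Cod A h = ob Y (n + 1)"
        "k \<in> Arr A" "Dom A k = Q1" "Cod A k = ob Y (n + 2)"
        "s n \<cdot> a = s n \<cdot> a' \<oplus> diff Y (n + 1) \<cdot> h"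
        "s (n + 1) \<cdot> b = s (n + 1) \<cdot> b' \<oplus> (h \<cdot> j \<oplus> diff Y (n + 2) \<cdot> k)"
      \<comment> \<open>The difference of the two maps becomes null-homotopic in \<open>Y\<close>
        through \<open>(h, k)\<close>; this null-homotopy has to be pulled back along
        \<open>s\<close>.\<close>
      define \<alpha> \<beta> where "\<alpha> = a \<oplus> Neg A a'" and "\<beta> = b \<oplus> Neg A b'"
      have \<alpha>: "\<alpha> \<in> Arr A" "Dom A \<alpha> = Q0" "Cod A \<alpha> = ob X n" "cycle_elem A X n \<alpha>"
        using e e' sD(1) Qob by (simp_all add: \<alpha>_def cycle_elem_def)
      have \<beta>: "\<beta> \<in> Arr A" "Dom A \<beta> = Q1" "Cod A \<beta> = ob X (n + 1)" "diff X (n + 1) \<cdot> \<beta> = \<alpha> \<cdot> j"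
        using e e' sD(1) j by (simp_all add: \<alpha>_def \<beta>_def)
      have "s n \<cdot> a \<oplus> Neg A (s n \<cdot> a') = diff Y (n + 1) \<cdot> h"
        by (rule add_eq_iff_diff_eq[THEN iffD1, OF _ _ _ _ _ _ _ _ _ hk(7)])
          (use e e' hk(1-6) sD(1-5) in \<open>auto\<close>)
      then have s\<alpha>: "s n \<cdot> \<alpha> = diff Y (n + 1) \<cdot> h"
        using e e' sD(1-5) by (simp add: \<alpha>_def)
      have "s (n + 1) \<cdot> b \<oplus> Neg A (s (n + 1) \<cdot> b') = h \<cdot> j \<oplus> diff Y (n + 2) \<cdot> k"
        by (rule add_eq_iff_diff_eq[THEN iffD1, OF _ _ _ _ _ _ _ _ _ hk(8)])
          (use e e' hk(1-6) sD(1-5) j in \<open>auto\<close>)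
      then have s\<beta>: "s (n + 1) \<cdot> \<beta> = h \<cdot> j \<oplus> diff Y (n + 2) \<cdot> k"
        using e e' sD(1-5) by (simp add: \<beta>_def)
      have "boundary_elem A Y n (s n \<cdot> \<alpha>)"
        unfolding boundary_elem_def s\<alpha> using hk(1-6) sD(1-5)
        by (intro bexI[of _ h]) (simp_all add: Hom_iff)
      then have "boundary_elem A X n \<alpha>"
        using quasi_iso_injective[OF s \<alpha>(4)] \<alpha> Q0 by simp
      then obtain h0 where h0: "h0 \<in> Arr A" "Dom A h0 = Q0" "Cod A h0 = ob X (n + 1)"
          "\<alpha> = diff X (n + 1) \<cdot> h0"
        using \<alpha> by (auto simp: boundary_elem_def Hom_iff)
      \<comment> \<open>Injectivity in homology gives a first choice \<open>h0\<close>, but its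
        image need not be homotopic to \<open>h\<close>. The two differ by a cycle, which
        surjectivity replaces, up to the boundary of \<open>w\<close>, by the image of a cycle
        \<open>c\<close> of \<open>X\<close>.\<close>
      have dsh0: "diff Y (n + 1) \<cdot> (s (n + 1) \<cdot> h0) = diff Y (n + 1) \<cdot> h"
        using chain_map_comp_diff[OF s', of h0 "n + 1"] h0 s\<alpha> by simp
      have "cycle_elem A Y (n + 1) (h \<oplus> Neg A (s (n + 1) \<cdot> h0))"
        using h0(1-3) hk(1-3) sD(1-5) dsh0 Qob by (simp add: cycle_elem_def)
      moreover have "Dom A (h \<oplus> Neg A (s (n + 1) \<cdot> h0)) = Q0"
        using h0(1-3) hk(1-3) sD(1-5) by simp
      ultimately obtain c w where c: "cycle_elem A X (n + 1) c" "Dom A c = Q0"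
        and w: "w \<in> Arr A" "Dom A w = Q0" "Cod A w = ob Y (n + 1 + 1)"
        and hw: "h \<oplus> Neg A (s (n + 1) \<cdot> h0) = s (n + 1) \<cdot> c \<oplus> diff Y (n + 1 + 1) \<cdot> w"
        using quasi_iso_surjective[OF s _ _ Q0] by metis
      note cD = cycle_elemD[OF c(1)]
      have n2: "n + 1 + 1 = n + 2" by simp
      note w = w[unfolded n2] and hw = hw[unfolded n2]
      define h1 where "h1 = h0 \<oplus> c"
      have h1: "h1 \<in> Arr A" "Dom A h1 = Q0" "Cod A h1 = ob X (n + 1)" "diff X (n + 1) \<cdot> h1 = \<alpha>"
        unfolding h1_def h0(4) using h0(1-3) cD c(2) sD(1) Qob by simp_all
      have "h = s (n + 1) \<cdot> h0 \<oplus> (s (n + 1) \<cdot> c \<oplus> diff Y (n + 2) \<cdot> w)"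
        by (rule add_eq_iff_diff_eq[THEN iffD2, OF _ _ _ _ _ _ _ _ _ hw])
          (use h0(1-3) hk(1-3) cD c(2) w sD(1-5) in auto)
      then have h_eq: "h = s (n + 1) \<cdot> h1 \<oplus> diff Y (n + 2) \<cdot> w"
        using h0(1-3) cD c(2) w sD(1-5) by (simp add: h1_def)
      \<comment> \<open>With the corrected \<open>h1\<close>, the rest of \<open>\<beta>\<close> is
        a cycle whose image is the boundary of \<open>w \<cdot> j \<oplus> k\<close>. Injectivity
        one degree higher then supplies \<open>k1\<close>.\<close>
      define \<gamma> where "\<gamma> = \<beta> \<oplus> Neg A (h1 \<cdot> j)"
      have dh1j: "diff X (n + 1) \<cdot> (h1 \<cdot> j) = \<alpha> \<cdot> j"
        using comp_assoc[of j h1 "diff X (n + 1)"] h1 j sD(1) by simp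
      have \<gamma>: "\<gamma> \<in> Arr A" "Dom A \<gamma> = Q1" "Cod A \<gamma> = ob X (n + 1)" "cycle_elem A X (n + 1) \<gamma>"
        using \<beta> h1(1-3) j sD(1) \<alpha>(1-3) Qob dh1j by (simp_all add: \<gamma>_def cycle_elem_def)
      have "h \<cdot> j \<oplus> diff Y (n + 2) \<cdot> k = s (n + 1) \<cdot> (h1 \<cdot> j) \<oplus> diff Y (n + 2) \<cdot> (w \<cdot> j \<oplus> k)"
        unfolding h_eq using h1(1-3) w hk(4-6) j sD(1-5) by simp
      then have "s (n + 1) \<cdot> \<beta> = s (n + 1) \<cdot> (h1 \<cdot> j) \<oplus> diff Y (n + 2) \<cdot> (w \<cdot> j \<oplus> k)"
        using s\<beta> by simp
      then have "s (n + 1) \<cdot> \<beta> \<oplus> Neg A (s (n + 1) \<cdot> (h1 \<cdot> j)) = diff Y (n + 2) \<cdot> (w \<cdot> j \<oplus> k)"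
        by - (rule add_eq_iff_diff_eq[THEN iffD1], use \<beta>(1-3) h1(1-3) w hk(4-6) j sD(1-5) in auto)
      then have s\<gamma>: "s (n + 1) \<cdot> \<gamma> = diff Y (n + 1 + 1) \<cdot> (w \<cdot> j \<oplus> k)"
        unfolding n2 using \<beta>(1-3) h1(1-3) j sD(1-5) by (simp add: \<gamma>_def)
      have "boundary_elem A Y (n + 1) (s (n + 1) \<cdot> \<gamma>)"
        unfolding boundary_elem_def s\<gamma> using w j hk(4-6) sD(1-5)
        by (intro bexI[of _ "w \<cdot> j \<oplus> k"]) (simp_all add: Hom_iff)
      then have "boundary_elem A X (n + 1) \<gamma>"
        using quasi_iso_injective[OF s \<gamma>(4)] \<gamma>(2) Q1 by simp
      then obtain k1 where k1: "k1 \<in> Arr A" "Dom A k1 = Q1" "Cod A k1 = ob X (n + 2)"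
          "\<gamma> = diff X (n + 2) \<cdot> k1"
        using \<gamma> by (auto simp: boundary_elem_def Hom_iff)
      show ?thesis
      proof (rule HI[of h1 _ k1])
        have "a = a' \<oplus> \<alpha>"
          by (rule add_eq_iff_diff_eq[THEN iffD2, OF _ _ _ _ _ _ _ _ _ \<alpha>_def[symmetric]])
            (use e e' \<alpha> in auto)
        then show "a = a' \<oplus> diff X (n + 1) \<cdot> h1" using h1 by simp
        have "\<beta> = h1 \<cdot> j \<oplus> \<gamma>"
          by (rule add_eq_iff_diff_eq[THEN iffD2, OF _ _ _ _ _ _ _ _ _ \<gamma>_def[symmetric]])
            (use \<beta>(1-3) \<gamma>(1-3) h1(1-3) j in auto)
        moreover have "b = b' \<oplus> \<beta>"
          by (rule add_eq_iff_diff_eq[THEN iffD2, OF _ _ _ _ _ _ _ _ _ \<beta>_def[symmetric]])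
            (use e e' \<beta> in auto)
        ultimately show "b = b' \<oplus> (h1 \<cdot> j \<oplus> diff X (n + 2) \<cdot> k1)"
          using k1(4) by simp
      qed (use h1 k1 in simp_all)
    qed
    then show ?thesis using RI[OF El] by (simp add: \<phi>' xy')
  qed

  have surj: "\<exists>x\<in>El (Dom (Ch A) \<phi>). (y, F \<phi> x) \<in> R (Cod (Ch A) \<phi>)"
    if \<phi>: "\<phi> \<in> quasi_isos A" and y: "y \<in> El (Cod (Ch A) \<phi>)" for \<phi> y
  proof -
    obtain X s Y where \<phi>': "\<phi> = (X, s, Y)" by (cases \<phi>)
    obtain a b where y': "y = (a, b)" by (cases y)
    have s: "(X, s, Y) \<in> quasi_isos A" and El: "(a, b) \<in> El Y"
      using \<phi> y by (simp_all add: \<phi>' y')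
    note s' = quasi_iso_chain_map[OF s]
    note sD = chain_mapD[OF s'] and e = ElD[OF El]
    have "cycle_elem A Y n a" using e by (simp add: cycle_elem_def)
    then obtain a0 w where a0: "cycle_elem A X n a0" "Dom A a0 = Q0"
      and w: "w \<in> Arr A" "Dom A w = Q0" "Cod A w = ob Y (n + 1)"
      and aw: "a = s n \<cdot> a0 \<oplus> diff Y (n + 1) \<cdot> w"
      using quasi_iso_surjective[OF s _ e(2) Q0] by metis
    note a0D = cycle_elemD[OF a0(1)]
    \<comment> \<open>\<open>a\<close> is homotopic through \<open>w\<close> to the image of the
      cycle \<open>a0\<close>. Transporting the relation between \<open>a\<close> and
      \<open>b\<close> along \<open>w\<close> shows that \<open>a0 \<cdot> j\<close> maps to a
      boundary, whence \<open>b0\<close>.\<close>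
    have a0j: "cycle_elem A X n (a0 \<cdot> j)"
      by (rule cycle_elem_comp(1)[OF sD(1) a0(1)]) (use j a0 in auto)
    have "a \<cdot> j = diff Y (n + 1) \<cdot> (w \<cdot> j) \<oplus> s n \<cdot> (a0 \<cdot> j)"
      unfolding aw using a0D a0(2) w j sD(1-5) by (simp add: add_commute)
    then have "a \<cdot> j \<oplus> Neg A (diff Y (n + 1) \<cdot> (w \<cdot> j)) = s n \<cdot> (a0 \<cdot> j)"
      by - (rule add_eq_iff_diff_eq[THEN iffD1], use e a0D a0(2) w j sD(1-5) in auto)
    then have sa0j: "s n \<cdot> (a0 \<cdot> j) = diff Y (n + 1) \<cdot> (b \<oplus> Neg A (w \<cdot> j))"
      using e(5-8) w j sD(1-5) by simp
    have "boundary_elem A Y n (s n \<cdot> (a0 \<cdot> j))"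
      unfolding boundary_elem_def sa0j using e(5-7) w j sD(1-5)
      by (intro bexI[of _ "b \<oplus> Neg A (w \<cdot> j)"]) (simp_all add: Hom_iff)
    then have "boundary_elem A X n (a0 \<cdot> j)"
      using quasi_iso_injective[OF s a0j] a0D a0(2) j Q1 by simp
    then obtain b0 where b0: "b0 \<in> Arr A" "Dom A b0 = Q1" "Cod A b0 = ob X (n + 1)"
        "a0 \<cdot> j = diff X (n + 1) \<cdot> b0"
      using a0D a0(2) j by (auto simp: boundary_elem_def Hom_iff)
    have dsb0: "diff Y (n + 1) \<cdot> (s (n + 1) \<cdot> b0) = diff Y (n + 1) \<cdot> (b \<oplus> Neg A (w \<cdot> j))"
      using chain_map_comp_diff[OF s', of b0 "n + 1"] b0 sa0j by simp
    \<comment> \<open>The discrepancy between \<open>b\<close>, corrected by \<open>w\<close>, and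
      the image of \<open>b0\<close> is a cycle. It comes from a cycle \<open>c\<close> of
      \<open>X\<close>, which is added to \<open>b0\<close>, up to a boundary that provides the
      second component \<open>k\<close> of the homotopy.\<close>
    define y where "y = (b \<oplus> Neg A (w \<cdot> j)) \<oplus> Neg A (s (n + 1) \<cdot> b0)"
    have bwj: "b \<oplus> Neg A (w \<cdot> j) \<in> Arr A" "Dom A (b \<oplus> Neg A (w \<cdot> j)) = Q1"
        "Cod A (b \<oplus> Neg A (w \<cdot> j)) = ob Y (n + 1)"
      using e(5-7) w j by simp_all
    have sb0: "s (n + 1) \<cdot> b0 \<in> Arr A" "Dom A (s (n + 1) \<cdot> b0) = Q1" "Cod A (s (n + 1) \<cdot> b0) = ob Y (n + 1)"
      using b0 sD(1-5) by simp_all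
    have yD: "y \<in> Arr A" "Dom A y = Q1" "Cod A y = ob Y (n + 1)"
      unfolding y_def using bwj sb0 by (auto simp del: add_assoc)
    have "diff Y (n + 1) \<cdot> y = diff Y (n + 1) \<cdot> (b \<oplus> Neg A (w \<cdot> j)) \<oplus> Neg A (diff Y (n + 1) \<cdot> (s (n + 1) \<cdot> b0))"
      unfolding y_def by (subst comp_add_right) (use bwj sb0 sD(1-5) in auto)
    also have "\<dots> = Zero A Q1 (ob Y n)"
      unfolding dsb0 by (subst add_neg) (use bwj sD(1-5) in auto)
    finally have "cycle_elem A Y (n + 1) y" using yD by (simp add: cycle_elem_def)
    then obtain c k where c: "cycle_elem A X (n + 1) c" "Dom A c = Q1"
      and k: "k \<in> Arr A" "Dom A k = Q1" "Cod A k = ob Y (n + 1 + 1)"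
      and yk: "y = s (n + 1) \<cdot> c \<oplus> diff Y (n + 1 + 1) \<cdot> k"
      using quasi_iso_surjective[OF s _ yD(2) Q1] by metis
    have n2: "n + 1 + 1 = n + 2" by simp
    note k = k[unfolded n2] and yk = yk[unfolded n2]
    note cD = cycle_elemD[OF c(1)]
    define b1 where "b1 = b0 \<oplus> c"
    have b1: "b1 \<in> Arr A" "Dom A b1 = Q1" "Cod A b1 = ob X (n + 1)" "diff X (n + 1) \<cdot> b1 = a0 \<cdot> j"
      unfolding b1_def b0(4) using b0(1-3) cD c(2) sD(1) Qob by simp_all
    have El1: "(a0, b1) \<in> El X" by (rule ElI) (use a0D a0(2) b1 in auto)
    have "b \<oplus> Neg A (w \<cdot> j) = s (n + 1) \<cdot> b0 \<oplus> y"
      by (rule add_eq_iff_diff_eq[THEN iffD2, OF _ _ _ _ _ _ _ _ _ y_def[symmetric]])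
        (use bwj sb0 yD in auto)
    then have "b = w \<cdot> j \<oplus> (s (n + 1) \<cdot> b0 \<oplus> y)"
      by - (rule add_eq_iff_diff_eq[THEN iffD2], use e(5-7) w j sb0 yD in auto)
    also have "\<dots> = s (n + 1) \<cdot> b1 \<oplus> (w \<cdot> j \<oplus> diff Y (n + 2) \<cdot> k)"
      unfolding yk b1_def using w j b0(1-3) cD c(2) k sD(1-5) by (simp add: add_ac)
    finally have b_eq: "b = s (n + 1) \<cdot> b1 \<oplus> (w \<cdot> j \<oplus> diff Y (n + 2) \<cdot> k)" .
    have "((a, b), (s n \<cdot> a0, s (n + 1) \<cdot> b1)) \<in> R Y"
      by (rule RI[OF El map_mem[OF s' El1] HI[OF w k aw b_eq]])
    then show ?thesis using El1 by (intro bexI[of _ "(a0, b1)"]) (simp_all add: \<phi>' y' F_def)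
  qed

  have "(F (X, f, Y) (a, b), F (X, g, Y) (a, b)) \<in> R Y"
  proof (rule Ch.loc_functor_eq_setoid[where El = El and R = R and F = F and X = X])
    show "equiv (El X) (R X)" if "X \<in> Obj (Ch A)" for X using equiv that by simp
    show "F (\<psi> \<cdot>\<^bsub>Ch A\<^esub> \<phi>) x = F \<psi> (F \<phi> x)"
      if arr: "\<phi> \<in> Arr (Ch A)" "\<psi> \<in> Arr (Ch A)" "Cod (Ch A) \<phi> = Dom (Ch A) \<psi>"
        and x: "x \<in> El (Dom (Ch A) \<phi>)" for \<phi> \<psi> x
    proof -
      obtain X f Y g Z where "\<phi> = (X, f, Y)" "\<psi> = (Y, g, Z)"
        using arr(3) by (cases \<phi>; cases \<psi>) auto
      moreover obtain a b where "x = (a, b)" by (cases x)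
      ultimately show ?thesis
        using arr x chain_mapD(1-5)[of X f Y] chain_mapD(1-5)[of Y g Z] ElD[of a b X]
        by (simp add: F_def)
    qed
    show "F (Id (Ch A) X) x = x" if "X \<in> Obj (Ch A)" "x \<in> El X" for X x
      using that ElD[of "fst x" "snd x" X] by (cases x) (simp add: F_def)
    show "(X, f, Y) \<in> Hom (Ch A) X Y" "(X, g, Y) \<in> Hom (Ch A) X Y"
      using f g by (simp_all add: Hom_iff)
    show "(a, b) \<in> El X" by (rule ElI[OF a b])
  qed (fact cong inj surj eq)+
  then have "H Y (f n \<cdot> a) (f (n + 1) \<cdot> b) (g n \<cdot> a) (g (n + 1) \<cdot> b)"
    using RD(3) by (simp add: F_def)
  then show ?thesis using that by (elim HE) blast
qed

end

section \<open>The projective class\<close>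

context abelian_category_enough_projectives
begin

lemma zero_diff_projective_cover:
  assumes X: "is_chain_complex A X"
  obtains P u where "zero_diff A P" "\<And>n. projective_obj A (ob P n)" "is_chain_map A (P, u, X)"
    "\<And>n. epi_arr A (homology_class A X n (u n))"
proof -
  have "\<exists>T z. projective_obj A T \<and> cycle_elem A X n z \<and> Dom A z = T \<and>
      epi_arr A (homology_class A X n z)" for n
  proof -
    have "homology A n X \<in> Obj A" using X by simp
    then obtain T e where e: "projective_obj A T" "epi_arr A e" "e \<in> Arr A" "Dom A e = T"
        "Cod A e = homology A n X"
      by (rule projective_cover)
    obtain z where "cycle_elem A X n z" "Dom A z = T" "homology_class A X n z = e"
      using X e(1,3,4,5) by (rule homology_class_surj)
    then show ?thesis using e by auto
  qed
  then obtain T z where Tz: "\<And>n. projective_obj A (T n)" "\<And>n. cycle_elem A X n (z n)"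
      "\<And>n. Dom A (z n) = T n" "\<And>n. epi_arr A (homology_class A X n (z n))"
    by metis
  have P: "zero_diff A (zero_diff_complex A T)"
    using Tz(1) by (intro zero_diff_complex) (simp add: projective_obj_def)
  show ?thesis
    by (rule that[OF P, of z]) (use Tz zero_diff_chain_map[OF P X Tz(2)] in auto)
qed

text \<open>In the cone, \<open>u n\<close> becomes the boundary of \<open>inj2\<close> one degree
  up, as the differential of \<open>P\<close> contributes nothing. So the inclusion kills the class
  of \<open>u n\<close>, which is epi.\<close>

lemma homology_cone_incl_zero:
  assumes P: "zero_diff A P" and u: "is_chain_map A (P, u, X)"
    and epi: "epi_arr A (homology_class A X n (u n))"
  shows "homology_map A n (cone_incl A (P, u, X)) = Zero A (homology A n X) (homology A n (cone A (P, u, X)))"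
proof -
  define C where "C = cone A (P, u, X)"
  define B where "B = cone_summands A (P, u, X)"
  note PD = zero_diffD[OF P] and uD = chain_mapD[OF u]
  note CD = is_biproductD[OF cone_biproduct[OF u], folded B_def]
  have incl: "is_chain_map A (X, \<lambda>n. inj1 (B n), C)"
    using cone_incl_chain_map[OF u] by (simp add: cone_incl_def B_def C_def)
  note iD = chain_mapD[OF incl]
  have z: "cycle_elem A X n (u n)" by (rule zero_diff_chain_map_cycle[OF P u])
  have "inj1 (B n) \<cdot> u n = diff C (n + 1) \<cdot> inj2 (B (n + 1))"
    using cone_diff(5)[OF u, of "n + 1", folded B_def C_def] CD(1-13)[of n] PD uD(1-5) by simp
  moreover have "inj2 (B (n + 1)) \<in> Hom A (Dom A (inj1 (B n) \<cdot> u n)) (ob C (n + 1))"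
    using CD(1-7)[of "n + 1"] CD(1-4)[of n] uD(1-5) by (simp add: Hom_iff C_def cone_ob B_def)
  ultimately have "boundary_elem A C n (inj1 (B n) \<cdot> u n)"
    unfolding boundary_elem_def by blast
  then have "homology_map A n (X, \<lambda>n. inj1 (B n), C) \<cdot> homology_class A X n (u n)
      = Zero A (ob P n) (homology A n C)"
    using homology_map_class[OF incl z] boundary_elemD(2)[OF iD(2), of n] uD(1-5) CD(1-4)[of n] by simp
  then have "homology_map A n (X, \<lambda>n. inj1 (B n), C) = Zero A (homology A n X) (homology A n C)"
    using epi_zeroD[OF epi, of "homology_map A n (X, \<lambda>n. inj1 (B n), C)"] incl z uD(1-5) by simp
  then show ?thesis by (simp add: cone_incl_def B_def C_def)
qed

section \<open>The shift on the derived category\<close>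

lemma shift_complex_simps [simp]:
  "ob (shift_complex A X) n = ob X (n - 1)" "diff (shift_complex A X) n = Neg A (diff X (n - 1))"
  by (simp_all add: shift_complex_def)

text \<open>The sign of the shifted differential changes neither the cycles nor, after negating the
  witness, the boundaries.\<close>

lemma cycle_elem_shift:
  assumes X: "is_chain_complex A X"
  shows "cycle_elem A (shift_complex A X) n z \<longleftrightarrow> cycle_elem A X (n - 1) z"
  unfolding cycle_elem_def
  using neg_eq_zero_iff[of "diff X (n - 1) \<cdot> z" "Dom A z" "ob X (n - 1 - 1)"] X by auto

lemma boundary_elem_shift:
  assumes X: "is_chain_complex A X"
  shows "boundary_elem A (shift_complex A X) n z \<longleftrightarrow> boundary_elem A X (n - 1) z"
proof -
  have "(\<exists>w\<in>Hom A T (ob X n). z = Neg A (diff X n) \<cdot> w)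
      \<longleftrightarrow> (\<exists>w\<in>Hom A T (ob X n). z = diff X n \<cdot> w)" for T
  proof
    assume "\<exists>w\<in>Hom A T (ob X n). z = Neg A (diff X n) \<cdot> w"
    then obtain w where "w \<in> Hom A T (ob X n)" "z = Neg A (diff X n) \<cdot> w" by blast
    then show "\<exists>w\<in>Hom A T (ob X n). z = diff X n \<cdot> w"
      using X by (intro bexI[of _ "Neg A w"]) (simp_all add: Hom_iff)
  next
    assume "\<exists>w\<in>Hom A T (ob X n). z = diff X n \<cdot> w"
    then obtain w where "w \<in> Hom A T (ob X n)" "z = diff X n \<cdot> w" by blast
    then show "\<exists>w\<in>Hom A T (ob X n). z = Neg A (diff X n) \<cdot> w"
      using X by (intro bexI[of _ "Neg A w"]) (simp_all add: Hom_iff)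
  qed
  then show ?thesis by (simp add: boundary_elem_def)
qed

lemma shift_chain_map:
  assumes f: "is_chain_map A (X, f, Y)"
  shows "is_chain_map A (shift_complex A X, \<lambda>n. f (n - 1), shift_complex A Y)"
  by (rule chain_mapI) (use chain_mapD[OF f] shift_complex_complex in auto)

text \<open>Lets the shift act on formal inverses as well, so that it preserves zigzags and their
  moves.\<close>

lemma shift_quasi_iso:
  assumes s: "(X, s, Y) \<in> quasi_isos A"
  shows "(shift_complex A X, \<lambda>n. s (n - 1), shift_complex A Y) \<in> quasi_isos A"
proof -
  note s' = quasi_iso_chain_map[OF s]
  note sD = chain_mapD[OF s']
  show ?thesis
  proof (rule quasi_isoI[OF shift_chain_map[OF s']])
    fix n z assume "projective_obj A (Dom A z)" "cycle_elem A (shift_complex A X) n z"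
      "boundary_elem A (shift_complex A Y) n (s (n - 1) \<cdot> z)"
    then show "boundary_elem A (shift_complex A X) n z"
      using quasi_iso_injective[OF s, of "n - 1" z] sD(1,2)
      by (simp add: cycle_elem_shift boundary_elem_shift)
  next
    fix n y assume T: "projective_obj A (Dom A y)" and y: "cycle_elem A (shift_complex A Y) n y"
    have "cycle_elem A Y (n - 1) y" using y sD(2) by (simp add: cycle_elem_shift)
    then obtain z w where z: "cycle_elem A X (n - 1) z" "Dom A z = Dom A y"
      and w: "w \<in> Arr A" "Dom A w = Dom A y" "Cod A w = ob Y (n - 1 + 1)"
      and yzw: "y = s (n - 1) \<cdot> z \<oplus> diff Y (n - 1 + 1) \<cdot> w"
      using quasi_iso_surjective[OF s _ refl T] by metis
    note SX = shift_complex_complex[OF sD(1)] and SY = shift_complex_complex[OF sD(2)]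
    have z': "cycle_elem A (shift_complex A X) n z"
      using z(1) sD(1) by (simp add: cycle_elem_shift)
    note sz = cycle_elem_map[OF shift_chain_map[OF s'] z']
    note zD = cycle_elemD[OF z(1)]
    have "y = s (n - 1) \<cdot> z \<oplus> diff (shift_complex A Y) (n + 1) \<cdot> Neg A w"
      using yzw w sD(2) by simp
    moreover have "homology_class A (shift_complex A Y) n
        (s (n - 1) \<cdot> z \<oplus> diff (shift_complex A Y) (n + 1) \<cdot> Neg A w)
      = homology_class A (shift_complex A Y) n (s (n - 1) \<cdot> z)"
      by (rule homology_class_add_boundary(2)[OF SY sz]) (use w z(2) zD sD in auto)
    ultimately have "homology_class A (shift_complex A Y) n (s (n - 1) \<cdot> z)
        = homology_class A (shift_complex A Y) n y"
      by metis
    then show "\<exists>z. cycle_elem A (shift_complex A X) n z \<and> Dom A z = Dom A y \<and>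
        homology_class A (shift_complex A Y) n (s (n - 1) \<cdot> z) = homology_class A (shift_complex A Y) n y"
      using z z' by auto
  qed
qed

lemma shift_letter:
  assumes "letter_in (Ch A) (quasi_isos A) l"
  shows "letter_in (Ch A) (quasi_isos A) (map_letter (shift_map A) l)"
    "letter_src (Ch A) (map_letter (shift_map A) l) = shift_complex A (letter_src (Ch A) l)"
    "letter_tgt (Ch A) (map_letter (shift_map A) l) = shift_complex A (letter_tgt (Ch A) l)"
  using assms
  by (cases rule: letter_cases;
      simp add: shift_map_def shift_chain_map shift_quasi_iso quasi_iso_chain_map)+

lemma shift_is_zigzag:
  "Ch.zpath X ls Y \<Longrightarrow>
    Ch.zpath (shift_complex A X) (map (map_letter (shift_map A)) ls) (shift_complex A Y)"
  by (induction ls arbitrary: X) (auto simp: shift_letter shift_complex_complex)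

lemma shift_elem_reduction:
  assumes "elem_reduction (Ch A) (quasi_isos A) ls ls'"
  shows "elem_reduction (Ch A) (quasi_isos A) (map (map_letter (shift_map A)) ls)
    (map (map_letter (shift_map A)) ls')"
  using assms
proof (cases rule: elem_reduction.cases)
  case (Comp f g)
  obtain X f' Y g' Z where fg: "f = (X, f', Y)" "g = (Y, g', Z)"
    using Comp(5) by (cases f; cases g) auto
  have "is_chain_map A (X, f', Y)" "is_chain_map A (Y, g', Z)"
    using Comp(3,4) fg by auto
  then show ?thesis
    using elem_reduction.Comp[of "shift_map A f" "Ch A" "shift_map A g" "quasi_isos A"]
    by (simp add: Comp(1,2) fg shift_map_def shift_chain_map)
next
  case (Id X)
  then show ?thesis
    using elem_reduction.Id[of "shift_complex A X" "Ch A" "quasi_isos A"]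
    by (simp add: shift_map_def shift_complex_complex)
next
  case (Fwd_Inv s)
  obtain X f Y where s: "s = (X, f, Y)" by (cases s)
  show ?thesis
    using elem_reduction.Fwd_Inv[OF shift_quasi_iso[OF Fwd_Inv(3)[unfolded s]], of "Ch A"]
    by (simp add: Fwd_Inv s shift_map_def)
next
  case (Inv_Fwd s)
  obtain X f Y where s: "s = (X, f, Y)" by (cases s)
  show ?thesis
    using elem_reduction.Inv_Fwd[OF shift_quasi_iso[OF Inv_Fwd(3)[unfolded s]], of "Ch A"]
    by (simp add: Inv_Fwd s shift_map_def)
qed

lemma shift_zigzag_step:
  assumes "zigzag_step (Ch A) (quasi_isos A) p q"
  shows "zigzag_step (Ch A) (quasi_isos A) (shift_zigzag A p) (shift_zigzag A q)"
proof -
  obtain X Y us ls ls' vs where pq: "p = (X, us @ ls @ vs, Y)" "q = (X, us @ ls' @ vs, Y)"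
      "elem_reduction (Ch A) (quasi_isos A) ls ls'"
    and zz: "Ch.zpath X (us @ ls @ vs) Y"
      "Ch.zpath X (us @ ls' @ vs) Y"
    using assms unfolding zigzag_step_def by auto
  let ?s = "map (map_letter (shift_map A))"
  show ?thesis
    unfolding zigzag_step_def
    using pq shift_is_zigzag[OF zz(1)] shift_is_zigzag[OF zz(2)] shift_elem_reduction[OF pq(3)]
    by (intro conjI exI[of _ "shift_complex A X"] exI[of _ "shift_complex A Y"] exI[of _ "?s us"]
      exI[of _ "?s ls"] exI[of _ "?s ls'"] exI[of _ "?s vs"]) (simp_all add: shift_zigzag_def)
qed

text \<open>A cone triangle is shown to be exact by comparing it with itself through identities, and
  the comparison involves the shift of one of them.\<close>

lemma shift_derived_id:
  assumes X: "is_chain_complex A X"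
  shows "shift_derived A (Id Ch.L X) = Id Ch.L (shift_complex A X)"
proof -
  let ?k = "Ch.zclass"
  have "?k (shift_zigzag A p) = ?k (shift_complex A X, [], shift_complex A X)"
    if "p \<in> ?k (X, [], X)" for p
  proof -
    have "equivclp (zigzag_step (Ch A) (quasi_isos A)) (X, [], X) p"
      using that by (simp add: Ch.mem_zigzag_class)
    then have "?k (shift_zigzag A (X, [], X)) = ?k (shift_zigzag A p)"
      by (rule Ch.equivclp_zigzag_invariant) (rule Ch.zigzag_class_stepI[OF shift_zigzag_step])
    then show ?thesis by (simp add: shift_zigzag_def)
  qed
  moreover have "(X, [], X) \<in> ?k (X, [], X)" by (rule Ch.zigzag_class_self) (use X in simp)
  ultimately show ?thesis
    by (auto simp: shift_derived_def Ch.localization_Id)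
qed

text \<open>Unfolds the record extension once, so that later arguments take place in the
  localization \<open>Ch.L\<close>.\<close>

lemma derived_category_simps:
  "Obj (derived_category A) = {X. is_chain_complex A X}" "Arr (derived_category A) = Arr Ch.L"
  "Dom (derived_category A) = Dom Ch.L" "Cod (derived_category A) = Cod Ch.L"
  "Id (derived_category A) = Id Ch.L" "Comp (derived_category A) = Comp Ch.L"
  "Hom (derived_category A) X Y = Hom Ch.L X Y"
  "iso_obj (derived_category A) X Y \<longleftrightarrow> iso_obj Ch.L X Y"
  "tzero (derived_category A) X Y = Ch.Q (zero_map A X Y)"
  "susp_obj (derived_category A) = shift_complex A"
  "exact_triangles (derived_category A) = derived_triangles A"
  by (auto simp: derived_category_def derived_loc_def derived_functor_Q_def category_data.extend_def
      triangulated_data.fields_def Hom_def iso_obj_def iso_arr_def inverse_pair_def localization_def)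

section \<open>Ghosts, ghost projectives and their triangles\<close>

lemma mem_ghosts_iff:
  assumes "\<phi> \<in> Hom Ch.L X Y"
  shows "\<phi> \<in> ghosts A \<longleftrightarrow> (\<forall>n. homology_derived A n \<phi> = Zero A (homology A n X) (homology A n Y))"
  using assms by (simp add: ghosts_def derived_category_simps Hom_iff)

lemma mem_ghost_projectives_iff:
  "X \<in> ghost_projectives A \<longleftrightarrow> is_chain_complex A X \<and>
    (\<exists>P. zero_diff A P \<and> (\<forall>n. projective_obj A (ob P n)) \<and> iso_obj Ch.L X P)"
  unfolding ghost_projectives_def derived_category_simps zero_diff_def by blast

lemma zero_diff_ghost_projective:
  assumes "zero_diff A P" "\<And>n. projective_obj A (ob P n)"
  shows "P \<in> ghost_projectives A"
proof -
  have P: "is_chain_complex A P" using zero_diffD[OF assms(1)] by blast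
  then have "iso_obj Ch.L P P"
    unfolding iso_obj_def using D.Id_Hom D.iso_arr_id by force
  then show ?thesis using assms P mem_ghost_projectives_iff by blast
qed

text \<open>Transported along an isomorphism to \<open>P\<close>, the composite comes from a chain
  map out of projectives with zero differential. Its homology is zero because that of
  \<open>\<phi>\<close> is, and such chain maps are determined in the localization by
  homology.\<close>

lemma ghost_comp_ghost_projective:
  assumes X: "X \<in> ghost_projectives A" and \<phi>: "\<phi> \<in> Hom Ch.L Y Z" "\<phi> \<in> ghosts A" and \<psi>: "\<psi> \<in> Hom Ch.L X Y"
  shows "\<phi> \<bullet> \<psi> = Ch.Q (zero_map A X Z)"
proof -
  obtain P a b where P: "zero_diff A P" "\<And>n. projective_obj A (ob P n)"
    and a: "a \<in> Hom Ch.L X P" and ab: "inverse_pair Ch.L a b"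
    using X by (auto simp: mem_ghost_projectives_iff iso_obj_def iso_arr_def)
  note abD = D.inverse_pairD[OF ab]
  have b: "b \<in> Hom Ch.L P X" using a abD by (simp add: Hom_iff)
  have \<phi>\<psi>: "\<phi> \<bullet> \<psi> \<in> Hom Ch.L X Z" by (rule D.Comp_Hom[OF \<psi> \<phi>(1)])
  have \<phi>\<psi>b: "(\<phi> \<bullet> \<psi>) \<bullet> b \<in> Hom Ch.L P Z" by (rule D.Comp_Hom[OF b \<phi>\<psi>])
  obtain h where h: "is_chain_map A (P, h, Z)" "(\<phi> \<bullet> \<psi>) \<bullet> b = Ch.Q (P, h, Z)"
    using localization_arr_from_projective[OF P \<phi>\<psi>b] by blast
  note hD = chain_mapD[OF h(1)]
  have zero: "is_chain_map A (P, \<lambda>n. Zero A (ob P n) (ob Z n), Z)"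
    using chain_map_zero[OF hD(1,2)] by (simp add: zero_map_def)
  have "homology_map A n (P, h, Z) = homology_map A n (P, \<lambda>n. Zero A (ob P n) (ob Z n), Z)" for n
  proof -
    have Y: "is_chain_complex A Y" "is_chain_complex A X"
      using \<psi> D.Dom_in_Obj D.Cod_in_Obj by (auto simp: Hom_iff)
    have "homology_map A n (P, h, Z) = (homology_derived A n \<phi> \<cdot> homology_derived A n \<psi>) \<cdot> homology_derived A n b"
      using homology_derived_loc_functor[OF h(1), of n] homology_derived_comp[OF b \<phi>\<psi>, of n]
        homology_derived_comp[OF \<psi> \<phi>(1), of n] h(2) by simp
    also have "\<dots> = Zero A (homology A n P) (homology A n Z)"
      using mem_ghosts_iff[OF \<phi>(1)] \<phi>(2) homology_derived_Hom[OF \<psi>, of n] homology_derived_Hom[OF b, of n]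
        hD(2) Y by (simp add: Hom_iff)
    finally show ?thesis
      using homology_map_zero[OF hD(1,2), of n] by (simp add: zero_map_def)
  qed
  then have "Ch.Q (P, h, Z) = Ch.Q (zero_map A P Z)"
    using loc_functor_eq_if_homology_eq[OF P h(1) zero] by (simp add: zero_map_def)
  then have "((\<phi> \<bullet> \<psi>) \<bullet> b) \<bullet> a = Ch.Q (zero_map A P Z) \<bullet> a"
    using h(2) by simp
  also have "\<dots> = Ch.Q (zero_map A X Z)" by (rule loc_functor_zero_comp[OF a hD(2)])
  also have "((\<phi> \<bullet> \<psi>) \<bullet> b) \<bullet> a = (\<phi> \<bullet> \<psi>) \<bullet> (b \<bullet> a)"
    by (rule D.comp_assoc) (use \<phi>\<psi> a b in \<open>auto simp: Hom_iff\<close>)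
  also have "\<dots> = \<phi> \<bullet> \<psi>"
    unfolding abD(5) by (rule D.comp_id) (use \<phi>\<psi> a in \<open>auto simp: Hom_iff\<close>)
  finally show ?thesis .
qed

text \<open>One test arrow suffices: the map \<open>u : P \<rightarrow> X\<close> that is epi in
  homology. If its composite with \<open>\<phi>\<close> is zero, the homology of
  \<open>\<phi>\<close> vanishes after an epi.\<close>

lemma ghostI:
  assumes \<phi>: "\<phi> \<in> Hom Ch.L X Y"
    and zero: "\<And>P \<psi>. P \<in> ghost_projectives A \<Longrightarrow> \<psi> \<in> Hom Ch.L P X \<Longrightarrow> \<phi> \<bullet> \<psi> = Ch.Q (zero_map A P Y)"
  shows "\<phi> \<in> ghosts A"
proof -
  have XY: "is_chain_complex A X" "is_chain_complex A Y"
    using \<phi> D.Dom_in_Obj D.Cod_in_Obj by (auto simp: Hom_iff)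
  obtain P u where P: "zero_diff A P" "\<And>n. projective_obj A (ob P n)" and u: "is_chain_map A (P, u, X)"
      and epi: "\<And>n. epi_arr A (homology_class A X n (u n))"
    using zero_diff_projective_cover[OF XY(1)] by blast
  have Qu: "Ch.Q (P, u, X) \<in> Hom Ch.L P X" using u by (simp add: Hom_iff)
  have "homology_derived A n \<phi> = Zero A (homology A n X) (homology A n Y)" for n
  proof -
    note H\<phi> = homology_derived_Hom[OF \<phi>, of n, unfolded Hom_iff]
    have PX: "is_chain_complex A P" using chain_mapD[OF u] by blast
    have id: "cycle_elem A P n (Id A (ob P n))"
      by (rule zero_diff_cycle[OF P(1)]) (use PX in auto)
    have "homology_derived A n \<phi> \<cdot> homology_map A n (P, u, X) = homology_map A n (zero_map A P Y)"
      using homology_derived_comp[OF Qu \<phi>, of n] zero[OF zero_diff_ghost_projective[OF P] Qu]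
        homology_derived_loc_functor[OF u, of n] chain_map_zero[OF PX XY(2)]
        homology_derived_loc_functor[of P "\<lambda>n. Zero A (ob P n) (ob Y n)" Y n]
      by (simp add: zero_map_def)
    also have "\<dots> = Zero A (homology A n P) (homology A n Y)" by (rule homology_map_zero[OF PX XY(2)])
    finally have "(homology_derived A n \<phi> \<cdot> homology_map A n (P, u, X)) \<cdot> homology_class A P n (Id A (ob P n))
        = Zero A (ob P n) (homology A n Y)"
      using PX XY id by simp
    then have "homology_derived A n \<phi> \<cdot> homology_class A X n (u n) = Zero A (ob P n) (homology A n Y)"
      using homology_map_zero_diff[OF P(1) u, of n] H\<phi> u id PX by simp
    then show ?thesis
      using epi_zeroD[OF epi[of n], of "homology_derived A n \<phi>"] H\<phi> XY chain_mapD[OF u]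
        zero_diff_chain_map_cycle[OF P(1) u] by simp
  qed
  then show ?thesis using mem_ghosts_iff[OF \<phi>] by simp
qed

lemma cone_triangle:
  assumes f: "is_chain_map A (X, f, Y)"
  shows "(Ch.Q (X, f, Y), Ch.Q (cone_incl A (X, f, Y)), Ch.Q (cone_proj A (X, f, Y))) \<in> derived_triangles A"
proof -
  note fD = chain_mapD[OF f]
  let ?C = "cone A (X, f, Y)" and ?S = "shift_complex A X"
  have C: "is_chain_complex A ?C" by (rule cone_complex[OF f])
  have S: "is_chain_complex A ?S" by (rule shift_complex_complex[OF fD(1)])
  have Qf: "Ch.Q (X, f, Y) \<in> Hom Ch.L X Y" using f by (simp add: Hom_iff)
  have Qi: "Ch.Q (cone_incl A (X, f, Y)) \<in> Hom Ch.L Y ?C"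
    using cone_incl_chain_map[OF f] by (simp add: Hom_iff cone_incl_def)
  have Qp: "Ch.Q (cone_proj A (X, f, Y)) \<in> Hom Ch.L ?C ?S"
    using cone_proj_chain_map[OF f] by (simp add: Hom_iff cone_proj_def)
  have id: "Id Ch.L V \<in> Hom Ch.L V V" "iso_arr Ch.L (Id Ch.L V)" if "is_chain_complex A V" for V
    using that D.Id_Hom D.iso_arr_id by auto
  show ?thesis
    unfolding derived_triangles_def Let_def derived_loc_def derived_functor_Q_def
  proof (simp only: mem_Collect_eq prod.case, rule exI[of _ X], rule exI[of _ Y], rule exI[of _ ?C],
      intro conjI Qf Qi Qp, rule exI[of _ X], rule exI[of _ Y], rule exI[of _ "(X, f, Y)"],
      rule exI[of _ "Id Ch.L X"], rule exI[of _ "Id Ch.L Y"], rule exI[of _ "Id Ch.L ?C"], intro conjI)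
    show "(X, f, Y) \<in> Hom (Ch A) X Y" using f by (simp add: Hom_iff)
  qed (simp_all only: id fD(1,2) C shift_derived_id D.Id_Comp[OF Qf] D.Comp_Id[OF Qf]
      D.Id_Comp[OF Qi] D.Comp_Id[OF Qi] D.Id_Comp[OF Qp] D.Comp_Id[OF Qp])
qed

lemma ghost_triangle:
  assumes X: "is_chain_complex A X"
  obtains P u where "P \<in> ghost_projectives A" "zero_diff A P" "\<forall>n. projective_obj A (ob P n)"
    "is_chain_map A (P, u, X)" "\<forall>n. epi_arr A (homology_class A X n (u n))"
    "Ch.Q (cone_incl A (P, u, X)) \<in> ghosts A"
proof -
  obtain P u where P: "zero_diff A P" "\<And>n. projective_obj A (ob P n)" and u: "is_chain_map A (P, u, X)"
      and epi: "\<And>n. epi_arr A (homology_class A X n (u n))"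
    using zero_diff_projective_cover[OF X] by blast
  have incl: "is_chain_map A (X, \<lambda>n. inj1 (cone_summands A (P, u, X) n), cone A (P, u, X))"
    using cone_incl_chain_map[OF u] by (simp add: cone_incl_def)
  then have "Ch.Q (cone_incl A (P, u, X)) \<in> Hom Ch.L X (cone A (P, u, X))"
    by (simp add: cone_incl_def Hom_iff)
  then have "Ch.Q (cone_incl A (P, u, X)) \<in> ghosts A"
    using homology_cone_incl_zero[OF P(1) u epi] homology_derived_loc_functor[OF incl]
    by (simp add: mem_ghosts_iff cone_incl_def)
  then show ?thesis
    using that zero_diff_ghost_projective[OF P] P u epi by blast
qed

text \<open>If the ghost \<open>X \<rightarrow> cone u\<close> vanishes, the map from \<open>j : Q1 \<rightarrow> P\<^sub>n\<close> to \<open>X\<close> given by \<open>u\<close>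
  becomes null-homotopic in \<open>cone u\<close>, and the null-homotopy splits \<open>P\<^sub>n \<rightarrow> H\<^sub>n(X)\<close>.\<close>

lemma homology_projective:
  assumes X: "is_chain_complex A X"
    and zero: "\<And>Y \<phi>. \<phi> \<in> Hom Ch.L X Y \<Longrightarrow> \<phi> \<in> ghosts A \<Longrightarrow> \<phi> = Ch.Q (zero_map A X Y)"
  shows "projective_obj A (homology A n X)"
proof -
  obtain P u where "P \<in> ghost_projectives A" and P: "zero_diff A P"
      and proj: "\<forall>n. projective_obj A (ob P n)" and u: "is_chain_map A (P, u, X)"
      and epi: "\<forall>n. epi_arr A (homology_class A X n (u n))"
      and ghost: "Ch.Q (cone_incl A (P, u, X)) \<in> ghosts A"
    by (rule ghost_triangle[OF X])
  note P = P proj[rule_format] and epi = epi[rule_format]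
  note PD = zero_diffD[OF P(1)] and uD = chain_mapD[OF u]
  define C where "C = cone A (P, u, X)"
  define B where "B = cone_summands A (P, u, X)"
  note Bb = cone_biproduct[OF u, folded B_def]
  note BD = is_biproductD[OF Bb]
  note prj = cone_diff_prj[OF u, folded B_def C_def]
  have C: "is_chain_complex A C" unfolding C_def by (rule cone_complex[OF u])
  have ob_C: "ob C m = bobj (B m)" for m by (simp add: C_def B_def cone_ob)
  have incl: "is_chain_map A (X, \<lambda>n. inj1 (B n), C)" "cone_incl A (P, u, X) = (X, \<lambda>n. inj1 (B n), C)"
    using cone_incl_chain_map[OF u] by (simp_all add: cone_incl_def B_def C_def)
  have zero_XC: "is_chain_map A (X, \<lambda>n. Zero A (ob X n) (ob C n), C)"
    using chain_map_zero[OF X C] by (simp add: zero_map_def)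
  have Q_eq: "Ch.Q (X, \<lambda>n. inj1 (B n), C) = Ch.Q (X, \<lambda>n. Zero A (ob X n) (ob C n), C)"
    using zero[of _ C] ghost incl by (simp add: Hom_iff zero_map_def)

  have z: "cycle_elem A X n (u n)" by (rule zero_diff_chain_map_cycle[OF P(1) u])
  define e where "e = homology_class A X n (u n)"
  have e: "e \<in> Arr A" "Dom A e = ob P n" "Cod A e = homology A n X" "epi_arr A e"
    using X z uD epi by (simp_all add: e_def)
  define i where "i = kernel_arr A e"
  have ker: "is_kernel A e i" unfolding i_def by (rule kernel_arr_kernel[OF e(1)])
  note iD = is_kernelD[OF ker]
  obtain Q1 t where t: "projective_obj A Q1" "epi_arr A t" "t \<in> Arr A" "Dom A t = Q1" "Cod A t = Dom A i"
    using projective_cover[of "Dom A i"] iD by auto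
  \<comment> \<open>\<open>Q1\<close> maps onto the kernel of \<open>e\<close>, so \<open>j\<close>
    presents \<open>homology A n X\<close> as its cokernel.\<close>
  define j where "j = i \<cdot> t"
  have j: "j \<in> Arr A" "Dom A j = Q1" "Cod A j = ob P n" using iD e t by (simp_all add: j_def)
  have Q1: "Q1 \<in> Obj A" using t by auto
  have "e \<cdot> j = (e \<cdot> i) \<cdot> t" unfolding j_def by (rule comp_assoc[symmetric]) (use iD e t in auto)
  then have ej: "e \<cdot> j = Zero A Q1 (homology A n X)" unfolding iD(4) using t e iD X by simp
  have uj: "cycle_elem A X n (u n \<cdot> j)" "homology_class A X n (u n \<cdot> j) = e \<cdot> j"
    using cycle_elem_comp[OF X z, of j] j uD by (simp_all add: e_def)
  have "boundary_elem A X n (u n \<cdot> j)"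
    by (rule homology_class_zeroD[OF X uj(1)]) (use uj(2) ej j uD(1-5) t in simp_all)
  \<comment> \<open>The pair \<open>(u n, b)\<close> is the map from the two-term complex to
    \<open>X\<close> on which the vanishing of the ghost is tested.\<close>
  then obtain b where b: "b \<in> Arr A" "Dom A b = Q1" "Cod A b = ob X (n + 1)" "diff X (n + 1) \<cdot> b = u n \<cdot> j"
    using j uD(1-5) by (auto simp: boundary_elem_def Hom_iff)

  have uc: "diff X n \<cdot> u n = Zero A (ob P n) (ob X (n - 1))" using cycle_elemD(3)[OF z] uD(4) by simp
  obtain h k where h: "h \<in> Arr A" "Dom A h = ob P n" "Cod A h = ob C (n + 1)"
    and k: "k \<in> Arr A" "Dom A k = Q1" "Cod A k = ob C (n + 2)"
    and uh: "inj1 (B n) \<cdot> u n = Zero A (ob X n) (ob C n) \<cdot> u n \<oplus> diff C (n + 1) \<cdot> h"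
    and bh: "inj1 (B (n + 1)) \<cdot> b = Zero A (ob X (n + 1)) (ob C (n + 1)) \<cdot> b \<oplus> (h \<cdot> j \<oplus> diff C (n + 2) \<cdot> k)"
    using two_term_homotopic[OF P(2) t(1) j incl(1) zero_XC Q_eq uD(3,4,5) uc b] by blast
  \<comment> \<open>The component \<open>h2\<close> is the endomorphism of \<open>ob P n\<close>
    that will factor through \<open>e\<close>; \<open>h1\<close> contributes only a boundary and
    disappears in homology.\<close>
  define h1 h2 where "h1 = prj1 (B (n + 1)) \<cdot> h" and "h2 = prj2 (B (n + 1)) \<cdot> h"
  have h1: "h1 \<in> Arr A" "Dom A h1 = ob P n" "Cod A h1 = ob X (n + 1)"
    and h2: "h2 \<in> Arr A" "Dom A h2 = ob P n" "Cod A h2 = ob P n"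
    using h BD(8-13)[of "n + 1"] by (simp_all add: h1_def h2_def ob_C)
  have prjC: "prj1 (B n) \<cdot> (diff C (n + 1) \<cdot> h) = diff X (n + 1) \<cdot> h1 \<oplus> u n \<cdot> h2"
  proof -
    have "prj1 (B n) \<cdot> (diff C (n + 1) \<cdot> h) = (prj1 (B n) \<cdot> diff C (n + 1)) \<cdot> h"
      by (rule comp_assoc[symmetric]) (use h C BD(8-13)[of n] in \<open>simp_all add: ob_C\<close>)
    also have "\<dots> = diff X (n + 1) \<cdot> h1 \<oplus> u n \<cdot> h2"
      using prj(1)[of "n + 1"] h BD(8-13)[of "n + 1"] uD(1-5) by (simp add: h1_def h2_def ob_C)
    finally show ?thesis .
  qed
  have "inj1 (B n) \<cdot> u n = diff C (n + 1) \<cdot> h"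
    using uh h C uD(1-5) by simp
  then have "prj1 (B n) \<cdot> (inj1 (B n) \<cdot> u n) = diff X (n + 1) \<cdot> h1 \<oplus> u n \<cdot> h2"
    using prjC by simp
  then have "u n = diff X (n + 1) \<cdot> h1 \<oplus> u n \<cdot> h2"
    using biproduct_comp(1)[OF Bb, of "u n" n] uD(1-5) by simp
  then have u_eq: "u n = u n \<cdot> h2 \<oplus> diff X (n + 1) \<cdot> h1"
    using add_commute[of "diff X (n + 1) \<cdot> h1" "u n \<cdot> h2"] h1 h2 uD(1-5) by simp
  have uh2: "cycle_elem A X n (u n \<cdot> h2)" "homology_class A X n (u n \<cdot> h2) = e \<cdot> h2"
    using cycle_elem_comp[OF X z, of h2] h2 uD(1-5) by (simp_all add: e_def)
  have "homology_class A X n (u n \<cdot> h2 \<oplus> diff X (n + 1) \<cdot> h1) = homology_class A X n (u n \<cdot> h2)"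
    by (rule homology_class_add_boundary(2)[OF X uh2(1)]) (use h1 h2 uD(1-5) in auto)
  then have e_h2: "e \<cdot> h2 = e" unfolding u_eq[symmetric] uh2(2) e_def by simp

  \<comment> \<open>Projected to \<open>ob P n\<close>, the boundary of \<open>k\<close> vanishes
    because \<open>P\<close> has zero differential, and \<open>inj1\<close> after \<open>b\<close>
    has no second component. So the second homotopy equation reduces to \<open>h2 \<cdot> j\<close>
    being zero.\<close>
  have "prj2 (B (n + 1)) \<cdot> (diff C (n + 2) \<cdot> k) = (prj2 (B (n + 1)) \<cdot> diff C (n + 2)) \<cdot> k"
    by (rule comp_assoc[symmetric]) (use k C BD(8-13)[of "n + 1"] in \<open>simp_all add: ob_C add.commute[of 1 n]\<close>)
  also have "prj2 (B (n + 1)) \<cdot> diff C (n + 2) = Zero A (bobj (B (n + 2))) (ob P n)"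
    using prj(2)[of "n + 2"] PD BD(1)[of "n + 2"] BD(8-13)[of "n + 2"] by (simp add: add.commute[of 1 n])
  finally have dk: "prj2 (B (n + 1)) \<cdot> (diff C (n + 2) \<cdot> k) = Zero A Q1 (ob P n)"
    using k PD by (simp add: ob_C)
  have "inj1 (B (n + 1)) \<cdot> b = h \<cdot> j \<oplus> diff C (n + 2) \<cdot> k"
    using bh b h j k C by (simp add: add.commute[of 1 n])
  then have "prj2 (B (n + 1)) \<cdot> (inj1 (B (n + 1)) \<cdot> b) = prj2 (B (n + 1)) \<cdot> (h \<cdot> j \<oplus> diff C (n + 2) \<cdot> k)"
    by simp
  also have "\<dots> = h2 \<cdot> j"
    using h j k C PD Q1 BD(8-13)[of "n + 1"] dk by (simp add: h2_def ob_C add.commute[of 1 n])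
  finally have h2j: "h2 \<cdot> j = Zero A Q1 (ob P n)"
    using biproduct_comp(3)[OF Bb, of b "n + 1"] b by simp
  \<comment> \<open>As \<open>t\<close> is epi, \<open>h2\<close> kills the whole kernel of
    \<open>e\<close> and descends along \<open>e\<close>.\<close>
  have "h2 \<cdot> i = Zero A (Cod A t) (Cod A (h2 \<cdot> i))"
    by (rule epi_zeroD[OF t(2)]) (use h2 h2j iD e t in \<open>simp_all add: j_def\<close>)
  then have "h2 \<cdot> i = Zero A (Dom A i) (Cod A h2)"
    unfolding t(5) using h2 iD e by simp
  then obtain r where r: "r \<in> Arr A" "Dom A r = homology A n X" "Cod A r = ob P n" "r \<cdot> e = h2"
    using epi_factor_kernel[OF e(4) ker, of h2] h2 e by metis
  have "(e \<cdot> r) \<cdot> e = Id A (homology A n X) \<cdot> e"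
    using e r e_h2 by simp
  then have "e \<cdot> r = Id A (homology A n X)"
    by - (rule epi_arrD[OF e(4)], use e r X in auto)
  then show ?thesis
    by (intro projective_retract[OF P(2)[of n], of r _ e]) (use e r in \<open>simp_all add: Hom_iff\<close>)
qed

text \<open>Projectivity allows the identity of \<open>homology A n X\<close> to be represented by a
  cycle \<open>s n\<close>. By \<open>class_s\<close>, composing with \<open>s n\<close> and then
  taking the class changes nothing, and both conditions of \<open>quasi_isoI\<close> follow.\<close>

lemma ghost_projectiveI:
  assumes X: "is_chain_complex A X" and proj: "\<And>n. projective_obj A (homology A n X)"
  shows "X \<in> ghost_projectives A"
proof -
  define P where "P = zero_diff_complex A (\<lambda>n. homology A n X)"
  have P: "zero_diff A P" unfolding P_def by (rule zero_diff_complex) (use X in simp)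
  have ob_P: "ob P n = homology A n X" for n by (simp add: P_def)
  have "\<exists>z. cycle_elem A X n z \<and> Dom A z = homology A n X \<and> homology_class A X n z = Id A (homology A n X)" for n
    using homology_class_surj[OF X proj, of "Id A (homology A n X)" n n] X by auto
  then obtain s where s: "\<And>n. cycle_elem A X n (s n)" "\<And>n. Dom A (s n) = homology A n X"
      "\<And>n. homology_class A X n (s n) = Id A (homology A n X)"
    by metis
  have sm: "is_chain_map A (P, s, X)"
    by (rule zero_diff_chain_map[OF P X]) (use s ob_P in auto)
  note sD = chain_mapD[OF sm]
  have class_s: "homology_class A X n (s n \<cdot> y) = y" if "y \<in> Arr A" "Cod A y = homology A n X" for n y
    using cycle_elem_comp(2)[OF X s(1), of y n] s(2,3) that by simp
  have "(P, s, X) \<in> quasi_isos A"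
  proof (rule quasi_isoI[OF sm])
    fix n z assume z: "cycle_elem A P n z" and b: "boundary_elem A X n (s n \<cdot> z)"
    note zD = cycle_elemD[OF z, unfolded ob_P]
    have "z = Zero A (Dom A z) (ob P n)"
      using boundary_elemD(2)[OF X b] class_s[of z n] zD sD(1-5) by (simp add: ob_P)
    also have "\<dots> = diff P (n + 1) \<cdot> Zero A (Dom A z) (ob P (n + 1))"
      using zD sD(1) by simp
    finally show "boundary_elem A P n z"
      unfolding boundary_elem_def using zD sD(1)
      by (intro bexI[of _ "Zero A (Dom A z) (ob P (n + 1))"]) (simp_all add: Hom_iff)
  next
    fix n y assume y: "cycle_elem A X n y"
    note yD = cycle_elemD[OF y]
    let ?z = "homology_class A X n y"
    have "cycle_elem A P n ?z" by (rule zero_diff_cycle[OF P]) (use X y ob_P in auto)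
    then show "\<exists>z. cycle_elem A P n z \<and> Dom A z = Dom A y \<and>
        homology_class A X n (s n \<cdot> z) = homology_class A X n y"
      using class_s[of ?z n] X y by (intro exI[of _ ?z]) simp
  qed
  then have inv: "inverse_pair Ch.L (Ch.Q (P, s, X)) (Ch.zclass (X, [Inv (P, s, X)], P))"
    using Ch.loc_functor_inverse by fastforce
  note invD = D.inverse_pairD[OF inv]
  have "inverse_pair Ch.L (Ch.zclass (X, [Inv (P, s, X)], P)) (Ch.Q (P, s, X))"
    unfolding inverse_pair_def Hom_iff using invD by simp
  then have "iso_obj Ch.L X P"
    unfolding iso_obj_def iso_arr_def using invD sm by (auto simp: Hom_iff)
  then show ?thesis
    using X P proj ob_P by (auto simp: mem_ghost_projectives_iff)
qed

theorem projective_class_ghosts: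
  "projective_class (derived_category A) (ghost_projectives A) (ghosts A)"
  unfolding projective_class_def derived_category_simps
proof (intro conjI ballI)
  have gp_Obj: "is_chain_complex A P" if "P \<in> ghost_projectives A" for P
    using that by (simp add: mem_ghost_projectives_iff)
  have ghost_Hom: "\<phi> \<in> Hom Ch.L (Dom Ch.L \<phi>) (Cod Ch.L \<phi>)" if "\<phi> \<in> ghosts A" for \<phi>
    using that by (simp add: ghosts_def derived_category_simps Hom_iff)
  show "ghosts A = {f \<in> Arr Ch.L. \<forall>P\<in>ghost_projectives A. \<forall>g\<in>Hom Ch.L P (Dom Ch.L f).
      f \<bullet> g = Ch.Q (zero_map A P (Cod Ch.L f))}" (is "_ = ?I")
  proof
    show "ghosts A \<subseteq> ?I"
      using ghost_Hom ghost_comp_ghost_projective by (fastforce simp: Hom_iff[of _ Ch.L "Dom _ _" "Cod _ _"])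
    show "?I \<subseteq> ghosts A"
    proof
      fix f assume "f \<in> ?I"
      then show "f \<in> ghosts A"
        by (intro ghostI[of f "Dom Ch.L f" "Cod Ch.L f"]) (auto simp: Hom_iff)
    qed
  qed
  show "ghost_projectives A = {P \<in> {X. is_chain_complex A X}. \<forall>f\<in>ghosts A. \<forall>g\<in>Hom Ch.L P (Dom Ch.L f).
      f \<bullet> g = Ch.Q (zero_map A P (Cod Ch.L f))}" (is "_ = ?P")
  proof
    show "ghost_projectives A \<subseteq> ?P"
      using gp_Obj ghost_Hom ghost_comp_ghost_projective by blast
    show "?P \<subseteq> ghost_projectives A"
    proof
      fix X assume "X \<in> ?P"
      then have X: "is_chain_complex A X" and zero: "\<And>f g. f \<in> ghosts A \<Longrightarrow> g \<in> Hom Ch.L X (Dom Ch.L f)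
          \<Longrightarrow> f \<bullet> g = Ch.Q (zero_map A X (Cod Ch.L f))"
        by auto
      \<comment> \<open>Taking \<open>g\<close> to be the identity turns the vanishing of composites
        into the vanishing of every ghost out of \<open>X\<close>.\<close>
      have "\<phi> = Ch.Q (zero_map A X Y)" if "\<phi> \<in> Hom Ch.L X Y" "\<phi> \<in> ghosts A" for \<phi> Y
        using zero[OF that(2), of "Id Ch.L X"] that D.Comp_Id[OF that(1)] D.Id_Hom[of X] X
        by (auto simp: Hom_iff)
      then show "X \<in> ghost_projectives A"
        using ghost_projectiveI[OF X homology_projective[OF X]] by blast
    qed
  qed
  fix X assume "X \<in> {X. is_chain_complex A X}"
  then have X: "is_chain_complex A X" by simp
  obtain P u where P: "P \<in> ghost_projectives A" and "zero_diff A P" "\<forall>n. projective_obj A (ob P n)"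
      and u: "is_chain_map A (P, u, X)" and "\<forall>n. epi_arr A (homology_class A X n (u n))"
      and ghost: "Ch.Q (cone_incl A (P, u, X)) \<in> ghosts A"
    by (rule ghost_triangle[OF X])
  show "\<exists>P\<in>ghost_projectives A. \<exists>Y\<in>{X. is_chain_complex A X}. \<exists>u\<in>Hom Ch.L P X. \<exists>v\<in>Hom Ch.L X Y.
      \<exists>w\<in>Hom Ch.L Y (shift_complex A P). (u, v, w) \<in> derived_triangles A \<and> v \<in> ghosts A"
  proof (rule bexI[OF _ P], rule bexI, rule bexI, rule bexI, rule bexI, rule conjI)
    show "(Ch.Q (P, u, X), Ch.Q (cone_incl A (P, u, X)), Ch.Q (cone_proj A (P, u, X))) \<in> derived_triangles A"
      by (rule cone_triangle[OF u])
    show "Ch.Q (cone_proj A (P, u, X)) \<in> Hom Ch.L (cone A (P, u, X)) (shift_complex A P)"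
      using cone_proj_chain_map[OF u] by (simp add: Hom_iff cone_proj_def)
    show "Ch.Q (cone_incl A (P, u, X)) \<in> Hom Ch.L X (cone A (P, u, X))"
      using cone_incl_chain_map[OF u] by (simp add: Hom_iff cone_incl_def)
    show "Ch.Q (P, u, X) \<in> Hom Ch.L P X" using u by (simp add: Hom_iff)
    show "cone A (P, u, X) \<in> {X. is_chain_complex A X}" using cone_complex[OF u] by simp
  qed (rule ghost)
qed

end

theorem proposition8p2:
  fixes A :: "('o, 'm) preadditive_data"
  assumes "abelian_category A"
    and "enough_projectives A"
    and "AB5 TYPE('i :: infinite) A"
  shows "projective_class (derived_category A) (ghost_projectives A) (ghosts A)"
proof -
  interpret abelian_category_enough_projectives A
    by (intro abelian_category_enough_projectives.intro abelian_category_enough_projectives_axioms.intro assms)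
  show ?thesis by (rule projective_class_ghosts)
qed

end
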